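(* Let $G$ be an amenable separable metrisable topological group with the local property (OB). The following are equivalent: (1) $G$ admits a uniformly continuous coarse embedding $\eta\colon G\to\mathcal{H}$ into a Hilbert space $\mathcal{H}$; (2) $G$ has the Haagerup property.
   Context: A metric on $G$ is compatible if it induces the topology of $G$, and left-invariant if $d(hg,hf)=d(g,f)$ for all $g,f,h\in G$. A subset $A\subseteq G$ has property (OB) relative to $G$ if it has finite diameter with respect to every compatible left-invariant metric on $G$; $G$ has the local property (OB) if some neighbourhood of $1$ has property (OB) relative to $G$. A sequence $(g_n)$ in $G$ tends to infinity, written $g_n\to\infty$, if $\partial(g_n,1)\to\infty$ for some compatible left-invariant metric $\partial$ on $G$. A compatible left-invariant metric $d$ is metrically proper if $d(g_n,1)\to\infty$ whenever $g_n\to\infty$. A separable metrisable group with the local property (OB) admits a metrically proper compatible left-invariant metric $d$, and "uniformly continuous coarse embedding" refers to any such $d$ (the notion does not depend on the choice). For a map $F\colon (X,d_X)\to(Y,d_Y)$ between metric spaces put $\kappa_1(t)=\inf\{d_Y(Fx_1,Fx_2): d_X(x_1,x_2)\geqslant t\}$ and $\kappa_2(t)=\sup\{d_Y(Fx_1,Fx_2): d_X(x_1,x_2)\leqslant t\}$. $F$ is a coarse embedding if $\lim_{t\to\infty}\kappa_1(t)=\infty$ and $\kappa_2(t)<\infty$ for all $t\in[0,\infty)$. An affine isometric action of $G$ on a Banach space $X$ is an action $\alpha(g)\xi=\pi(g)\xi+b(g)$, where $\pi$ is a representation by invertible linear isometries of $X$ and $b(gf)=\pi(g)b(f)+b(g)$.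 It is metrically proper if for all $\xi\in X$, $\|\alpha(g_n)\xi-\xi\|\to\infty$ whenever $g_n\to\infty$. A metrisable group has the Haagerup property if it admits a metrically proper continuous affine isometric action on a Hilbert space. Let $\mathrm{LUC}(G)$ be the space of bounded functions $\phi\colon G\to\mathbb{R}$ such that for every $\epsilon>0$ there is an open $W\ni 1$ with $|\phi(f)-\phi(fw)|<\epsilon$ for all $f\in G$, $w\in W$. $G$ is amenable (in the usual sense of topological groups) if there is a mean on $\mathrm{LUC}(G)$ invariant under right translations $\phi\mapsto\phi(\,\cdot\,g)$. *)

theory Defs
  imports "HOL-Analysis.Analysis"
begin

section \<open>Coarse geometry of topological groups\<close>

text \<open>
  Topological groups are types of class \<^class>\<open>topological_group_add\<close>. The group law is written
  additively but is not assumed to be commutative, so \<open>0\<close> is the neutral element.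
\<close>

text \<open>The equation of topologies forces \<^term>\<open>mspace d = UNIV\<close>.\<close>

definition compatible_left_invariant :: "'g::topological_group_add metric \<Rightarrow> bool" where
  "compatible_left_invariant d \<longleftrightarrow>
     mtopology_of d = euclidean \<and> (\<forall>g f h. mdist d (h + g) (h + f) = mdist d g f)"

definition OB_set :: "'g::topological_group_add set \<Rightarrow> bool" where
  "OB_set A \<longleftrightarrow>
     (\<forall>d. compatible_left_invariant d \<longrightarrow> (\<exists>K. \<forall>x\<in>A. \<forall>y\<in>A. mdist d x y \<le> K))"

definition locally_OB :: "'g::topological_group_add itself \<Rightarrow> bool" where
  "locally_OB _ \<longleftrightarrow> (\<exists>V::'g set. 0 \<in> interior V \<and> OB_set V)"

definition tends_to_infinity :: "(nat \<Rightarrow> 'g::topological_group_add) \<Rightarrow> bool" where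
  "tends_to_infinity g \<longleftrightarrow>
     (\<exists>d. compatible_left_invariant d \<and> filterlim (\<lambda>n. mdist d (g n) 0) at_top sequentially)"

definition metrically_proper_metric :: "'g::topological_group_add metric \<Rightarrow> bool" where
  "metrically_proper_metric d \<longleftrightarrow> compatible_left_invariant d \<and>
     (\<forall>g. tends_to_infinity g \<longrightarrow> filterlim (\<lambda>n. mdist d (g n) 0) at_top sequentially)"

text \<open>
  In \<^typ>\<open>ereal\<close> the infimum over the empty set is \<open>\<infinity>\<close>, so for a bounded source the
  compression modulus is eventually \<open>\<infinity>\<close>.
\<close>

definition compression_modulus :: "'a metric \<Rightarrow> 'b metric \<Rightarrow> ('a \<Rightarrow> 'b) \<Rightarrow> real \<Rightarrow> ereal" where
  "compression_modulus X Y F t =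
     Inf {ereal (mdist Y (F x1) (F x2)) | x1 x2. x1 \<in> mspace X \<and> x2 \<in> mspace X \<and> mdist X x1 x2 \<ge> t}"

definition expansion_modulus :: "'a metric \<Rightarrow> 'b metric \<Rightarrow> ('a \<Rightarrow> 'b) \<Rightarrow> real \<Rightarrow> ereal" where
  "expansion_modulus X Y F t =
     Sup {ereal (mdist Y (F x1) (F x2)) | x1 x2. x1 \<in> mspace X \<and> x2 \<in> mspace X \<and> mdist X x1 x2 \<le> t}"

definition coarse_embedding :: "'a metric \<Rightarrow> 'b metric \<Rightarrow> ('a \<Rightarrow> 'b) \<Rightarrow> bool" where
  "coarse_embedding X Y F \<longleftrightarrow> F \<in> mspace X \<rightarrow> mspace Y \<and>
     (compression_modulus X Y F \<longlongrightarrow> \<infinity>) at_top \<and>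
     (\<forall>t\<ge>0. expansion_modulus X Y F t < \<infinity>)"


section \<open>Amenability\<close>

definition LUC :: "('g::topological_group_add \<Rightarrow> real) set" where
  "LUC = {\<phi>. bounded (range \<phi>) \<and>
     (\<forall>\<epsilon>>0. \<exists>W. open W \<and> 0 \<in> W \<and> (\<forall>f. \<forall>w\<in>W. \<bar>\<phi> f - \<phi> (f + w)\<bar> < \<epsilon>))}"

text \<open>Only the values of \<open>m\<close> on \<^const>\<open>LUC\<close> matter.\<close>

definition mean_on_LUC :: "(('g::topological_group_add \<Rightarrow> real) \<Rightarrow> real) \<Rightarrow> bool" where
  "mean_on_LUC m \<longleftrightarrow>
     (\<forall>\<phi>\<in>LUC. \<forall>\<psi>\<in>LUC. m (\<lambda>x. \<phi> x + \<psi> x) = m \<phi> + m \<psi>) \<and>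
     (\<forall>c. \<forall>\<phi>\<in>LUC. m (\<lambda>x. c * \<phi> x) = c * m \<phi>) \<and>
     (\<forall>\<phi>\<in>LUC. (\<forall>x. 0 \<le> \<phi> x) \<longrightarrow> 0 \<le> m \<phi>) \<and>
     m (\<lambda>_. 1) = 1"

definition amenable :: "'g::topological_group_add itself \<Rightarrow> bool" where
  "amenable _ \<longleftrightarrow>
     (\<exists>m :: ('g \<Rightarrow> real) \<Rightarrow> real. mean_on_LUC m \<and> (\<forall>\<phi>\<in>LUC. \<forall>g. m (\<lambda>x. \<phi> (x + g)) = m \<phi>))"


section \<open>Hilbert spaces on carrier sets\<close>

text \<open>
  The existence of a Hilbert space cannot be expressed by quantifying over types of class
  \<^class>\<open>real_inner\<close>. We therefore quantify over all real Hilbert space structures whose underlying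
  set is a subset of an arbitrary type \<open>'h\<close>, which plays the role of a universe.
  Every Hilbert space is isomorphic to one of these as soon as \<open>'h\<close> is large enough. A statement
  proved for every \<open>'h\<close> therefore carries no restriction on the size of the Hilbert spaces.
\<close>

record 'h inner_structure =
  hcarrier :: "'h set"
  hzero :: 'h
  hadd :: "'h \<Rightarrow> 'h \<Rightarrow> 'h"
  hscale :: "real \<Rightarrow> 'h \<Rightarrow> 'h"
  hinner :: "'h \<Rightarrow> 'h \<Rightarrow> real"

locale inner_space =
  fixes H :: "'h inner_structure"
  assumes zero_closed: "hzero H \<in> hcarrier H"
    and add_closed: "\<lbrakk>x \<in> hcarrier H; y \<in> hcarrier H\<rbrakk> \<Longrightarrow> hadd H x y \<in> hcarrier H"
    and scale_closed: "x \<in> hcarrier H \<Longrightarrow> hscale H a x \<in> hcarrier H"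
    and add_assoc: "\<lbrakk>x \<in> hcarrier H; y \<in> hcarrier H; z \<in> hcarrier H\<rbrakk> \<Longrightarrow>
          hadd H (hadd H x y) z = hadd H x (hadd H y z)"
    and add_commute: "\<lbrakk>x \<in> hcarrier H; y \<in> hcarrier H\<rbrakk> \<Longrightarrow> hadd H x y = hadd H y x"
    and add_zero: "x \<in> hcarrier H \<Longrightarrow> hadd H x (hzero H) = x"
    and add_uminus: "x \<in> hcarrier H \<Longrightarrow> hadd H x (hscale H (-1) x) = hzero H"
    and scale_scale: "x \<in> hcarrier H \<Longrightarrow> hscale H a (hscale H b x) = hscale H (a * b) x"
    and scale_one: "x \<in> hcarrier H \<Longrightarrow> hscale H 1 x = x"
    and scale_add_right: "\<lbrakk>x \<in> hcarrier H; y \<in> hcarrier H\<rbrakk> \<Longrightarrow>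
          hscale H a (hadd H x y) = hadd H (hscale H a x) (hscale H a y)"
    and scale_add_left: "x \<in> hcarrier H \<Longrightarrow>
          hscale H (a + b) x = hadd H (hscale H a x) (hscale H b x)"
    and inner_commute: "\<lbrakk>x \<in> hcarrier H; y \<in> hcarrier H\<rbrakk> \<Longrightarrow> hinner H x y = hinner H y x"
    and inner_add_left: "\<lbrakk>x \<in> hcarrier H; y \<in> hcarrier H; z \<in> hcarrier H\<rbrakk> \<Longrightarrow>
          hinner H (hadd H x y) z = hinner H x z + hinner H y z"
    and inner_scale_left: "\<lbrakk>x \<in> hcarrier H; y \<in> hcarrier H\<rbrakk> \<Longrightarrow>
          hinner H (hscale H a x) y = a * hinner H x y"
    and inner_nonneg: "x \<in> hcarrier H \<Longrightarrow> 0 \<le> hinner H x x"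
    and inner_eq_zero: "x \<in> hcarrier H \<Longrightarrow> hinner H x x = 0 \<Longrightarrow> x = hzero H"

definition hnorm :: "'h inner_structure \<Rightarrow> 'h \<Rightarrow> real" where
  "hnorm H x = sqrt (hinner H x x)"

definition hdiff :: "'h inner_structure \<Rightarrow> 'h \<Rightarrow> 'h \<Rightarrow> 'h" where
  "hdiff H x y = hadd H x (hscale H (-1) y)"

text \<open>
  The value \<open>0\<close> off the carrier is needed because \<^locale>\<open>Metric_space\<close> demands nonnegativity and
  symmetry on the whole type.
\<close>

definition hdist :: "'h inner_structure \<Rightarrow> 'h \<Rightarrow> 'h \<Rightarrow> real" where
  "hdist H x y = (if x \<in> hcarrier H \<and> y \<in> hcarrier H then hnorm H (hdiff H x y) else 0)"

definition hmetric :: "'h inner_structure \<Rightarrow> 'h metric" where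
  "hmetric H = metric (hcarrier H, hdist H)"

locale hilbert_space = inner_space +
  assumes complete: "mcomplete_of (hmetric H)"

context inner_space
begin

lemma hdiff_closed: "x \<in> hcarrier H \<Longrightarrow> y \<in> hcarrier H \<Longrightarrow> hdiff H x y \<in> hcarrier H"
  by (simp add: hdiff_def add_closed scale_closed)

lemma inner_add_right:
  "\<lbrakk>x \<in> hcarrier H; y \<in> hcarrier H; z \<in> hcarrier H\<rbrakk> \<Longrightarrow>
    hinner H z (hadd H x y) = hinner H z x + hinner H z y"
  by (metis inner_add_left inner_commute add_closed)

lemma inner_scale_right:
  "\<lbrakk>x \<in> hcarrier H; y \<in> hcarrier H\<rbrakk> \<Longrightarrow> hinner H x (hscale H a y) = a * hinner H x y"
  by (metis inner_scale_left inner_commute scale_closed)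

lemma inner_zero: "hinner H (hzero H) (hzero H) = 0"
  using inner_add_left[OF zero_closed zero_closed zero_closed] add_zero[OF zero_closed] by simp

lemma Cauchy_Schwarz:
  assumes x: "x \<in> hcarrier H" and y: "y \<in> hcarrier H"
  shows "\<bar>hinner H x y\<bar> \<le> hnorm H x * hnorm H y"
proof -
  have q: "0 \<le> hinner H x x + 2 * t * hinner H x y + t\<^sup>2 * hinner H y y" for t
    using inner_nonneg[OF add_closed[OF x scale_closed[OF y, of t]]] x y
    by (simp add: inner_add_left inner_add_right inner_scale_left inner_scale_right
        add_closed scale_closed inner_commute[of y x] power2_eq_square algebra_simps)
  have "(hinner H x y)\<^sup>2 \<le> hinner H x x * hinner H y y"
  proof (cases "hinner H y y = 0")
    case True
    have "hinner H x y = 0"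
    proof (rule ccontr)
      assume n: "hinner H x y \<noteq> 0"
      show False
        using q[of "- (hinner H x x + 1) / (2 * hinner H x y)"] n True by (simp add: field_simps)
    qed
    then show ?thesis using True by simp
  next
    case False
    then have p: "hinner H y y > 0" using inner_nonneg[OF y] by simp
    have "0 \<le> hinner H x x - (hinner H x y)\<^sup>2 / hinner H y y"
      using q[of "- hinner H x y / hinner H y y"] p by (simp add: field_simps power2_eq_square)
    then show ?thesis using p by (simp add: field_simps)
  qed
  then show ?thesis
    unfolding hnorm_def by (metis real_sqrt_abs real_sqrt_le_iff real_sqrt_mult)
qed

lemma hnorm_triangle:
  assumes x: "x \<in> hcarrier H" and y: "y \<in> hcarrier H"
  shows "hnorm H (hadd H x y) \<le> hnorm H x + hnorm H y"
proof -
  have "hinner H (hadd H x y) (hadd H x y) = hinner H x x + 2 * hinner H x y + hinner H y y"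
    using x y by (simp add: inner_add_left inner_add_right add_closed inner_commute[of y x])
  also have "\<dots> \<le> (hnorm H x)\<^sup>2 + 2 * (hnorm H x * hnorm H y) + (hnorm H y)\<^sup>2"
    using Cauchy_Schwarz[OF x y] inner_nonneg x y by (simp add: hnorm_def)
  also have "\<dots> = (hnorm H x + hnorm H y)\<^sup>2"
    by (simp add: power2_eq_square algebra_simps)
  finally show ?thesis
    unfolding hnorm_def[of H "hadd H x y"]
    using x y inner_nonneg by (intro real_le_lsqrt) (auto simp: hnorm_def)
qed

lemma hdiff_eq_zero:
  assumes x: "x \<in> hcarrier H" and y: "y \<in> hcarrier H"
  shows "hdiff H x y = hzero H \<longleftrightarrow> x = y"
proof
  assume e: "hdiff H x y = hzero H"
  have "x = hadd H x (hadd H (hscale H (-1) y) y)"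
    using x y by (simp add: add_commute[of _ y] scale_closed add_uminus add_zero)
  also have "\<dots> = hadd H (hdiff H x y) y"
    using x y by (simp add: hdiff_def add_assoc scale_closed)
  also have "\<dots> = y"
    using e y by (simp add: add_commute[of _ y] zero_closed add_zero)
  finally show "x = y" .
qed (use x in \<open>simp add: hdiff_def add_uminus\<close>)

lemma Metric_space_hdist: "Metric_space (hcarrier H) (hdist H)"
proof
  show "0 \<le> hdist H x y" for x y
    by (simp add: hdist_def hnorm_def inner_nonneg hdiff_closed)
  show "hdist H x y = hdist H y x" for x y
    by (auto simp: hdist_def hnorm_def hdiff_def inner_add_left inner_add_right inner_scale_left
        inner_scale_right add_closed scale_closed inner_commute)
  show "hdist H x y = 0 \<longleftrightarrow> x = y" if "x \<in> hcarrier H" "y \<in> hcarrier H" for x y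
    using that hdiff_eq_zero[OF that] inner_eq_zero[OF hdiff_closed[OF that]] inner_zero
    by (auto simp: hdist_def hnorm_def)
  show "hdist H x z \<le> hdist H x y + hdist H y z"
    if x: "x \<in> hcarrier H" and y: "y \<in> hcarrier H" and z: "z \<in> hcarrier H" for x y z
  proof -
    let ?m = "hscale H (-1)"
    have "hadd H (hdiff H x y) (hdiff H y z) = hadd H x (hadd H (hadd H (?m y) y) (?m z))"
      using x y z by (simp add: hdiff_def add_assoc add_closed scale_closed)
    also have "\<dots> = hdiff H x z"
      using x y z by (simp add: hdiff_def add_commute[of _ y] add_commute[of "hzero H"]
          add_uminus add_zero scale_closed zero_closed)
    finally show ?thesis
      using hnorm_triangle[OF hdiff_closed[OF x y] hdiff_closed[OF y z]] x y z
      by (simp add: hdist_def)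
  qed
qed

lemma mspace_hmetric [simp]: "mspace (hmetric H) = hcarrier H"
  and mdist_hmetric [simp]: "mdist (hmetric H) = hdist H"
  by (simp_all add: hmetric_def Metric_space.mspace_metric Metric_space.mdist_metric
      Metric_space_hdist)

end

text \<open>Every type-class Hilbert space is an instance, with its usual metric.\<close>

definition class_inner_structure :: "'h::real_inner inner_structure" where
  "class_inner_structure =
     \<lparr>hcarrier = UNIV, hzero = 0, hadd = (+), hscale = (*\<^sub>R), hinner = (\<bullet>)\<rparr>"

lemma hmetric_class_inner_structure:
  "hmetric (class_inner_structure :: 'h::real_inner inner_structure) = euclidean_metric"
proof -
  have "hdist (class_inner_structure :: 'h inner_structure) = dist"
    by (intro ext) (simp add: hdist_def hnorm_def hdiff_def class_inner_structure_def dist_norm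
        norm_eq_sqrt_inner)
  then show ?thesis
    by (simp add: hmetric_def euclidean_metric_def class_inner_structure_def)
qed

lemma hilbert_space_class_inner_structure:
  "hilbert_space (class_inner_structure :: 'h::{real_inner, complete_space} inner_structure)"
proof -
  have "inner_space (class_inner_structure :: 'h inner_structure)"
    by unfold_locales
      (auto simp: class_inner_structure_def inner_left_distrib Real_Vector_Spaces.scaleR_add_left
        scaleR_add_right inner_right_distrib Inner_Product.inner_commute)
  moreover have "mcomplete_of (hmetric (class_inner_structure :: 'h inner_structure))"
    by (simp add: hmetric_class_inner_structure mcomplete_of_def complete_UNIV)
  ultimately show ?thesis
    by (simp add: hilbert_space_def hilbert_space_axioms_def)
qed


section \<open>Affine isometric actions and the Haagerup property\<close>

definition linear_isometric_bijection :: "'h inner_structure \<Rightarrow> ('h \<Rightarrow> 'h) \<Rightarrow> bool" where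
  "linear_isometric_bijection H T \<longleftrightarrow>
     bij_betw T (hcarrier H) (hcarrier H) \<and>
     (\<forall>x\<in>hcarrier H. \<forall>y\<in>hcarrier H. T (hadd H x y) = hadd H (T x) (T y)) \<and>
     (\<forall>a. \<forall>x\<in>hcarrier H. T (hscale H a x) = hscale H a (T x)) \<and>
     (\<forall>x\<in>hcarrier H. hnorm H (T x) = hnorm H x)"

definition isometric_representation ::
    "'h inner_structure \<Rightarrow> ('g::topological_group_add \<Rightarrow> 'h \<Rightarrow> 'h) \<Rightarrow> bool" where
  "isometric_representation H \<pi> \<longleftrightarrow>
     (\<forall>g. linear_isometric_bijection H (\<pi> g)) \<and>
     (\<forall>\<xi>\<in>hcarrier H. \<pi> 0 \<xi> = \<xi>) \<and>
     (\<forall>g f. \<forall>\<xi>\<in>hcarrier H. \<pi> (g + f) \<xi> = \<pi> g (\<pi> f \<xi>))"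

definition affine_isometric_action ::
    "'h inner_structure \<Rightarrow> ('g::topological_group_add \<Rightarrow> 'h \<Rightarrow> 'h) \<Rightarrow> bool" where
  "affine_isometric_action H \<alpha> \<longleftrightarrow>
     (\<exists>\<pi> b. isometric_representation H \<pi> \<and>
        (\<forall>g. b g \<in> hcarrier H) \<and>
        (\<forall>g f. b (g + f) = hadd H (\<pi> g (b f)) (b g)) \<and>
        (\<forall>g. \<forall>\<xi>\<in>hcarrier H. \<alpha> g \<xi> = hadd H (\<pi> g \<xi>) (b g)))"

definition continuous_action ::
    "'h inner_structure \<Rightarrow> ('g::topological_group_add \<Rightarrow> 'h \<Rightarrow> 'h) \<Rightarrow> bool" where
  "continuous_action H \<alpha> \<longleftrightarrow>
     continuous_map (prod_topology euclidean (mtopology_of (hmetric H))) (mtopology_of (hmetric H))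
       (\<lambda>(g, \<xi>). \<alpha> g \<xi>)"

definition metrically_proper_action ::
    "'h inner_structure \<Rightarrow> ('g::topological_group_add \<Rightarrow> 'h \<Rightarrow> 'h) \<Rightarrow> bool" where
  "metrically_proper_action H \<alpha> \<longleftrightarrow>
     (\<forall>\<xi>\<in>hcarrier H. \<forall>g. tends_to_infinity g \<longrightarrow>
        filterlim (\<lambda>n. hnorm H (hdiff H (\<alpha> (g n) \<xi>) \<xi>)) at_top sequentially)"

text \<open>The second argument is the universe over whose subsets the Hilbert spaces range.\<close>

definition haagerup_property :: "'g::topological_group_add itself \<Rightarrow> 'h itself \<Rightarrow> bool" where
  "haagerup_property _ _ \<longleftrightarrow>
     (\<exists>(H :: 'h inner_structure) (\<alpha> :: 'g \<Rightarrow> 'h \<Rightarrow> 'h).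
        hilbert_space H \<and> affine_isometric_action H \<alpha> \<and> continuous_action H \<alpha> \<and>
        metrically_proper_action H \<alpha>)"

text \<open>
  The metric on the group is some metrically proper compatible left-invariant metric; any two such
  metrics are both uniformly and coarsely equivalent, so the choice is immaterial.
\<close>

definition admits_uc_coarse_embedding ::
    "'g::topological_group_add itself \<Rightarrow> 'h itself \<Rightarrow> bool" where
  "admits_uc_coarse_embedding _ _ \<longleftrightarrow>
     (\<exists>(d :: 'g metric) (H :: 'h inner_structure) (\<eta> :: 'g \<Rightarrow> 'h).
        metrically_proper_metric d \<and> hilbert_space H \<and>
        uniformly_continuous_map d (hmetric H) \<eta> \<and> coarse_embedding d (hmetric H) \<eta>)"

end

theory Submission
  imports Defs
begin

text \<open>
  For the implication from the Haagerup property to coarse embeddability, take the orbit map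
  \<open>b\<close> of \<open>0\<close> under the affine action as the embedding. Its expansion is controlled because
  \<open>d x y + \<parallel>b x - b y\<parallel>\<close> is again a compatible left-invariant metric, so a sequence
  along which \<open>\<parallel>b\<parallel>\<close> is unbounded tends to infinity and cannot be bounded for a metrically proper
  \<open>d\<close>. Such a \<open>d\<close> is built as in the Birkhoff--Kakutani theorem from a chain \<open>V i\<close>, \<open>i\<close> an
  integer, of symmetric open sets with \<open>V i + V i + V i \<subseteq> V (i + 1)\<close> in which every member has
  property (OB); separability lets these sets exhaust the group.

  Conversely let \<open>\<eta>\<close> be a uniformly continuous coarse embedding and \<open>m\<close> an invariant mean. The
  functions \<open>b g = (x \<mapsto> \<eta> (x + g) - \<eta> x)\<close> form a cocycle for the right translation action on
  functions from the group to the Hilbert space, and \<open>m (x \<mapsto> \<langle>\<xi> x, \<zeta> x\<rangle>)\<close> is a translation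
  invariant semi-inner product on their span. Its completion is realised as the space of bounded
  linear functionals on the span, whose squared norm is the Legendre transform of the quadratic form.
  As a functional is determined by its values at \<open>b g\<close> for \<open>g\<close> in a countable dense set, the
  completion has at most the cardinality of the continuum and fits into the given universe as soon as
  that contains a nonzero Hilbert space.
\<close>

section \<open>Compatible left-invariant metrics\<close>

text \<open>The averaging direction rests on \<open>mdist d (x + g) x = mdist d g 0\<close>, whose
  value does not depend on \<open>x\<close>. It makes every \<open>b g\<close> bounded, turns
  uniform continuity of \<eta> into the condition that defines \<open>LUC\<close>, and, when
  \<open>g\<close> is far from \<open>0\<close>, bounds \<open>b g x\<close> from below at all
  \<open>x\<close> at once. A mean is only finitely additive and respects only such uniform bounds:
  a lower bound at some points \<open>x\<close> would be lost in the average. Since \<eta> itself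
  can be unbounded, the semi-inner product lives on its displacements.

  Functionals replace Cauchy sequences for two reasons. A bounded functional kills every null
  vector, so no quotient is formed; and functionals are equal as soon as their values agree, so they
  can be coded by sequences of reals.

  In the metric construction the threefold sums are matched with costs \<open>2 powi i\<close>: a
  chain cut at half of its cost leaves a left piece, one step and a right piece, each one level
  lower.\<close>

lemma open_left_translate:
  fixes g :: "'g::topological_group_add"
  assumes "open U" shows "open {w. g + w \<in> U}"
  using open_vimage[OF assms, of "\<lambda>w. g + w"] by (simp add: vimage_def continuous_on_add)

lemma open_right_translate:
  fixes g :: "'g::topological_group_add"
  assumes "open U" shows "open {w. w + g \<in> U}"
  using open_vimage[OF assms, of "\<lambda>w. w + g"] by (simp add: vimage_def continuous_on_add)

lemma open_uminus_vimage:
  fixes U :: "'g::topological_group_add set"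
  assumes "open U" shows "open {w. - w \<in> U}"
  using open_vimage[OF assms, of uminus] by (simp add: vimage_def continuous_on_minus)

text \<open>The sum set is a union of left translates of \<open>V\<close>, one for each element of
  \<open>U\<close>.\<close>

lemma open_plus_set:
  fixes U :: "'g::topological_group_add set"
  assumes "open V" shows "open {a + b | a b. a \<in> U \<and> b \<in> V}"
proof -
  have "{a + b | a b. a \<in> U \<and> b \<in> V} = (\<Union>a\<in>U. {w. - a + w \<in> V})"
  proof safe
    fix a w assume "a \<in> U" "- a + w \<in> V"
    then show "\<exists>a' b. w = a' + b \<and> a' \<in> U \<and> b \<in> V"
      by (intro exI[of _ a] exI[of _ "- a + w"]) (simp add: add.assoc[symmetric])
  next
    fix a b assume "a \<in> U" "b \<in> V"
    then show "a + b \<in> (\<Union>a\<in>U. {w. - a + w \<in> V})"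
      by (intro UN_I[of a]) (auto simp: add.assoc[symmetric])
  qed
  then show ?thesis using open_left_translate[OF assms] by auto
qed

text \<open>Continuity of addition at \<open>(0, 0)\<close> halves a neighbourhood. Halving twice
  puts \<open>a + b\<close> into \<open>P\<close>, to which \<open>c\<close> also belongs, and one
  more halving relation leads from \<open>P\<close> to \<open>U\<close>.\<close>

lemma symmetric_triple_neighbourhood:
  fixes U :: "'g::topological_group_add set"
  assumes "open U" "0 \<in> U"
  obtains V where "open V" "0 \<in> V" "\<And>x. x \<in> V \<Longrightarrow> - x \<in> V"
    "\<And>a b c. a \<in> V \<Longrightarrow> b \<in> V \<Longrightarrow> c \<in> V \<Longrightarrow> a + b + c \<in> U"
proof -
  have half: "\<exists>V. open V \<and> 0 \<in> V \<and> (\<forall>a\<in>V. \<forall>b\<in>V. a + b \<in> U)"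
    if U: "open U" "0 \<in> U" for U :: "'g set"
  proof -
    have o: "open ((\<lambda>p. fst p + snd p) -` U)"
      by (rule open_vimage[OF U(1)], rule continuous_on_add[OF continuous_on_fst[OF continuous_on_id]
            continuous_on_snd[OF continuous_on_id]])
    have "(0, 0) \<in> (\<lambda>p. fst p + snd p) -` U" using U(2) by simp
    with o obtain A B where AB: "open A" "open B" "(0, 0) \<in> A \<times> B"
        "A \<times> B \<subseteq> (\<lambda>p. fst p + snd p) -` U"
      by (rule open_prod_elim)
    have "a + b \<in> U" if "a \<in> A" "b \<in> B" for a b
      using subsetD[OF AB(4), of "(a, b)"] that by simp
    then show ?thesis using AB(1-3) by (intro exI[of _ "A \<inter> B"]) (simp add: open_Int)
  qed
  obtain P where P: "open P" "0 \<in> P" "\<forall>a\<in>P. \<forall>b\<in>P. a + b \<in> U" using half[OF assms] by blast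
  obtain Q where Q: "open Q" "0 \<in> Q" "\<forall>a\<in>Q. \<forall>b\<in>Q. a + b \<in> P" using half[OF P(1,2)] by blast
  let ?V = "P \<inter> Q \<inter> {w. - w \<in> P \<inter> Q}"
  show thesis
  proof (rule that[of ?V])
    show "open ?V" using P Q by (intro open_Int open_uminus_vimage)
    show "0 \<in> ?V" using P Q by simp
    show "- x \<in> ?V" if "x \<in> ?V" for x using that by simp
    show "a + b + c \<in> U" if "a \<in> ?V" "b \<in> ?V" "c \<in> ?V" for a b c
      using that P(3) Q(3) by blast
  qed
qed

text \<open>A left-invariant metric is determined by its length function, and left invariance is
  built into the term \<open>- x + y\<close>. The conditions \<open>small\<close> and
  \<open>base\<close> compare the two topologies at \<open>0\<close> only; left translation carries
  the comparison to all points.\<close>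

lemma compatible_left_invariantI:
  fixes L :: "'g::topological_group_add \<Rightarrow> real"
  assumes nonneg: "\<And>x. 0 \<le> L x" and zero: "\<And>x. L x = 0 \<longleftrightarrow> x = 0"
    and uminus: "\<And>x. L (- x) = L x" and add: "\<And>x y. L (x + y) \<le> L x + L y"
    and small: "\<And>e. e > 0 \<Longrightarrow> \<exists>U. open U \<and> 0 \<in> U \<and> (\<forall>x\<in>U. L x < e)"
    and base: "\<And>U. open U \<Longrightarrow> 0 \<in> U \<Longrightarrow> \<exists>e>0. \<forall>x. L x < e \<longrightarrow> x \<in> U"
  shows "compatible_left_invariant (metric (UNIV, \<lambda>x y. L (- x + y)))" (is ?comp)
    and "mdist (metric (UNIV, \<lambda>x y. L (- x + y))) = (\<lambda>x y. L (- x + y))" (is ?dist)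
proof -
  let ?d = "\<lambda>x y. L (- x + y)"
  interpret Metric_space UNIV ?d
  proof
    show "?d x y = ?d y x" for x y using uminus[of "- x + y"] by (simp add: minus_add)
    show "?d x y = 0 \<longleftrightarrow> x = y" for x y
      unfolding zero using neg_eq_iff_add_eq_0[of "- x" y] by simp
    show "?d x z \<le> ?d x y + ?d y z" for x y z
      using add[of "- x + y" "- y + z"] by (simp add: add.assoc)
  qed (rule nonneg)
  have "openin mtopology U \<longleftrightarrow> open U" for U
  proof
    assume U: "openin mtopology U"
    show "open U"
    proof (subst open_subopen, intro ballI)
      fix x assume "x \<in> U"
      then obtain r where r: "r > 0" "mball x r \<subseteq> U" using U openin_mtopology by blast
      obtain V where V: "open V" "0 \<in> V" "\<forall>v\<in>V. L v < r" using small[OF r(1)] by auto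
      have "{w. - x + w \<in> V} \<subseteq> U" using V(3) r(2) by (auto simp: subset_iff)
      then show "\<exists>T. open T \<and> x \<in> T \<and> T \<subseteq> U"
        using open_left_translate[OF V(1), of "- x"] V(2) by (intro exI[of _ "{w. - x + w \<in> V}"]) auto
    qed
  next
    assume U: "open U"
    have "\<exists>r>0. mball x r \<subseteq> U" if x: "x \<in> U" for x
    proof -
      obtain e where e: "e > 0" "\<forall>w. L w < e \<longrightarrow> x + w \<in> U"
        using base[OF open_left_translate[OF U, of x]] x unfolding mem_Collect_eq add_0_right by blast
      have "y \<in> U" if "L (- x + y) < e" for y
        using e(2)[rule_format, OF that] by (simp add: add.assoc[symmetric])
      then show ?thesis using e(1) by (intro exI[of _ e]) auto
    qed
    then show "openin mtopology U" by (simp add: openin_mtopology)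
  qed
  then have eq: "openin mtopology = open" by (rule ext)
  have "mtopology = euclidean" using openin_inverse[of mtopology] unfolding eq by (rule sym)
  moreover have "?d (h + g) (h + f) = ?d g f" for g f h
    by (simp only: minus_add add.assoc minus_add_cancel)
  ultimately show ?comp ?dist by (auto simp: compatible_left_invariant_def)
qed

lemma
  fixes d :: "'g::topological_group_add metric"
  assumes d: "compatible_left_invariant d"
  shows compatible_mspace: "mspace d = UNIV"
    and compatible_invariant: "mdist d (h + g) (h + f) = mdist d g f"
    and compatible_open_ball: "open {y. mdist d x y < r}"
    and compatible_base: "open U \<Longrightarrow> x \<in> U \<Longrightarrow> \<exists>e>0. \<forall>y. mdist d x y < e \<longrightarrow> y \<in> U"
proof -
  have t: "mtopology_of d = euclidean" using d by (simp add: compatible_left_invariant_def)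
  show m: "mspace d = UNIV" using arg_cong[OF t, of topspace] by simp
  show "mdist d (h + g) (h + f) = mdist d g f" using d by (simp add: compatible_left_invariant_def)
  interpret Metric_space UNIV "mdist d" using Metric_space_mspace_mdist[of d] m by simp
  have o: "openin mtopology U \<longleftrightarrow> open U" for U
  proof -
    have "mtopology = euclidean" using t unfolding mtopology_of_def m .
    then show ?thesis by (simp only: open_openin[symmetric])
  qed
  show "open {y. mdist d x y < r}" using openin_mball[of x r] unfolding o mball_def by simp
  show "open U \<Longrightarrow> x \<in> U \<Longrightarrow> \<exists>e>0. \<forall>y. mdist d x y < e \<longrightarrow> y \<in> U"
    using openin_mtopology[of U] unfolding o mball_def subset_iff by simp
qed

lemma compatible_length:
  fixes d :: "'g::topological_group_add metric"
  assumes d: "compatible_left_invariant d"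
  shows "mdist d x y = mdist d 0 (- x + y)"
    and "mdist d 0 (- x) = mdist d 0 x"
    and "mdist d 0 (x + y) \<le> mdist d 0 x + mdist d 0 y"
proof -
  note inv = compatible_invariant[OF d]
  show l: "mdist d x y = mdist d 0 (- x + y)" for x y using inv[of "- x" x y] by simp
  show "mdist d 0 (- x) = mdist d 0 x" using l[of x 0] mdist_commute[of d x 0] by simp
  show "mdist d 0 (x + y) \<le> mdist d 0 x + mdist d 0 y"
    using mdist_triangle[of 0 d x "x + y"] inv[of x 0 y] compatible_mspace[OF d] by simp
qed

text \<open>Diameter is traded for distance from \<open>0\<close>, because lengths are symmetric and
  subadditive; this makes the closure properties under unions, negatives and sums immediate.\<close>

lemma OB_set_iff:
  "OB_set A \<longleftrightarrow> (\<forall>d. compatible_left_invariant d \<longrightarrow> (\<exists>K. \<forall>x\<in>A. mdist d 0 x \<le> K))"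
proof -
  have "(\<exists>K. \<forall>x\<in>A. \<forall>y\<in>A. mdist d x y \<le> K) \<longleftrightarrow> (\<exists>K. \<forall>x\<in>A. mdist d 0 x \<le> K)"
    if d: "compatible_left_invariant d" for d
  proof
    assume "\<exists>K. \<forall>x\<in>A. \<forall>y\<in>A. mdist d x y \<le> K"
    then obtain K where K: "\<And>x y. x \<in> A \<Longrightarrow> y \<in> A \<Longrightarrow> mdist d x y \<le> K" by auto
    show "\<exists>K. \<forall>x\<in>A. mdist d 0 x \<le> K"
    proof (cases "A = {}")
      case False
      then obtain a where a: "a \<in> A" by auto
      have "mdist d 0 x \<le> mdist d 0 a + K" if "x \<in> A" for x
        using mdist_triangle[of 0 d a x] compatible_mspace[OF d] K[OF a that] by simp
      then show ?thesis by auto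
    qed auto
  next
    assume "\<exists>K. \<forall>x\<in>A. mdist d 0 x \<le> K"
    then obtain K where K: "\<And>x. x \<in> A \<Longrightarrow> mdist d 0 x \<le> K" by auto
    have "mdist d x y \<le> K + K" if "x \<in> A" "y \<in> A" for x y
      using mdist_triangle[of x d 0 y] compatible_mspace[OF d] K[OF that(1)] K[OF that(2)]
      by (simp add: mdist_commute[of d x 0])
    then show "\<exists>K. \<forall>x\<in>A. \<forall>y\<in>A. mdist d x y \<le> K" by auto
  qed
  then show ?thesis by (auto simp: OB_set_def)
qed

lemma OB_subset: "OB_set B \<Longrightarrow> A \<subseteq> B \<Longrightarrow> OB_set A"
  unfolding OB_set_iff by (meson subsetD)

lemma OB_singleton: "OB_set {x}"
  unfolding OB_set_iff by auto

lemma OB_Un: assumes "OB_set A" "OB_set B" shows "OB_set (A \<union> B)"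
  unfolding OB_set_iff
proof (intro allI impI)
  fix d :: "'a metric" assume d: "compatible_left_invariant d"
  obtain K L where "\<forall>x\<in>A. mdist d 0 x \<le> K" "\<forall>x\<in>B. mdist d 0 x \<le> L"
    using assms d unfolding OB_set_iff by metis
  then show "\<exists>K. \<forall>x\<in>A \<union> B. mdist d 0 x \<le> K"
    by (intro exI[of _ "max K L"]) (auto simp: le_max_iff_disj)
qed

lemma OB_uminus: assumes "OB_set A" shows "OB_set {x. - x \<in> A}"
  unfolding OB_set_iff
proof (intro allI impI)
  fix d :: "'a metric" assume d: "compatible_left_invariant d"
  obtain K where "\<forall>x\<in>A. mdist d 0 x \<le> K" using assms d unfolding OB_set_iff by metis
  then show "\<exists>K. \<forall>x\<in>{x. - x \<in> A}. mdist d 0 x \<le> K"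
    using compatible_length(2)[OF d] by (intro exI[of _ K]) (metis mem_Collect_eq)
qed

lemma OB_plus: assumes "OB_set A" "OB_set B" shows "OB_set {a + b | a b. a \<in> A \<and> b \<in> B}"
  unfolding OB_set_iff
proof (intro allI impI)
  fix d :: "'a metric" assume d: "compatible_left_invariant d"
  obtain K L where K: "\<And>x. x \<in> A \<Longrightarrow> mdist d 0 x \<le> K" and L: "\<And>x. x \<in> B \<Longrightarrow> mdist d 0 x \<le> L"
    using assms d unfolding OB_set_iff by metis
  have "mdist d 0 (a + b) \<le> K + L" if "a \<in> A" "b \<in> B" for a b
    using compatible_length(3)[OF d, of a b] K[OF that(1)] L[OF that(2)] by linarith
  then show "\<exists>K. \<forall>x\<in>{a + b | a b. a \<in> A \<and> b \<in> B}. mdist d 0 x \<le> K" by blast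
qed

section \<open>The Birkhoff--Kakutani length of a chain of neighbourhoods\<close>

lemma small_power:
  fixes e :: real
  assumes "e > 0" shows "\<exists>i::int. 2 powi i < e"
proof -
  from assms obtain n where "(1/2)^n < e" using real_arch_pow_inv[of e "1/2"] by auto
  then have "2 powi (- int n) < e" by (simp add: power_int_minus power_one_over inverse_eq_divide)
  then show ?thesis by blast
qed

text \<open>Indexing by all integers lets one length function serve both ends: small
  \<open>i\<close> describes the topology at \<open>0\<close>, large \<open>i\<close> exhausts the
  group and describes the coarse structure.\<close>

locale neighbourhood_scale =
  fixes V :: "int \<Rightarrow> 'g::topological_group_add set"
  assumes V_open: "open (V i)" and V_zero: "0 \<in> V i"
    and V_uminus: "x \<in> V i \<Longrightarrow> - x \<in> V i"
    and V_triple: "a \<in> V i \<Longrightarrow> b \<in> V i \<Longrightarrow> c \<in> V i \<Longrightarrow> a + b + c \<in> V (i + 1)"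
    and V_cover: "\<exists>i. x \<in> V i"
    and V_base: "open U \<Longrightarrow> 0 \<in> U \<Longrightarrow> \<exists>i. V i \<subseteq> U"
    and V_separating: "(\<And>i. x \<in> V i) \<Longrightarrow> x = 0"
begin

definition valid :: "(int \<times> 'g) list \<Rightarrow> bool" where
  "valid ps \<longleftrightarrow> (\<forall>p\<in>set ps. snd p \<in> V (fst p))"

definition cost :: "(int \<times> 'g) list \<Rightarrow> real" where
  "cost ps = sum_list (map (\<lambda>p. 2 powi fst p) ps)"

definition chain_sum :: "(int \<times> 'g) list \<Rightarrow> 'g" where
  "chain_sum ps = sum_list (map snd ps)"

text \<open>This is the greatest subadditive function that is at most \<open>2 powi i\<close> on
  each \<open>V i\<close>.\<close>

definition chain_length :: "'g \<Rightarrow> real" where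
  "chain_length x = Inf (cost ` {ps. valid ps \<and> chain_sum ps = x})"

lemma cost_simps [simp]:
  "cost [] = 0" "cost (p # ps) = 2 powi fst p + cost ps" "cost (ps @ qs) = cost ps + cost qs"
  by (simp_all add: cost_def)

lemma chain_sum_simps [simp]:
  "chain_sum [] = 0" "chain_sum (p # ps) = snd p + chain_sum ps"
  "chain_sum (ps @ qs) = chain_sum ps + chain_sum qs"
  by (simp_all add: chain_sum_def)

lemma valid_simps [simp]:
  "valid []" "valid (p # ps) \<longleftrightarrow> snd p \<in> V (fst p) \<and> valid ps"
  "valid (ps @ qs) \<longleftrightarrow> valid ps \<and> valid qs"
  by (auto simp: valid_def)

lemma cost_nonneg: "0 \<le> cost ps"
  by (induction ps) (auto simp: add_nonneg_nonneg)

lemma V_mono: "i \<le> j \<Longrightarrow> V i \<subseteq> V j"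
proof (induction j rule: int_ge_induct)
  case (step j)
  then show ?case using V_triple[of _ j 0 0] V_zero by auto
qed simp

text \<open>The cut falls at the step \<open>p\<close> where the running cost reaches
  \<open>h\<close>, or at the last step if it stays below. Induction runs from the right, as a new
  last step moves the cut only when the old chain costs less than \<open>h\<close>.\<close>

lemma split_chain:
  assumes "h > 0"
  shows "ps \<noteq> [] \<Longrightarrow> \<exists>xs p ys. ps = xs @ p # ys \<and> cost xs < h \<and> (ys = [] \<or> h \<le> cost (xs @ [p]))"
proof (induction ps rule: rev_induct)
  case (snoc z zs)
  show ?case
  proof (cases "zs = []")
    case True
    then show ?thesis using assms by (intro exI[of _ "[]"] exI[of _ z]) simp
  next
    case False
    then obtain xs p ys where s: "zs = xs @ p # ys" "cost xs < h" "ys = [] \<or> h \<le> cost (xs @ [p])"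
      using snoc.IH by blast
    show ?thesis
    proof (cases "h \<le> cost (xs @ [p])")
      case True
      then show ?thesis using s by (intro exI[of _ xs] exI[of _ p] exI[of _ "ys @ [z]"]) simp
    next
      case False
      \<comment> \<open>The failed inequality forces \<open>ys = []\<close>, so all of
        \<open>zs\<close> costs less than \<open>h\<close> and the new step becomes
        \<open>p\<close>.\<close>
      then show ?thesis using s by (intro exI[of _ zs] exI[of _ z] exI[of _ "[]"]) simp
    qed
  qed
qed simp

text \<open>
  Cut the chain at the last point before half of its cost is used up: both remaining pieces cost
  less than half of the bound, so the induction hypothesis puts them one level lower.
\<close>

lemma chain_sum_in_V:
  assumes "valid ps" "cost ps < 2 powi j"
  shows "chain_sum ps \<in> V j"
  using assms
proof (induction ps arbitrary: j rule: length_induct)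
  case (1 ps)
  show ?case
  proof (cases "ps = []")
    case True
    then show ?thesis by (simp add: V_zero)
  next
    case False
    define h :: real where "h = 2 powi (j - 1)"
    have h: "h > 0" by (simp add: h_def)
    have h2: "2 powi j = 2 * h" using power_int_add[of "2::real" "j - 1" 1] by (simp add: h_def)
    obtain xs p ys where s: "ps = xs @ p # ys" "cost xs < h" "ys = [] \<or> h \<le> cost (xs @ [p])"
      using split_chain[OF h False] by blast
    have ys: "cost ys < h"
      using s(3)
    proof
      assume "h \<le> cost (xs @ [p])"
      then show ?thesis using s(1) 1(3) h2 by simp
    qed (simp add: h)
    have "2 powi fst p < (2::real) powi j"
      using s(1) 1(3) cost_nonneg[of xs] cost_nonneg[of ys] by simp
    \<comment> \<open>Costs are powers of 2, so a step cheaper than \<open>2 powi j\<close> is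
      already at level \<open>j - 1\<close>. It is the middle one of the three terms given to
      \<open>V_triple\<close>.\<close>
    then have "fst p \<le> j - 1"
      using power_int_increasing[of j "fst p" "2::real"] by (cases "j \<le> fst p") auto
    then have "V (fst p) \<subseteq> V (j - 1)" by (rule V_mono)
    then have "snd p \<in> V (j - 1)" using 1(2) s(1) by auto
    moreover have "chain_sum xs \<in> V (j - 1)" "chain_sum ys \<in> V (j - 1)"
      using 1(1,2) s(1,2) ys by (auto simp: h_def)
    ultimately show ?thesis
      using V_triple[of "chain_sum xs" "j - 1" "snd p" "chain_sum ys"] s(1) by (simp add: add.assoc)
  qed
qed

lemma chain_length_le: "valid ps \<Longrightarrow> chain_sum ps = x \<Longrightarrow> chain_length x \<le> cost ps"
  unfolding chain_length_def
  by (intro cInf_lower bdd_belowI2[of _ 0]) (auto simp: cost_nonneg)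

lemma chain_exists: "\<exists>ps. valid ps \<and> chain_sum ps = x"
proof -
  obtain i where "x \<in> V i" using V_cover by blast
  then show ?thesis by (intro exI[of _ "[(i, x)]"]) simp
qed

lemma chain_length_greatest:
  "(\<And>ps. valid ps \<Longrightarrow> chain_sum ps = x \<Longrightarrow> C \<le> cost ps) \<Longrightarrow> C \<le> chain_length x"
  unfolding chain_length_def using chain_exists[of x] by (intro cInf_greatest) auto

lemma chain_length_nonneg: "0 \<le> chain_length x"
  by (intro chain_length_greatest cost_nonneg)

lemma chain_length_V: "x \<in> V i \<Longrightarrow> chain_length x \<le> 2 powi i"
  using chain_length_le[of "[(i, x)]" x] by simp

text \<open>Together with \<open>chain_length_V\<close> this places \<open>V j\<close> between the
  open and the closed ball of radius \<open>2 powi j\<close>, so the length sees both the topology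
  and the sets with property (OB).\<close>

lemma chain_length_less: assumes "chain_length x < 2 powi j" shows "x \<in> V j"
proof (rule ccontr)
  assume "x \<notin> V j"
  then have "2 powi j \<le> chain_length x"
    using chain_sum_in_V by (intro chain_length_greatest) (meson not_le)
  with assms show False by simp
qed

lemma chain_length_add: "chain_length (x + y) \<le> chain_length x + chain_length y"
proof -
  have le: "chain_length (x + y) \<le> cost ps + cost qs"
    if "valid ps" "chain_sum ps = x" "valid qs" "chain_sum qs = y" for ps qs
    using chain_length_le[of "ps @ qs" "x + y"] that by simp
  have "chain_length (x + y) - cost ps \<le> chain_length y"
    if ps: "valid ps" "chain_sum ps = x" for ps
  proof (rule chain_length_greatest)
    fix qs assume "valid qs" "chain_sum qs = y"
    from le[OF ps this] show "chain_length (x + y) - cost ps \<le> cost qs" by simp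
  qed
  then have "chain_length (x + y) - chain_length y \<le> cost ps"
    if "valid ps" "chain_sum ps = x" for ps
    using that by (simp add: diff_le_eq add.commute)
  then have "chain_length (x + y) - chain_length y \<le> chain_length x"
    by (rule chain_length_greatest)
  then show ?thesis by simp
qed

lemma chain_length_uminus: "chain_length (- x) = chain_length x"
proof -
  have le: "chain_length (- x) \<le> chain_length x" for x
  proof (rule chain_length_greatest)
    fix ps assume ps: "valid ps" "chain_sum ps = x"
    \<comment> \<open>The group need not be commutative, so the negated chain is also
      reversed.\<close>
    let ?qs = "map (\<lambda>p. (fst p, - snd p)) (rev ps)"
    have "chain_sum ?qs = - chain_sum ps" by (induction ps) (auto simp: minus_add)
    moreover have "cost ?qs = cost ps" by (induction ps) auto
    moreover have "valid ?qs" using ps(1) by (auto simp: valid_def V_uminus)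
    ultimately show "chain_length (- x) \<le> cost ps" using chain_length_le[of ?qs "- x"] ps by simp
  qed
  show ?thesis using le[of x] le[of "- x"] by simp
qed

lemma chain_length_eq_zero: "chain_length x = 0 \<longleftrightarrow> x = 0"
proof
  assume "chain_length x = 0"
  then show "x = 0" by (intro V_separating chain_length_less) simp
next
  assume "x = 0"
  then have "chain_length x \<le> 0" using chain_length_le[of "[]" 0] by simp
  then show "chain_length x = 0" using chain_length_nonneg[of x] by simp
qed

definition chain_metric :: "'g metric" where
  "chain_metric = metric (UNIV, \<lambda>x y. chain_length (- x + y))"

lemma chain_metric:
  shows compatible_chain_metric: "compatible_left_invariant chain_metric"
    and mdist_chain_metric: "mdist chain_metric x y = chain_length (- x + y)"
proof -
  note * = compatible_left_invariantI[of chain_length, OF chain_length_nonneg chain_length_eq_zero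
      chain_length_uminus chain_length_add]
  have small: "\<exists>U. open U \<and> 0 \<in> U \<and> (\<forall>x\<in>U. chain_length x < e)" if "e > 0" for e
  proof -
    obtain i where "2 powi i < e" using small_power[OF \<open>e > 0\<close>] by blast
    then show ?thesis using chain_length_V V_open V_zero by (meson le_less_trans)
  qed
  have base: "\<exists>e>0. \<forall>x. chain_length x < e \<longrightarrow> x \<in> U" if U: "open U" "0 \<in> U" for U
  proof -
    obtain i where "V i \<subseteq> U" using V_base[OF U] by blast
    then show ?thesis using chain_length_less by (intro exI[of _ "2 powi i"]) auto
  qed
  show "compatible_left_invariant chain_metric"
    and "mdist chain_metric x y = chain_length (- x + y)"
    using *[OF small base] by (simp_all add: chain_metric_def)
qed

end

section \<open>Metric properness and the construction of the scale\<close>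

lemma filterlim_real_at_top_iff:
  fixes f :: "nat \<Rightarrow> real"
  shows "filterlim f at_top sequentially \<longleftrightarrow> (\<forall>C. \<exists>N. \<forall>n\<ge>N. C \<le> f n)"
  by (simp add: filterlim_at_top eventually_sequentially)

lemma subsequence_in_sublevel:
  fixes f :: "nat \<Rightarrow> real"
  assumes "\<not> filterlim f at_top sequentially"
  obtains r :: "nat \<Rightarrow> nat" and C where "strict_mono r" "\<And>n. f (r n) < C"
proof -
  obtain C where C: "\<And>N. \<exists>n\<ge>N. f n < C"
    using assms unfolding filterlim_real_at_top_iff by (meson not_le)
  have "infinite {n. f n < C}" unfolding infinite_nat_iff_unbounded_le using C by blast
  from infinite_enumerate[OF this] obtain r :: "nat \<Rightarrow> nat"
    where "strict_mono r" "\<And>n. f (r n) < C" by auto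
  then show thesis by (rule that)
qed

text \<open>A subsequence that is bounded in the chain metric stays in one \<open>V k\<close>.
  Property (OB) of that set bounds it in every compatible left-invariant metric, so the sequence
  cannot tend to infinity.\<close>

lemma (in neighbourhood_scale) chain_metric_proper:
  assumes OB: "\<And>i. OB_set (V i)"
  shows "metrically_proper_metric chain_metric"
  unfolding metrically_proper_metric_def
proof (intro conjI allI impI compatible_chain_metric)
  fix g :: "nat \<Rightarrow> 'g" assume "tends_to_infinity g"
  then obtain d where d: "compatible_left_invariant d"
    and lim: "filterlim (\<lambda>n. mdist d (g n) 0) at_top sequentially"
    by (auto simp: tends_to_infinity_def)
  show "filterlim (\<lambda>n. mdist chain_metric (g n) 0) at_top sequentially"
  proof (rule ccontr)
    assume "\<not> ?thesis"
    then obtain r C where r: "strict_mono (r :: nat \<Rightarrow> nat)" and C: "\<And>n. mdist chain_metric (g (r n)) 0 < C"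
      using subsequence_in_sublevel by blast
    obtain k where "C < 2 ^ k" using real_arch_pow[of 2 C] by auto
    then have "chain_length (g (r n)) < 2 powi int k" for n
      using C[of n] by (simp add: mdist_chain_metric chain_length_uminus)
    then have "g (r n) \<in> V (int k)" for n by (intro chain_length_less)
    then obtain K where K: "\<And>n. mdist d 0 (g (r n)) \<le> K"
      using OB[of "int k"] d unfolding OB_set_iff by blast
    obtain n where "K + 1 \<le> mdist d (g (r n)) 0"
      using filterlim_compose[OF lim filterlim_subseq[OF r]] unfolding filterlim_real_at_top_iff by blast
    then show False using K[of n] by (simp add: mdist_commute)
  qed
qed

text \<open>An enumeration serves twice: it drives the recursion in \<open>OB_scale_up\<close>, and
  it later codes functionals as sequences of reals.\<close>

lemma dense_sequence_exists:
  assumes "separable_space (euclidean :: 'a::topological_space topology)"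
  shows "\<exists>s :: nat \<Rightarrow> 'a. \<forall>N x. open N \<longrightarrow> x \<in> N \<longrightarrow> (\<exists>n. s n \<in> N)"
proof -
  obtain D :: "'a set" where D: "countable D" "euclidean closure_of D = UNIV"
    using assms by (auto simp: separable_space_def)
  have "D \<noteq> {}" using D(2) by auto
  then have s: "range (from_nat_into D) = D" using D(1) by (simp add: range_from_nat_into)
  have "\<exists>n. from_nat_into D n \<in> N" if N: "open N" "x \<in> N" for N x
    using D(2) N s by (metis UNIV_I in_closure_of open_openin rangeE)
  then show ?thesis by blast
qed

text \<open>Stage \<open>n\<close> adjoins the translate \<open>s n + U\<close> of the starting set
  and then takes threefold sums. Each stage uses finitely many unions, negatives and sums, which
  preserve property (OB), while density of \<open>s\<close> makes the translates cover the
  group.\<close>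

lemma OB_scale_up:
  fixes U :: "'g::topological_group_add set"
  assumes sep: "separable_space (euclidean :: 'g topology)"
    and U: "open U" "0 \<in> U" "OB_set U" "\<And>x. x \<in> U \<Longrightarrow> - x \<in> U"
  obtains A :: "nat \<Rightarrow> 'g set" where "A 0 = U" "\<And>n. open (A n)" "\<And>n. 0 \<in> A n" "\<And>n. OB_set (A n)"
    "\<And>n x. x \<in> A n \<Longrightarrow> - x \<in> A n"
    "\<And>n a b c. a \<in> A n \<Longrightarrow> b \<in> A n \<Longrightarrow> c \<in> A n \<Longrightarrow> a + b + c \<in> A (Suc n)"
    "\<And>x. \<exists>n. x \<in> A n"
proof -
  obtain s :: "nat \<Rightarrow> 'g" where dense: "\<And>N x. open N \<Longrightarrow> x \<in> N \<Longrightarrow> \<exists>n. s n \<in> N"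
    using dense_sequence_exists[OF sep] by blast
  \<comment> \<open>The negatives of \<open>g + U\<close> are adjoined as well, to keep the set
    symmetric.\<close>
  define C where "C g B = B \<union> {g + u | u. u \<in> U} \<union> {x. - x \<in> {g + u | u. u \<in> U}}" for g B
  define T where "T B = {a + b | a b. a \<in> {a + b | a b. a \<in> B \<and> b \<in> B} \<and> b \<in> B}" for B :: "'g set"
  define A where "A = rec_nat U (\<lambda>n B. T (C (s n) B))"
  have A0: "A 0 = U" and AS: "A (Suc n) = T (C (s n) (A n))" for n by (simp_all add: A_def)
  have Uplus: "{g + u | u. u \<in> U} = {a + b | a b. a \<in> {g} \<and> b \<in> U}" for g by auto
  have Copen: "open (C g B)" if "open B" for g B
    unfolding C_def by (intro open_Un open_uminus_vimage that) (simp_all only: Uplus open_plus_set U)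
  have COB: "OB_set (C g B)" if "OB_set B" for g B
    unfolding C_def Uplus by (intro OB_Un OB_uminus OB_plus OB_singleton that U)
  have Csym: "- x \<in> C g B" if "x \<in> C g B" "\<And>x. x \<in> B \<Longrightarrow> - x \<in> B" for x g B
    using that unfolding C_def by auto
  have Tmem: "a + b + c \<in> T B" if "a \<in> B" "b \<in> B" "c \<in> B" for a b c B
    unfolding T_def using that by blast
  have TE: "\<exists>a b c. x = a + b + c \<and> a \<in> B \<and> b \<in> B \<and> c \<in> B" if "x \<in> T B" for x B
    using that unfolding T_def by blast
  have Topen: "open (T B)" if "open B" for B
    unfolding T_def by (intro open_plus_set that)
  have TOB: "OB_set (T B)" if "OB_set B" for B
    unfolding T_def by (intro OB_plus that)
  have Tsym: "- x \<in> T B" if x: "x \<in> T B" and B: "\<And>x. x \<in> B \<Longrightarrow> - x \<in> B" for x B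
  proof -
    obtain a b c where "x = a + b + c" "a \<in> B" "b \<in> B" "c \<in> B" using TE[OF x] by blast
    then show ?thesis using Tmem[of "- c" B "- b" "- a"] B by (simp add: minus_add add.assoc)
  qed
  have A: "open (A n) \<and> 0 \<in> A n \<and> OB_set (A n) \<and> (\<forall>x\<in>A n. - x \<in> A n)" for n
  proof (induction n)
    case (Suc n)
    have "0 \<in> T (C (s n) (A n))" using Tmem[of 0 "C (s n) (A n)" 0 0] Suc by (simp add: C_def)
    then show ?case unfolding AS using Suc Topen Copen TOB COB Tsym Csym by metis
  qed (simp add: A0 U)
  have sub: "C (s n) (A n) \<subseteq> A (Suc n)" for n
  proof
    fix x assume "x \<in> C (s n) (A n)"
    then show "x \<in> A (Suc n)"
      using Tmem[of x "C (s n) (A n)" 0 0] A[of n] by (simp add: AS C_def)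
  qed
  have cover: "\<exists>n. x \<in> A n" for x
  proof -
    \<comment> \<open>Density is applied to the open set \<open>x + U\<close>; symmetry of
      \<open>U\<close> then turns \<open>s n\<close> in \<open>x + U\<close> into \<open>x\<close>
      in \<open>s n + U\<close>.\<close>
    obtain n where "- x + s n \<in> U"
      using dense[OF open_left_translate[OF U(1), of "- x"], of x] U(2) by auto
    then have "- (- x + s n) \<in> U" by (rule U)
    then have "x \<in> {s n + u | u. u \<in> U}"
      by (intro CollectI exI[of _ "- (- x + s n)"]) (simp add: minus_add add.assoc[symmetric])
    then show ?thesis using sub[of n] unfolding C_def by blast
  qed
  show thesis
  proof (rule that[of A])
    show "a + b + c \<in> A (Suc n)" if "a \<in> A n" "b \<in> A n" "c \<in> A n" for a b c n
      unfolding AS using that by (intro Tmem) (auto simp: C_def)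
  qed (use A A0 cover in auto)
qed

text \<open>The given metric may fail to be left-invariant. It supplies a countable neighbourhood
  base at \<open>0\<close>, and dependent choice picks each set inside both its predecessor and the
  next ball.\<close>

lemma metrizable_scale_down:
  fixes U :: "'g::topological_group_add set"
  assumes met: "metrizable_space (euclidean :: 'g topology)"
    and U: "open U" "0 \<in> U" "\<And>x. x \<in> U \<Longrightarrow> - x \<in> U"
  obtains B :: "nat \<Rightarrow> 'g set" where "B 0 = U" "\<And>n. open (B n)" "\<And>n. 0 \<in> B n"
    "\<And>n x. x \<in> B n \<Longrightarrow> - x \<in> B n"
    "\<And>n a b c. a \<in> B (Suc n) \<Longrightarrow> b \<in> B (Suc n) \<Longrightarrow> c \<in> B (Suc n) \<Longrightarrow> a + b + c \<in> B n"
    "\<And>N. open N \<Longrightarrow> 0 \<in> N \<Longrightarrow> \<exists>n. B n \<subseteq> N"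
proof -
  obtain M :: "'g set" and d where M: "Metric_space M d" and e: "euclidean = Metric_space.mtopology M d"
    using met by (auto simp: metrizable_space_def)
  interpret Metric_space M d by (rule M)
  have MU: "M = UNIV" using arg_cong[OF e, of topspace] by simp
  have M0: "0 \<in> M" using MU by blast
  have op: "openin mtopology X \<longleftrightarrow> open X" for X
    unfolding e[symmetric] by (rule open_openin[symmetric])
  \<comment> \<open>The radius is imposed for positive \<open>n\<close> only, so
    \<open>inverse 0 = 0\<close> never occurs; the case \<open>n = 0\<close> pins the starting
    set.\<close>
  define P where "P n B \<longleftrightarrow> open B \<and> 0 \<in> B \<and> (\<forall>x\<in>B. - x \<in> B) \<and> (n = 0 \<longrightarrow> B = U) \<and>
    (\<forall>m. n = Suc m \<longrightarrow> B \<subseteq> mball 0 (inverse (real n)))" for n B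
  define Q where "Q n B V \<longleftrightarrow> (\<forall>a b c. a \<in> V \<longrightarrow> b \<in> V \<longrightarrow> c \<in> V \<longrightarrow> a + b + c \<in> B)"
    for n :: nat and B V :: "'g set"
  have "\<exists>B. \<forall>n. P n (B n) \<and> Q n (B n) (B (Suc n))"
  proof (rule dependent_nat_choice)
    show "\<exists>x. P 0 x" using U by (auto simp: P_def)
    fix B n assume B: "P n B"
    let ?N = "B \<inter> mball 0 (inverse (real (Suc n)))"
    have No: "open ?N"
      using B openin_mball[of 0 "inverse (real (Suc n))"] unfolding P_def op by blast
    have "inverse (real (Suc n)) > 0" by simp
    then have "0 \<in> mball 0 (inverse (real (Suc n)))" using centre_in_mball_iff M0 by blast
    then have N0: "0 \<in> ?N" using B unfolding P_def by blast
    obtain V where V: "open V" "0 \<in> V" "\<And>x. x \<in> V \<Longrightarrow> - x \<in> V"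
      "\<And>a b c. a \<in> V \<Longrightarrow> b \<in> V \<Longrightarrow> c \<in> V \<Longrightarrow> a + b + c \<in> ?N"
      using symmetric_triple_neighbourhood[OF No N0] by metis
    have "V \<subseteq> ?N" using V(4)[OF _ V(2) V(2)] by auto
    then have "P (Suc n) V" using V(1-3) unfolding P_def by blast
    then show "\<exists>V. P (Suc n) V \<and> Q n B V" using V(4) unfolding Q_def by blast
  qed
  then obtain B where B: "\<And>n. P n (B n)"
    and tri: "\<And>n a b c. a \<in> B (Suc n) \<Longrightarrow> b \<in> B (Suc n) \<Longrightarrow> c \<in> B (Suc n) \<Longrightarrow> a + b + c \<in> B n"
    unfolding Q_def by blast
  show thesis
  proof (rule that[of B])
    fix N :: "'g set" assume "open N" "0 \<in> N"
    then obtain r where r: "r > 0" "mball 0 r \<subseteq> N" using op openin_mtopology[of N] by blast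
    obtain n where "inverse (real (Suc n)) < r" using reals_Archimedean[OF r(1)] by auto
    then have "mball 0 (inverse (real (Suc n))) \<subseteq> N"
      using r(2) mball_subset_concentric[of _ r 0] by (meson less_imp_le order_trans)
    moreover have "B (Suc n) \<subseteq> mball 0 (inverse (real (Suc n)))" using B[of "Suc n"] unfolding P_def by blast
    ultimately show "\<exists>n. B n \<subseteq> N" by blast
  next
    show "B 0 = U" using B[of 0] by (simp add: P_def)
    show "open (B n)" "0 \<in> B n" for n using B[of n] by (simp_all add: P_def)
    show "- x \<in> B n" if "x \<in> B n" for n x using B[of n] that by (simp add: P_def)
  qed (rule tri)
qed

lemma metrically_proper_metric_exists:
  assumes met: "metrizable_space (euclidean :: 'g::topological_group_add topology)"
    and sep: "separable_space (euclidean :: 'g topology)"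
    and OB: "locally_OB TYPE('g)"
  shows "\<exists>d :: 'g metric. metrically_proper_metric d"
proof -
  obtain Q :: "'g set" where Q: "0 \<in> interior Q" "OB_set Q" using OB by (auto simp: locally_OB_def)
  define U where "U = interior Q \<inter> {x. - x \<in> interior Q}"
  have U: "open U" "0 \<in> U" "\<And>x. x \<in> U \<Longrightarrow> - x \<in> U"
    using Q(1) by (auto simp: U_def intro!: open_Int open_uminus_vimage)
  have UOB: "OB_set U" using Q(2) interior_subset[of Q] by (auto simp: U_def elim!: OB_subset)
  obtain A :: "nat \<Rightarrow> 'g set" where A: "A 0 = U" "\<And>n. open (A n)" "\<And>n. 0 \<in> A n" "\<And>n. OB_set (A n)"
    "\<And>n x. x \<in> A n \<Longrightarrow> - x \<in> A n"
    "\<And>n a b c. a \<in> A n \<Longrightarrow> b \<in> A n \<Longrightarrow> c \<in> A n \<Longrightarrow> a + b + c \<in> A (Suc n)"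
    "\<And>x. \<exists>n. x \<in> A n"
    using OB_scale_up[OF sep U(1,2) UOB U(3)] by blast
  obtain B :: "nat \<Rightarrow> 'g set" where B: "B 0 = U" "\<And>n. open (B n)" "\<And>n. 0 \<in> B n"
    "\<And>n x. x \<in> B n \<Longrightarrow> - x \<in> B n"
    "\<And>n a b c. a \<in> B (Suc n) \<Longrightarrow> b \<in> B (Suc n) \<Longrightarrow> c \<in> B (Suc n) \<Longrightarrow> a + b + c \<in> B n"
    "\<And>N. open N \<Longrightarrow> 0 \<in> N \<Longrightarrow> \<exists>n. B n \<subseteq> N"
    using metrizable_scale_down[OF met U] by blast
  \<comment> \<open>Both sequences start at \<open>U\<close>, so they fit together at index
    \<open>0\<close> and threefold sums are controlled across all integers.\<close>
  define V where "V i = (if 0 \<le> i then A (nat i) else B (nat (- i)))" for i :: int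
  have VA: "V (int n) = A n" and VB: "V (- int n) = B n" for n
    by (auto simp: V_def A(1) B(1))
  have BU: "B n \<subseteq> U" for n
  proof (induction n)
    case (Suc n)
    have "B (Suc n) \<subseteq> B n" using B(5)[where b = 0 and c = 0] B(3) by force
    with Suc show ?case by simp
  qed (simp add: B)
  interpret neighbourhood_scale V
  proof
    fix i :: int and x :: 'g and a b c :: 'g and N :: "'g set"
    show "open (V i)" "0 \<in> V i" by (auto simp: V_def A B)
    show "- x \<in> V i" if "x \<in> V i" using that by (auto simp: V_def A B)
    show "a + b + c \<in> V (i + 1)" if "a \<in> V i" "b \<in> V i" "c \<in> V i"
    proof (cases "0 \<le> i")
      case True
      then obtain n where "i = int n" using nonneg_eq_int by blast
      then show ?thesis using that A(6) VA[of n] VA[of "Suc n"] by (simp add: add.commute)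
    next
      case False
      \<comment> \<open>Here \<open>i + 1 = - int n\<close>, so tripling leads from
        \<open>B (Suc n)\<close> to \<open>B n\<close>.\<close>
      then obtain n where "i = - int (Suc n)" using negD[of i] by auto
      then show ?thesis using that B(5) VB[of n] VB[of "Suc n"] by (simp add: add.commute)
    qed
    show "\<exists>i. x \<in> V i" using A(7)[of x] VA by metis
    show "\<exists>i. V i \<subseteq> N" if "open N" "0 \<in> N" using B(6)[OF that] VB by metis
    show "x = 0" if x: "\<And>i. x \<in> V i"
    proof (rule ccontr)
      assume "x \<noteq> 0"
      \<comment> \<open>The type class contains no separation axiom; separation comes from
        metrisability.\<close>
      have "Hausdorff_space (euclidean :: 'g topology)"
        using met metrizable_imp_Hausdorff_space by blast
      then obtain N where "open N" "0 \<in> N" "x \<notin> N"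
        using \<open>x \<noteq> 0\<close> unfolding Hausdorff_space_def disjnt_iff topspace_euclidean
        by (metis UNIV_I open_openin)
      then show False using B(6)[of N] x VB by (metis subsetD)
    qed
  qed
  have "OB_set (V i)" for i
    using A(4) OB_subset[OF UOB BU] by (auto simp: V_def)
  then show ?thesis using chain_metric_proper by blast
qed


section \<open>The dual of a semi-inner product space\<close>

text \<open>Null vectors are not divided out of \<open>W\<close>. By \<open>bounded_by\<close> every
  functional in the dual vanishes on them, so the passage to the dual performs the quotient.\<close>

locale semi_inner_product =
  fixes W :: "'w set" and add :: "'w \<Rightarrow> 'w \<Rightarrow> 'w" and scale :: "real \<Rightarrow> 'w \<Rightarrow> 'w"
    and q :: "'w \<Rightarrow> 'w \<Rightarrow> real"
  assumes nonempty: "W \<noteq> {}"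
    and W_add: "u \<in> W \<Longrightarrow> v \<in> W \<Longrightarrow> add u v \<in> W"
    and W_scale: "u \<in> W \<Longrightarrow> scale c u \<in> W"
    and q_commute: "u \<in> W \<Longrightarrow> v \<in> W \<Longrightarrow> q u v = q v u"
    and q_add_left: "u \<in> W \<Longrightarrow> v \<in> W \<Longrightarrow> w \<in> W \<Longrightarrow> q (add u v) w = q u w + q v w"
    and q_scale_left: "u \<in> W \<Longrightarrow> v \<in> W \<Longrightarrow> q (scale c u) v = c * q u v"
    and q_nonneg: "u \<in> W \<Longrightarrow> 0 \<le> q u u"
begin

lemma q_add_right: "u \<in> W \<Longrightarrow> v \<in> W \<Longrightarrow> w \<in> W \<Longrightarrow> q w (add u v) = q w u + q w v"
  by (metis q_add_left q_commute W_add)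

lemma q_scale_right: "u \<in> W \<Longrightarrow> v \<in> W \<Longrightarrow> q u (scale c v) = c * q u v"
  by (metis q_scale_left q_commute W_scale)

lemma q_add_self:
  "u \<in> W \<Longrightarrow> v \<in> W \<Longrightarrow> q (add u v) (add u v) = q u u + 2 * q u v + q v v"
  by (simp add: q_add_left q_add_right W_add q_commute[of v u])

lemma q_scale_self: "u \<in> W \<Longrightarrow> q (scale c u) (scale c u) = c\<^sup>2 * q u u"
  by (simp add: q_scale_left q_scale_right W_scale power2_eq_square)

text \<open>The constant bounds the square of the operator norm.\<close>

definition bounded_by :: "real \<Rightarrow> ('w \<Rightarrow> real) \<Rightarrow> bool" where
  "bounded_by C F \<longleftrightarrow> (\<forall>u\<in>W. (F u)\<^sup>2 \<le> C * q u u)"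

text \<open>The value \<open>0\<close> off \<open>W\<close> makes functionals that agree on \<open>W\<close> equal.\<close>

definition linear_on_W :: "('w \<Rightarrow> real) \<Rightarrow> bool" where
  "linear_on_W F \<longleftrightarrow> (\<forall>w. w \<notin> W \<longrightarrow> F w = 0) \<and> (\<forall>u\<in>W. \<forall>v\<in>W. F (add u v) = F u + F v) \<and>
     (\<forall>c. \<forall>u\<in>W. F (scale c u) = c * F u)"

definition dual :: "('w \<Rightarrow> real) set" where
  "dual = {F. linear_on_W F \<and> (\<exists>C\<ge>0. bounded_by C F)}"

text \<open>The Legendre transform of \<open>u \<mapsto> q u u\<close>; it is the square of the operator norm of \<open>F\<close>.\<close>

definition sqnorm :: "('w \<Rightarrow> real) \<Rightarrow> real" where
  "sqnorm F = (SUP u\<in>W. 2 * F u - q u u)"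

definition riesz :: "'w \<Rightarrow> 'w \<Rightarrow> real" where
  "riesz u = (\<lambda>w. if w \<in> W then q u w else 0)"

text \<open>This is polarisation. Bilinearity cannot be read off the formula and is recovered
  through \<open>dual_inner_limit\<close>.\<close>

definition dual_inner :: "('w \<Rightarrow> real) \<Rightarrow> ('w \<Rightarrow> real) \<Rightarrow> real" where
  "dual_inner F G = (sqnorm (\<lambda>w. F w + G w) - sqnorm F - sqnorm G) / 2"

lemma dual_add: "F \<in> dual \<Longrightarrow> u \<in> W \<Longrightarrow> v \<in> W \<Longrightarrow> F (add u v) = F u + F v"
  by (simp add: dual_def linear_on_W_def)

lemma dual_scale: "F \<in> dual \<Longrightarrow> u \<in> W \<Longrightarrow> F (scale c u) = c * F u"
  by (simp add: dual_def linear_on_W_def)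

lemma dual_outside: "F \<in> dual \<Longrightarrow> w \<notin> W \<Longrightarrow> F w = 0"
  by (simp add: dual_def linear_on_W_def)

lemma bounded_by_sqrt:
  assumes "bounded_by C F" "u \<in> W" shows "\<bar>F u\<bar> \<le> sqrt C * sqrt (q u u)"
proof -
  have "sqrt ((F u)\<^sup>2) \<le> sqrt (C * q u u)"
    using assms by (intro real_sqrt_le_mono) (simp add: bounded_by_def)
  then show ?thesis by (simp add: real_sqrt_mult)
qed

text \<open>Young's inequality \<open>2 * a * b \<le> a^2 + b^2\<close>; it makes the supremum in
  \<open>sqnorm\<close> finite.\<close>

lemma bounded_by_young:
  assumes C: "C \<ge> 0" and F: "bounded_by C F" and u: "u \<in> W"
  shows "2 * F u - q u u \<le> C"
proof -
  have "2 * F u \<le> 2 * (sqrt C * sqrt (q u u))"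
    using bounded_by_sqrt[OF F u] by simp
  also have "\<dots> \<le> (sqrt C)\<^sup>2 + (sqrt (q u u))\<^sup>2"
    using sum_squares_bound[of "sqrt C" "sqrt (q u u)"] by simp
  finally show ?thesis using C q_nonneg[OF u] by simp
qed

lemma sqnorm_le: "C \<ge> 0 \<Longrightarrow> bounded_by C F \<Longrightarrow> sqnorm F \<le> C"
  unfolding sqnorm_def by (intro cSUP_least nonempty bounded_by_young)

lemma sqnorm_upper: "F \<in> dual \<Longrightarrow> u \<in> W \<Longrightarrow> 2 * F u - q u u \<le> sqnorm F"
  unfolding sqnorm_def dual_def
  by (rule cSUP_upper) (auto intro: bdd_aboveI2 bounded_by_young)

lemma sqnorm_nonneg:
  assumes F: "F \<in> dual" shows "0 \<le> sqnorm F"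
proof -
  obtain u where u: "u \<in> W" using nonempty by auto
  show ?thesis
    \<comment> \<open>The vector \<open>scale 0 u\<close> acts as zero: \<open>F\<close> and
      \<open>q\<close> both vanish there.\<close>
    using sqnorm_upper[OF F W_scale[OF u, of 0]] u F
    by (simp add: dual_scale q_scale_self)
qed

lemma sqnorm_bound:
  assumes F: "F \<in> dual" shows "bounded_by (sqnorm F) F"
  unfolding bounded_by_def
proof
  fix u assume u: "u \<in> W"
  show "(F u)\<^sup>2 \<le> sqnorm F * q u u"
  proof (cases "q u u = 0")
    case True
    then have "(F u)\<^sup>2 \<le> 0" using F u by (force simp: dual_def bounded_by_def)
    then show ?thesis using True by simp
  next
    case False
    then have p: "q u u > 0" using q_nonneg[OF u] by simp
    \<comment> \<open>This is the maximiser of \<open>2 * t * F u - t^2 * q u u\<close> on the line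
      through \<open>u\<close>.\<close>
    let ?t = "F u / q u u"
    have "2 * (?t * F u) - ?t\<^sup>2 * q u u \<le> sqnorm F"
      using sqnorm_upper[OF F W_scale[OF u, of ?t]] u F by (simp add: dual_scale q_scale_self)
    moreover have "2 * (?t * F u) - ?t\<^sup>2 * q u u = (F u)\<^sup>2 / q u u"
      using p by (simp add: power2_eq_square field_simps)
    ultimately show ?thesis using p by (simp add: pos_divide_le_eq)
  qed
qed

lemma dual_sqrt_bound: "F \<in> dual \<Longrightarrow> u \<in> W \<Longrightarrow> \<bar>F u\<bar> \<le> sqrt (sqnorm F) * sqrt (q u u)"
  by (intro bounded_by_sqrt sqnorm_bound)

lemma bounded_by_sqrtI:
  assumes "c \<ge> 0" "\<And>u. u \<in> W \<Longrightarrow> \<bar>F u\<bar> \<le> c * sqrt (q u u)"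
  shows "bounded_by (c\<^sup>2) F"
  unfolding bounded_by_def
proof
  fix u assume u: "u \<in> W"
  have "\<bar>F u\<bar>\<^sup>2 \<le> (c * sqrt (q u u))\<^sup>2" by (intro power_mono assms u) simp
  then show "(F u)\<^sup>2 \<le> c\<^sup>2 * q u u" using q_nonneg[OF u] by (simp add: power_mult_distrib)
qed

lemma
  assumes F: "F \<in> dual" and G: "G \<in> dual"
  shows dual_sum: "(\<lambda>w. F w + G w) \<in> dual"
    and sqnorm_triangle: "sqrt (sqnorm (\<lambda>w. F w + G w)) \<le> sqrt (sqnorm F) + sqrt (sqnorm G)"
proof -
  have b: "bounded_by ((sqrt (sqnorm F) + sqrt (sqnorm G))\<^sup>2) (\<lambda>w. F w + G w)"
  proof (rule bounded_by_sqrtI)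
    fix u assume u: "u \<in> W"
    show "\<bar>F u + G u\<bar> \<le> (sqrt (sqnorm F) + sqrt (sqnorm G)) * sqrt (q u u)"
      using dual_sqrt_bound[OF F u] dual_sqrt_bound[OF G u] by (simp add: distrib_right)
  qed (simp add: F G sqnorm_nonneg)
  moreover have "linear_on_W (\<lambda>w. F w + G w)"
    using F G by (simp add: dual_def linear_on_W_def distrib_left)
  ultimately show s: "(\<lambda>w. F w + G w) \<in> dual"
    unfolding dual_def using zero_le_power2 by blast
  show "sqrt (sqnorm (\<lambda>w. F w + G w)) \<le> sqrt (sqnorm F) + sqrt (sqnorm G)"
    using sqnorm_le[OF _ b] by (intro real_le_lsqrt) (auto simp: F G sqnorm_nonneg)
qed

lemma
  assumes F: "F \<in> dual"
  shows dual_scaled: "(\<lambda>w. c * F w) \<in> dual"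
    and sqnorm_scale: "sqnorm (\<lambda>w. c * F w) = c\<^sup>2 * sqnorm F"
proof -
  have b: "bounded_by (c\<^sup>2 * sqnorm F) (\<lambda>w. c * F w)" if F: "F \<in> dual" for c F
    using sqnorm_bound[OF F] unfolding bounded_by_def
    by (auto simp: power_mult_distrib mult.assoc intro: mult_left_mono)
  have d: "(\<lambda>w. c * F w) \<in> dual" if F: "F \<in> dual" for c F
  proof -
    have "linear_on_W (\<lambda>w. c * F w)"
      using F by (auto simp: dual_def linear_on_W_def algebra_simps)
    moreover have "c\<^sup>2 * sqnorm F \<ge> 0" using F by (simp add: sqnorm_nonneg)
    ultimately show ?thesis using b[OF F] unfolding dual_def by blast
  qed
  have le: "sqnorm (\<lambda>w. c * F w) \<le> c\<^sup>2 * sqnorm F" if F: "F \<in> dual" for c F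
    using b[OF F] F by (intro sqnorm_le) (auto simp: sqnorm_nonneg)
  show "(\<lambda>w. c * F w) \<in> dual" by (rule d[OF F])
  show "sqnorm (\<lambda>w. c * F w) = c\<^sup>2 * sqnorm F"
  proof (cases "c = 0")
    case True
    then show ?thesis using le[OF F, of 0] sqnorm_nonneg[OF d[OF F, of 0]] by simp
  next
    case False
    \<comment> \<open>The inequality \<open>le\<close> for the scaled functional and the factor
      \<open>1/c\<close> gives the reverse estimate.\<close>
    have "sqnorm F \<le> (1/c)\<^sup>2 * sqnorm (\<lambda>w. c * F w)"
      using le[OF d[OF F, of c], of "1/c"] False by simp
    then have "c\<^sup>2 * sqnorm F \<le> sqnorm (\<lambda>w. c * F w)"
      using False by (simp add: power_one_over pos_le_divide_eq mult.commute)
    then show ?thesis using le[OF F, of c] by simp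
  qed
qed

lemma dual_zero: "(\<lambda>w. 0) \<in> dual"
  by (auto simp: dual_def linear_on_W_def bounded_by_def intro!: exI[of _ 0])

lemma sqnorm_zero: "sqnorm (\<lambda>w. 0) = 0"
  using sqnorm_scale[OF dual_zero, of 0] by simp

text \<open>Boundedness is the Cauchy--Schwarz inequality for a form that may be degenerate,
  obtained from positivity of \<open>q\<close> at \<open>u + t v\<close>.\<close>

lemma riesz_dual: assumes u: "u \<in> W" shows "riesz u \<in> dual"
proof -
  have "(q u v)\<^sup>2 \<le> q u u * q v v" if v: "v \<in> W" for v
  proof -
    have p: "0 \<le> q u u + 2 * t * q u v + t\<^sup>2 * q v v" for t
      using q_nonneg[OF W_add[OF u W_scale[OF v, of t]]] u v
      by (simp add: q_add_self W_scale q_scale_right q_scale_left power2_eq_square mult.assoc)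
    show ?thesis
    proof (cases "q v v = 0")
      case True
      have "q u v = 0"
      proof (rule ccontr)
        assume n: "q u v \<noteq> 0"
        show False
          \<comment> \<open>For a null vector \<open>v\<close> the expression is affine in
            \<open>t\<close>, and at this \<open>t\<close> it equals -1.\<close>
          using p[of "- (q u u + 1) / (2 * q u v)"] n True by (simp add: field_simps)
      qed
      then show ?thesis using True by simp
    next
      case False
      then have g: "q v v > 0" using q_nonneg[OF v] by simp
      have "0 \<le> q u u - (q u v)\<^sup>2 / q v v"
        using p[of "- q u v / q v v"] g by (simp add: field_simps power2_eq_square)
      then show ?thesis using g by (simp add: field_simps)
    qed
  qed
  then have "bounded_by (q u u) (riesz u)" by (simp add: bounded_by_def riesz_def)
  moreover have "linear_on_W (riesz u)"
    using u by (auto simp: linear_on_W_def riesz_def q_add_right q_scale_right W_add W_scale)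
  ultimately show ?thesis using q_nonneg[OF u] unfolding dual_def by blast
qed

text \<open>Completing the square shifts the supremum that defines \<^const>\<open>sqnorm\<close>.\<close>

lemma sqnorm_add_riesz:
  assumes F: "F \<in> dual" and u: "u \<in> W"
  shows "sqnorm (\<lambda>w. F w + riesz u w) = sqnorm F + 2 * F u + q u u"
proof -
  have le: "sqnorm (\<lambda>w. F w + riesz u w) \<le> sqnorm F + 2 * F u + q u u"
    if F: "F \<in> dual" and u: "u \<in> W" for F u
    unfolding sqnorm_def[of "\<lambda>w. F w + riesz u w"]
  proof (rule cSUP_least[OF nonempty])
    fix v assume v: "v \<in> W"
    let ?s = "scale (-1) u"
    have "2 * F (add v ?s) - q (add v ?s) (add v ?s) \<le> sqnorm F"
      using F u v by (intro sqnorm_upper W_add W_scale)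
    then show "2 * (F v + riesz u v) - q v v \<le> sqnorm F + 2 * F u + q u u"
      using F u v by (simp add: dual_add dual_scale W_scale q_add_self q_scale_left
          q_scale_right riesz_def q_commute[of v u])
  qed
  let ?s = "scale (-1) u" and ?G = "\<lambda>w. F w + riesz u w"
  have G: "?G \<in> dual" by (intro dual_sum F riesz_dual u)
  have "(\<lambda>w. ?G w + riesz ?s w) = F"
    using u by (auto simp: riesz_def q_scale_left)
  then have "sqnorm F \<le> sqnorm ?G + 2 * ?G ?s + q u u"
    using le[OF G W_scale[OF u, of "-1"]] u by (simp add: q_scale_self)
  then have "sqnorm F \<le> sqnorm ?G - 2 * F u - q u u"
    using u F by (simp add: dual_scale riesz_def W_scale q_scale_right)
  then show ?thesis using le[OF F u] by simp
qed

lemma sqnorm_riesz: "u \<in> W \<Longrightarrow> sqnorm (riesz u) = q u u"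
  using sqnorm_add_riesz[OF dual_zero, of u] sqnorm_zero by simp

lemma dual_diff: "F \<in> dual \<Longrightarrow> G \<in> dual \<Longrightarrow> (\<lambda>w. F w - G w) \<in> dual"
  using dual_sum[of F "\<lambda>w. -1 * G w"] dual_scaled[of G "-1"] by simp

text \<open>Choose \<open>u\<close> almost attaining the supremum that defines
  \<open>sqnorm F\<close>. By \<open>sqnorm_add_riesz\<close> the deficit is exactly the squared
  norm of \<open>F\<close> minus the Riesz functional of \<open>u\<close>.\<close>

lemma riesz_dense:
  assumes F: "F \<in> dual" and e: "e > 0"
  obtains u where "u \<in> W" "sqnorm (\<lambda>w. F w - riesz u w) < e"
proof -
  obtain u where u: "u \<in> W" and l: "sqnorm F - e < 2 * F u - q u u"
    using less_cSUP_iff[OF nonempty, of "\<lambda>u. 2 * F u - q u u" "sqnorm F - e"] e sqnorm_upper[OF F]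
    unfolding sqnorm_def[symmetric] by (auto simp: bdd_above_def)
  have G: "(\<lambda>w. F w - riesz u w) \<in> dual" by (intro dual_diff F riesz_dual u)
  have "sqnorm F = sqnorm (\<lambda>w. F w - riesz u w) + 2 * (F u - q u u) + q u u"
    using sqnorm_add_riesz[OF G u] u by (simp add: riesz_def)
  with l u show thesis by (intro that[of u]) auto
qed

lemma sqnorm_perturb:
  assumes F: "F \<in> dual" and G: "G \<in> dual"
  shows "\<bar>sqrt (sqnorm F) - sqrt (sqnorm G)\<bar> \<le> sqrt (sqnorm (\<lambda>w. F w - G w))"
proof -
  have D: "(\<lambda>w. F w - G w) \<in> dual" by (intro dual_diff F G)
  have E: "(\<lambda>w. G w - F w) \<in> dual" by (intro dual_diff F G)
  have "sqnorm (\<lambda>w. G w - F w) = sqnorm (\<lambda>w. F w - G w)"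
    using sqnorm_scale[OF D, of "-1"] by simp
  then show ?thesis
    using sqnorm_triangle[OF D G] sqnorm_triangle[OF E F] by simp
qed

text \<open>Against a Riesz functional, polarisation is evaluation at its vector, by
  \<open>sqnorm_add_riesz\<close>, and Riesz functionals approximate \<open>G\<close>. One sequence
  \<open>u\<close> works for all \<open>F\<close>, so linearity of evaluation passes to the first
  argument of \<open>dual_inner\<close>.\<close>

lemma dual_inner_limit:
  assumes G: "G \<in> dual"
  obtains u where "\<And>n::nat. u n \<in> W" "\<And>F. F \<in> dual \<Longrightarrow> (\<lambda>n. F (u n)) \<longlonglongrightarrow> dual_inner F G"
proof -
  have "\<exists>v\<in>W. sqnorm (\<lambda>w. G w - riesz v w) < inverse (real (Suc n))" for n
  proof -
    have "inverse (real (Suc n)) > 0" by simp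
    then show ?thesis using riesz_dense[OF G] by blast
  qed
  then have "\<forall>n. \<exists>v. v \<in> W \<and> sqnorm (\<lambda>w. G w - riesz v w) < inverse (real (Suc n))" by blast
  from choice[OF this] obtain u where u: "\<And>n. u n \<in> W"
    and s: "\<And>n. sqnorm (\<lambda>w. G w - riesz (u n) w) < inverse (real (Suc n))" by blast
  have D: "(\<lambda>w. G w - riesz (u n) w) \<in> dual" for n by (intro dual_diff riesz_dual G u)
  have "(\<lambda>n. sqnorm (\<lambda>w. G w - riesz (u n) w)) \<longlonglongrightarrow> 0"
    by (rule tendsto_sandwich[OF always_eventually always_eventually tendsto_const LIMSEQ_inverse_real_of_nat])
      (use sqnorm_nonneg[OF D] less_imp_le[OF s] in blast)+
  from tendsto_real_sqrt[OF this]
  have z: "(\<lambda>n. sqrt (sqnorm (\<lambda>w. G w - riesz (u n) w))) \<longlonglongrightarrow> 0" by simp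
  have lim: "(\<lambda>n. sqnorm (\<lambda>w. F w + riesz (u n) w)) \<longlonglongrightarrow> sqnorm (\<lambda>w. F w + G w)"
    if F: "F \<in> dual" for F
  proof -
    have a: "norm (sqrt (sqnorm (\<lambda>w. F w + riesz (u n) w)) - sqrt (sqnorm (\<lambda>w. F w + G w)))
        \<le> sqrt (sqnorm (\<lambda>w. G w - riesz (u n) w))" for n
      using sqnorm_perturb[OF dual_sum[OF F G] dual_sum[OF F riesz_dual[OF u[of n]]]]
      by (simp add: abs_minus_commute)
    have "(\<lambda>n. sqrt (sqnorm (\<lambda>w. F w + riesz (u n) w)) - sqrt (sqnorm (\<lambda>w. F w + G w))) \<longlonglongrightarrow> 0"
      by (rule Lim_null_comparison[OF always_eventually z]) (use a in blast)
    then have "(\<lambda>n. sqrt (sqnorm (\<lambda>w. F w + riesz (u n) w))) \<longlonglongrightarrow> sqrt (sqnorm (\<lambda>w. F w + G w))"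
      by (rule LIM_zero_cancel)
    from tendsto_power[OF this, of 2] show ?thesis
      unfolding real_sqrt_pow2[OF sqnorm_nonneg[OF dual_sum[OF F G]]]
        real_sqrt_pow2[OF sqnorm_nonneg[OF dual_sum[OF F riesz_dual[OF u]]]] .
  qed
  show thesis
  proof (rule that[of u])
    fix F assume F: "F \<in> dual"
    \<comment> \<open>Writing the last term with \<open>0 + riesz\<close> lets \<open>lim\<close> be
      used with the zero functional as well.\<close>
    have "F (u n) = (sqnorm (\<lambda>w. F w + riesz (u n) w) - sqnorm F - sqnorm (\<lambda>w. 0 + riesz (u n) w)) / 2" for n
      unfolding sqnorm_add_riesz[OF F u[of n]] sqnorm_add_riesz[OF dual_zero u[of n]]
      using sqnorm_zero by simp
    then have eq: "(\<lambda>n. F (u n)) = (\<lambda>n. (sqnorm (\<lambda>w. F w + riesz (u n) w) - sqnorm F -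
        sqnorm (\<lambda>w. 0 + riesz (u n) w)) / 2)" by (rule ext)
    have "(\<lambda>n. F (u n)) \<longlonglongrightarrow> (sqnorm (\<lambda>w. F w + G w) - sqnorm F - sqnorm (\<lambda>w. 0 + G w)) / 2"
      unfolding eq
      by (rule tendsto_divide[OF tendsto_diff[OF tendsto_diff[OF lim[OF F] tendsto_const]
            lim[OF dual_zero]] tendsto_const]) simp
    then show "(\<lambda>n. F (u n)) \<longlonglongrightarrow> dual_inner F G" by (simp add: dual_inner_def)
  qed (rule u)
qed

lemma dual_inner_self:
  assumes "F \<in> dual" shows "dual_inner F F = sqnorm F"
proof -
  have "(\<lambda>w. F w + F w) = (\<lambda>w. 2 * F w)" by auto
  with sqnorm_scale[OF assms, of 2] have "sqnorm (\<lambda>w. F w + F w) = 4 * sqnorm F" by simp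
  then show ?thesis unfolding dual_inner_def by simp
qed

section \<open>The Hilbert space structure on the dual\<close>

definition dual_structure :: "('w \<Rightarrow> real) inner_structure" where
  "dual_structure = \<lparr>hcarrier = dual, hzero = (\<lambda>w. 0), hadd = (\<lambda>F G w. F w + G w),
     hscale = (\<lambda>c F w. c * F w), hinner = dual_inner\<rparr>"

lemma dual_structure_simps [simp]:
  "hcarrier dual_structure = dual" "hzero dual_structure = (\<lambda>w. 0)"
  "hadd dual_structure F G = (\<lambda>w. F w + G w)" "hscale dual_structure c F = (\<lambda>w. c * F w)"
  "hinner dual_structure = dual_inner"
  by (simp_all add: dual_structure_def)

lemma hnorm_dual: "F \<in> dual \<Longrightarrow> hnorm dual_structure F = sqrt (sqnorm F)"
  by (simp add: hnorm_def dual_inner_self)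

lemma hdiff_dual: "hdiff dual_structure F G = (\<lambda>w. F w - G w)"
  by (simp add: hdiff_def)

lemma inner_space_dual: "inner_space dual_structure"
proof
  fix F G L :: "'w \<Rightarrow> real" and c :: real
  assume F: "F \<in> hcarrier dual_structure"
  show "0 \<le> hinner dual_structure F F" using F by (simp add: dual_inner_self sqnorm_nonneg)
  \<comment> \<open>On \<open>W\<close> the norm bound forces \<open>F\<close> to vanish, and off
    \<open>W\<close> it vanishes by convention.\<close>
  show "F = hzero dual_structure" if z: "hinner dual_structure F F = 0"
  proof
    fix w show "F w = hzero dual_structure w"
      using dual_sqrt_bound[of F w] F z dual_outside[of F w]
      by (cases "w \<in> W") (auto simp: dual_inner_self)
  qed
  assume G: "G \<in> hcarrier dual_structure"
  show "hinner dual_structure F G = hinner dual_structure G F"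
    by (simp add: dual_inner_def add.commute)
  show "hinner dual_structure (hscale dual_structure c F) G = c * hinner dual_structure F G"
  proof -
    obtain u where "\<And>F. F \<in> dual \<Longrightarrow> (\<lambda>n::nat. F (u n)) \<longlonglongrightarrow> dual_inner F G"
      using G dual_inner_limit[of G thesis] unfolding dual_structure_simps by blast
    note lim = this
    have "(\<lambda>n. c * F (u n)) \<longlonglongrightarrow> c * dual_inner F G"
      using F by (intro tendsto_mult_left lim) simp
    moreover have "(\<lambda>n. c * F (u n)) \<longlonglongrightarrow> dual_inner (\<lambda>w. c * F w) G"
      using F by (intro lim dual_scaled) simp
    ultimately show ?thesis unfolding dual_structure_simps by (rule LIMSEQ_unique[rotated])
  qed
  show "hinner dual_structure (hadd dual_structure F L) G =
      hinner dual_structure F G + hinner dual_structure L G" if L: "L \<in> hcarrier dual_structure"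
  proof -
    obtain u where "\<And>F. F \<in> dual \<Longrightarrow> (\<lambda>n::nat. F (u n)) \<longlonglongrightarrow> dual_inner F G"
      using G dual_inner_limit[of G thesis] unfolding dual_structure_simps by blast
    note lim = this
    have "(\<lambda>n. F (u n) + L (u n)) \<longlonglongrightarrow> dual_inner F G + dual_inner L G"
      using F L by (intro tendsto_add lim) simp_all
    moreover have "(\<lambda>n. F (u n) + L (u n)) \<longlonglongrightarrow> dual_inner (\<lambda>w. F w + L w) G"
      using F L by (intro lim dual_sum) simp_all
    ultimately show ?thesis unfolding dual_structure_simps by (rule LIMSEQ_unique[rotated])
  qed
qed (simp_all add: dual_zero dual_sum dual_scaled add_ac distrib_left distrib_right mult.assoc)

text \<open>The limit is taken pointwise. The Cauchy estimate at each vector has the form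
  \<open>bounded_by e\<close> and survives the limit in one index.\<close>

lemma dual_complete:
  assumes F: "\<And>n::nat. F n \<in> dual"
    and C: "\<And>e. e > 0 \<Longrightarrow> \<exists>N. \<forall>m\<ge>N. \<forall>n\<ge>N. sqnorm (\<lambda>w. F m w - F n w) < e"
  obtains L where "L \<in> dual" "\<And>e. e > 0 \<Longrightarrow> \<exists>N. \<forall>n\<ge>N. sqnorm (\<lambda>w. F n w - L w) \<le> e"
proof -
  have D: "(\<lambda>w. F m w - F n w) \<in> dual" for m n by (intro dual_diff F)
  have "convergent (\<lambda>n. F n w)" for w
  proof (cases "w \<in> W")
    case False
    then show ?thesis using dual_outside[OF F] by (simp add: convergent_const)
  next
    case w: True
    have "\<exists>N. \<forall>m\<ge>N. \<forall>n\<ge>N. norm (F m w - F n w) < e" if e: "e > 0" for e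
    proof -
      \<comment> \<open>The summand 1 allows division when \<open>w\<close> is a null
        vector.\<close>
      have p: "q w w + 1 > 0" using q_nonneg[OF w] by simp
      obtain N where N: "\<And>m n. m \<ge> N \<Longrightarrow> n \<ge> N \<Longrightarrow> sqnorm (\<lambda>w. F m w - F n w) < e\<^sup>2 / (q w w + 1)"
        using C[of "e\<^sup>2 / (q w w + 1)"] e p by auto
      have "\<bar>F m w - F n w\<bar> < e" if "m \<ge> N" "n \<ge> N" for m n
      proof -
        have "(F m w - F n w)\<^sup>2 \<le> sqnorm (\<lambda>w. F m w - F n w) * q w w"
          using sqnorm_bound[OF D] w by (simp add: bounded_by_def)
        also have "\<dots> \<le> sqnorm (\<lambda>w. F m w - F n w) * (q w w + 1)"
          by (intro mult_left_mono sqnorm_nonneg D) simp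
        also have "\<dots> < e\<^sup>2" using N[OF that] p by (simp add: field_simps)
        finally show ?thesis using e abs_le_square_iff[of e "F m w - F n w"] by linarith
      qed
      then show ?thesis by auto
    qed
    then show ?thesis by (simp add: Cauchy_iff flip: Cauchy_convergent_iff)
  qed
  then obtain L where L: "\<And>w. (\<lambda>n. F n w) \<longlonglongrightarrow> L w" unfolding convergent_def by metis
  have lin: "linear_on_W L"
    unfolding linear_on_W_def
  proof (intro conjI allI impI ballI)
    show "L w = 0" if "w \<notin> W" for w
      using L[of w] dual_outside[OF F that] by (simp add: LIMSEQ_const_iff)
    show "L (add u v) = L u + L v" if "u \<in> W" "v \<in> W" for u v
      using LIMSEQ_unique[OF L[of "add u v"]] tendsto_add[OF L[of u] L[of v]] dual_add[OF F that]
      by presburger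
    show "L (scale c u) = c * L u" if "u \<in> W" for c u
      using LIMSEQ_unique[OF L[of "scale c u"]] tendsto_mult_left[OF L[of u], of c] dual_scale[OF F that]
      by presburger
  qed
  have lim: "\<exists>N. \<forall>n\<ge>N. bounded_by e (\<lambda>w. F n w - L w)" if e: "e > 0" for e
  proof -
    obtain N where N: "\<And>m n. m \<ge> N \<Longrightarrow> n \<ge> N \<Longrightarrow> sqnorm (\<lambda>w. F m w - F n w) < e"
      using C[OF e] by auto
    have "(F n u - L u)\<^sup>2 \<le> e * q u u" if n: "n \<ge> N" and u: "u \<in> W" for n u
    proof (rule LIMSEQ_le_const2)
      show "(\<lambda>m. (F n u - F m u)\<^sup>2) \<longlonglongrightarrow> (F n u - L u)\<^sup>2" by (intro tendsto_intros L)
      have "(F n u - F m u)\<^sup>2 \<le> e * q u u" if m: "m \<ge> N" for m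
      proof -
        have "(F n u - F m u)\<^sup>2 \<le> sqnorm (\<lambda>w. F n w - F m w) * q u u"
          using sqnorm_bound[OF D] u by (simp add: bounded_by_def)
        also have "\<dots> \<le> e * q u u"
          using N[OF n m] q_nonneg[OF u] by (intro mult_right_mono) auto
        finally show ?thesis .
      qed
      then show "\<exists>N. \<forall>m\<ge>N. (F n u - F m u)\<^sup>2 \<le> e * q u u" by auto
    qed
    then show ?thesis unfolding bounded_by_def by auto
  qed
  \<comment> \<open>Boundedness of \<open>L\<close> is obtained indirectly: \<open>F N\<close> and
    \<open>F N - L\<close> are in the dual, hence so is their difference.\<close>
  obtain N where "bounded_by 1 (\<lambda>w. F N w - L w)" using lim[of 1] by auto
  moreover have "linear_on_W (\<lambda>w. F N w - L w)"
    using lin F[of N] by (simp add: dual_def linear_on_W_def right_diff_distrib)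
  ultimately have "(\<lambda>w. F N w - L w) \<in> dual" unfolding dual_def using zero_le_one by blast
  from dual_diff[OF F[of N] this] have "L \<in> dual" by simp
  moreover have "\<exists>N. \<forall>n\<ge>N. sqnorm (\<lambda>w. F n w - L w) \<le> e" if "e > 0" for e
    using lim[OF that] sqnorm_le[of e] that by (meson less_imp_le)
  ultimately show thesis by (rule that)
qed

lemma hilbert_space_dual: "hilbert_space dual_structure"
proof -
  interpret inner_space dual_structure by (rule inner_space_dual)
  interpret M: Metric_space "hcarrier dual_structure" "hdist dual_structure" by (rule Metric_space_hdist)
  have dist: "hdist dual_structure F G = sqrt (sqnorm (\<lambda>w. F w - G w))"
    if "F \<in> dual" "G \<in> dual" for F G
    using that by (simp add: hdist_def hdiff_dual hnorm_dual dual_diff)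
  have "M.mcomplete"
    unfolding M.mcomplete_def
  proof (intro allI impI)
    fix F :: "nat \<Rightarrow> 'w \<Rightarrow> real" assume "M.MCauchy F"
    then have F: "\<And>n. F n \<in> dual"
      and C0: "\<And>e. e > 0 \<Longrightarrow> \<exists>N. \<forall>m\<ge>N. \<forall>n\<ge>N. hdist dual_structure (F m) (F n) < e"
      unfolding M.MCauchy_def image_subset_iff by (simp, blast)
    have C: "\<exists>N. \<forall>m\<ge>N. \<forall>n\<ge>N. sqrt (sqnorm (\<lambda>w. F m w - F n w)) < e" if "e > 0" for e
      using C0[OF that] by (simp add: dist[OF F F])
    have C': "\<exists>N. \<forall>m\<ge>N. \<forall>n\<ge>N. sqnorm (\<lambda>w. F m w - F n w) < e" if e: "e > 0" for e
      using C[of "sqrt e"] e by simp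
    obtain L where L: "L \<in> dual"
      and lim: "\<And>e. e > 0 \<Longrightarrow> \<exists>N. \<forall>n\<ge>N. sqnorm (\<lambda>w. F n w - L w) \<le> e"
      using dual_complete[OF F C'] by blast
    have "\<exists>N. \<forall>n\<ge>N. hdist dual_structure (F n) L < e" if e: "e > 0" for e
    proof -
      \<comment> \<open>The factor 1/2 turns the weak inequality of \<open>lim\<close> into a strict
        one.\<close>
      obtain N where "\<forall>n\<ge>N. sqnorm (\<lambda>w. F n w - L w) \<le> e\<^sup>2 / 2" using lim[of "e\<^sup>2 / 2"] e by auto
      moreover have "e\<^sup>2 / 2 < e\<^sup>2" using e by simp
      ultimately have "\<forall>n\<ge>N. sqnorm (\<lambda>w. F n w - L w) < e\<^sup>2" by (meson le_less_trans)
      then have "\<forall>n\<ge>N. sqrt (sqnorm (\<lambda>w. F n w - L w)) < e"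
        using e by (simp add: real_less_lsqrt)
      then show ?thesis unfolding dist[OF F L] by blast
    qed
    then show "\<exists>x. limitin M.mtopology F x sequentially"
      unfolding M.limit_metric_sequentially using L F by (intro exI[of _ L] conjI allI impI) simp_all
  qed
  then show ?thesis
    by unfold_locales (simp add: hmetric_def M.mcomplete_of del: dual_structure_simps)
qed

end


section \<open>Affine isometric actions\<close>

context inner_space
begin

lemma add_left_commute:
  "x \<in> hcarrier H \<Longrightarrow> y \<in> hcarrier H \<Longrightarrow> z \<in> hcarrier H \<Longrightarrow>
    hadd H x (hadd H y z) = hadd H y (hadd H x z)"
  by (metis add_assoc add_commute)

lemma hnorm_nonneg: "x \<in> hcarrier H \<Longrightarrow> 0 \<le> hnorm H x"
  by (simp add: hnorm_def inner_nonneg)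

lemma hnorm_sq: "x \<in> hcarrier H \<Longrightarrow> (hnorm H x)\<^sup>2 = hinner H x x"
  by (simp add: hnorm_def inner_nonneg)

lemma hnorm_scale: "x \<in> hcarrier H \<Longrightarrow> hnorm H (hscale H a x) = \<bar>a\<bar> * hnorm H x"
  by (simp add: hnorm_def inner_scale_left inner_scale_right scale_closed real_sqrt_mult
      mult.assoc[symmetric])

lemma hdist_eq: "x \<in> hcarrier H \<Longrightarrow> y \<in> hcarrier H \<Longrightarrow> hdist H x y = hnorm H (hdiff H x y)"
  by (simp add: hdist_def)

lemma hnorm_hdiff_commute:
  "x \<in> hcarrier H \<Longrightarrow> y \<in> hcarrier H \<Longrightarrow> hnorm H (hdiff H x y) = hnorm H (hdiff H y x)"
  using Metric_space.commute[OF Metric_space_hdist, of x y] by (simp add: hdist_eq)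

lemma hnorm_hdiff_triangle:
  "x \<in> hcarrier H \<Longrightarrow> y \<in> hcarrier H \<Longrightarrow> z \<in> hcarrier H \<Longrightarrow>
    hnorm H (hdiff H x z) \<le> hnorm H (hdiff H x y) + hnorm H (hdiff H y z)"
  using Metric_space.triangle[OF Metric_space_hdist, of x y z] by (simp add: hdist_eq)

lemma hnorm_hdiff_le:
  "x \<in> hcarrier H \<Longrightarrow> y \<in> hcarrier H \<Longrightarrow> hnorm H (hdiff H x y) \<le> hnorm H x + hnorm H y"
  using hnorm_triangle[of x "hscale H (-1) y"] by (simp add: hdiff_def scale_closed hnorm_scale)

lemma hdiff_hadd:
  assumes "a \<in> hcarrier H" "b \<in> hcarrier H" "x \<in> hcarrier H" "y \<in> hcarrier H"
  shows "hdiff H (hadd H a b) (hadd H x y) = hadd H (hdiff H a x) (hdiff H b y)"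
  using assms by (simp add: hdiff_def add_assoc add_left_commute[of b] add_closed scale_closed
      scale_add_right)

lemma hdiff_scale:
  assumes "a \<in> hcarrier H" "b \<in> hcarrier H"
  shows "hdiff H (hscale H c a) (hscale H c b) = hscale H c (hdiff H a b)"
  using assms by (simp add: hdiff_def scale_add_right scale_scale scale_closed mult.commute)

lemma hdiff_hadd_right:
  assumes "a \<in> hcarrier H" "b \<in> hcarrier H" "x \<in> hcarrier H"
  shows "hdiff H (hadd H a x) (hadd H b x) = hdiff H a b"
  using assms by (simp add: hdiff_hadd hdiff_closed add_uminus add_zero hdiff_def[of H x x])

lemma hdiff_hadd_cancel:
  assumes "a \<in> hcarrier H" "b \<in> hcarrier H"
  shows "hdiff H (hadd H a b) a = b"
proof -
  have "hdiff H (hadd H a b) a = hadd H (hadd H a (hscale H (-1) a)) b"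
    using assms by (simp add: hdiff_def add_assoc add_commute[of b] scale_closed add_closed)
  then show ?thesis using assms by (simp add: add_uminus add_commute[of "hzero H"] zero_closed add_zero)
qed

lemma hdiff_telescope:
  assumes "a \<in> hcarrier H" "b \<in> hcarrier H" "c \<in> hcarrier H"
  shows "hadd H (hdiff H a b) (hdiff H b c) = hdiff H a c"
proof -
  have "hadd H (hdiff H a b) (hdiff H b c) =
      hadd H a (hadd H (hadd H b (hscale H (-1) b)) (hscale H (-1) c))"
    using assms by (simp add: hdiff_def add_assoc add_commute[of "hscale H (-1) b"] scale_closed
        add_closed add_left_commute[of "hscale H (-1) b"])
  then show ?thesis
    using assms by (simp add: add_uminus add_commute[of "hzero H"] zero_closed add_zero
        scale_closed hdiff_def)
qed

lemma inner_perturb: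
  assumes "a \<in> hcarrier H" "b \<in> hcarrier H" "x \<in> hcarrier H" "y \<in> hcarrier H"
  shows "\<bar>hinner H a b - hinner H x y\<bar> \<le> hnorm H (hdiff H a x) * hnorm H b + hnorm H x * hnorm H (hdiff H b y)"
proof -
  have "hinner H a b - hinner H x y = hinner H (hdiff H a x) b + hinner H x (hdiff H b y)"
    using assms by (simp add: hdiff_def inner_add_left inner_add_right inner_scale_left
        inner_scale_right scale_closed)
  then show ?thesis
    using Cauchy_Schwarz[of "hdiff H a x" b] Cauchy_Schwarz[of x "hdiff H b y"] assms
    by (simp add: hdiff_closed)
qed

end

lemma (in inner_space) isometric_representation_facts:
  assumes "isometric_representation H \<pi>"
  shows rep_closed: "x \<in> hcarrier H \<Longrightarrow> \<pi> g x \<in> hcarrier H"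
    and rep_norm: "x \<in> hcarrier H \<Longrightarrow> hnorm H (\<pi> g x) = hnorm H x"
    and rep_add: "x \<in> hcarrier H \<Longrightarrow> y \<in> hcarrier H \<Longrightarrow> \<pi> g (hadd H x y) = hadd H (\<pi> g x) (\<pi> g y)"
    and rep_scale: "x \<in> hcarrier H \<Longrightarrow> \<pi> g (hscale H a x) = hscale H a (\<pi> g x)"
    and rep_zero: "x \<in> hcarrier H \<Longrightarrow> \<pi> 0 x = x"
    and rep_mult: "x \<in> hcarrier H \<Longrightarrow> \<pi> (g + f) x = \<pi> g (\<pi> f x)"
    and rep_hdiff: "x \<in> hcarrier H \<Longrightarrow> y \<in> hcarrier H \<Longrightarrow> \<pi> g (hdiff H x y) = hdiff H (\<pi> g x) (\<pi> g y)"
proof -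
  have lin: "linear_isometric_bijection H (\<pi> g)" for g
    using assms by (simp add: isometric_representation_def)
  show c: "\<pi> g x \<in> hcarrier H" if "x \<in> hcarrier H" for x
    using lin that unfolding linear_isometric_bijection_def by (meson bij_betwE)
  show "hnorm H (\<pi> g x) = hnorm H x" if "x \<in> hcarrier H"
    using lin that unfolding linear_isometric_bijection_def by blast
  show a: "\<pi> g (hadd H x y) = hadd H (\<pi> g x) (\<pi> g y)" if "x \<in> hcarrier H" "y \<in> hcarrier H" for x y
    using lin that unfolding linear_isometric_bijection_def by blast
  show s: "\<pi> g (hscale H a x) = hscale H a (\<pi> g x)" if "x \<in> hcarrier H" for a x
    using lin that unfolding linear_isometric_bijection_def by blast
  show "\<pi> g (hdiff H x y) = hdiff H (\<pi> g x) (\<pi> g y)" if "x \<in> hcarrier H" "y \<in> hcarrier H"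
    using that by (simp add: hdiff_def a s scale_closed)
qed (use assms in \<open>auto simp: isometric_representation_def\<close>)

text \<open>Because every group element acts by an isometry, joint continuity reduces to
  neighbourhoods of \<open>0\<close>. For properness one orbit suffices, since \<open>b g\<close>
  and the displacement of \<xi> differ in norm by at most twice the norm of \<xi>.\<close>

lemma haagerup_propertyI:
  fixes H :: "'h inner_structure" and \<pi> :: "'g::topological_group_add \<Rightarrow> 'h \<Rightarrow> 'h"
  assumes hilb: "hilbert_space H" and rep: "isometric_representation H \<pi>"
    and b: "\<And>g. b g \<in> hcarrier H" and cocycle: "\<And>g f. b (g + f) = hadd H (\<pi> g (b f)) (b g)"
    and rep_cont: "\<And>\<xi> e. \<xi> \<in> hcarrier H \<Longrightarrow> e > 0 \<Longrightarrow>
      \<exists>U. open U \<and> 0 \<in> U \<and> (\<forall>g\<in>U. hnorm H (hdiff H (\<pi> g \<xi>) \<xi>) < e)"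
    and b_cont: "\<And>e. e > 0 \<Longrightarrow> \<exists>U. open U \<and> 0 \<in> U \<and> (\<forall>g\<in>U. hnorm H (b g) < e)"
    and proper: "\<And>g. tends_to_infinity g \<Longrightarrow> filterlim (\<lambda>n. hnorm H (b (g n))) at_top sequentially"
  shows "haagerup_property TYPE('g) TYPE('h)"
proof -
  interpret hilbert_space H by (rule hilb)
  interpret M: Metric_space "hcarrier H" "hdist H" by (rule Metric_space_hdist)
  note rf = isometric_representation_facts[OF rep]
  define \<alpha> where "\<alpha> g \<xi> = hadd H (\<pi> g \<xi>) (b g)" for g \<xi>
  have \<alpha>_closed: "\<alpha> g \<xi> \<in> hcarrier H" if "\<xi> \<in> hcarrier H" for g \<xi>
    using that by (simp add: \<alpha>_def add_closed rf b)
  have \<alpha>_mult: "\<alpha> (g + f) \<xi> = \<alpha> g (\<alpha> f \<xi>)" if "\<xi> \<in> hcarrier H" for g f \<xi>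
    using that by (simp add: \<alpha>_def cocycle rf b add_assoc)
  have \<alpha>_dist: "hnorm H (hdiff H (\<alpha> g \<xi>) (\<alpha> g \<zeta>)) = hnorm H (hdiff H \<xi> \<zeta>)"
    if "\<xi> \<in> hcarrier H" "\<zeta> \<in> hcarrier H" for g \<xi> \<zeta>
    using that by (simp add: \<alpha>_def hdiff_hadd_right rf b hdiff_closed flip: rf(7))
  have aff: "affine_isometric_action H \<alpha>"
    unfolding affine_isometric_action_def using rep b cocycle by (auto simp: \<alpha>_def)
  have cont: "continuous_action H \<alpha>"
  proof -
    have "\<exists>U. openin (prod_topology euclidean M.mtopology) U \<and> p \<in> U \<and>
        (\<forall>y\<in>U. (\<lambda>(g, \<xi>). \<alpha> g \<xi>) y \<in> M.mball ((\<lambda>(g, \<xi>). \<alpha> g \<xi>) p) e)"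
      if p: "p \<in> topspace (prod_topology (euclidean :: 'g topology) M.mtopology)" and e: "e > 0" for p e
    proof -
      obtain g \<xi> where p_eq: "p = (g, \<xi>)" and \<xi>: "\<xi> \<in> hcarrier H" using p by (cases p) auto
      have e3: "e / 3 > 0" using e by simp
      obtain U where U: "open U" "0 \<in> U" "\<And>g. g \<in> U \<Longrightarrow> hnorm H (hdiff H (\<pi> g \<xi>) \<xi>) < e / 3"
        using rep_cont[OF \<xi> e3] by blast
      obtain V where V: "open V" "0 \<in> V" "\<And>g. g \<in> V \<Longrightarrow> hnorm H (b g) < e / 3"
        using b_cont[OF e3] by blast
      let ?N = "{w. - g + w \<in> U \<inter> V} \<times> M.mball \<xi> (e / 3)"
      have "openin (prod_topology euclidean M.mtopology) ?N"
        using open_left_translate[OF open_Int[OF U(1) V(1)]] M.openin_mball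
        unfolding openin_prod_Times_iff open_openin[symmetric] by blast
      moreover have "p \<in> ?N" using U(2) V(2) \<xi> e3 by (simp add: p_eq)
      moreover have "\<alpha> w \<zeta> \<in> M.mball (\<alpha> g \<xi>) e" if w: "(w, \<zeta>) \<in> ?N" for w \<zeta>
      proof -
        let ?h = "- g + w"
        have \<zeta>: "\<zeta> \<in> hcarrier H" "hnorm H (hdiff H \<xi> \<zeta>) < e / 3"
          using w \<xi> by (auto simp: M.in_mball hdist_eq)
        have h: "?h \<in> U" "?h \<in> V" using w by auto
        have w_eq: "w = g + ?h" by (simp add: add.assoc[symmetric])
        \<comment> \<open>As \<open>w = g + ?h\<close>, the isometry \<open>\<alpha> g\<close>
          cancels. Three terms remain: the motion of \<xi> under \<open>\<pi> ?h\<close>, the norm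
          of \<open>b ?h\<close>, and the distance from \<xi> to \<zeta>.\<close>
        have "hnorm H (hdiff H (\<alpha> g \<xi>) (\<alpha> w \<zeta>)) = hnorm H (hdiff H \<xi> (\<alpha> ?h \<zeta>))"
          by (subst w_eq) (simp only: \<alpha>_mult \<alpha>_dist \<alpha>_closed \<xi> \<zeta>)
        also have "\<dots> \<le> hnorm H (hdiff H \<xi> (\<pi> ?h \<xi>)) + hnorm H (hdiff H (\<pi> ?h \<xi>) (\<alpha> ?h \<zeta>))"
          using \<xi> \<zeta> by (intro hnorm_hdiff_triangle rf \<alpha>_closed)
        also have "\<dots> \<le> hnorm H (hdiff H \<xi> (\<pi> ?h \<xi>)) +
            (hnorm H (hdiff H (\<pi> ?h \<xi>) (\<alpha> ?h \<xi>)) + hnorm H (hdiff H (\<alpha> ?h \<xi>) (\<alpha> ?h \<zeta>)))"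
          using \<xi> \<zeta> by (intro add_left_mono hnorm_hdiff_triangle rf \<alpha>_closed)
        also have "hnorm H (hdiff H (\<alpha> ?h \<xi>) (\<alpha> ?h \<zeta>)) = hnorm H (hdiff H \<xi> \<zeta>)"
          using \<xi> \<zeta> by (intro \<alpha>_dist)
        also have "hnorm H (hdiff H (\<pi> ?h \<xi>) (\<alpha> ?h \<xi>)) = hnorm H (b ?h)"
          using \<xi> hnorm_hdiff_commute[of "\<pi> ?h \<xi>" "\<alpha> ?h \<xi>"]
          by (simp add: \<alpha>_def rf b add_closed hdiff_hadd_cancel)
        also have "hnorm H (hdiff H \<xi> (\<pi> ?h \<xi>)) = hnorm H (hdiff H (\<pi> ?h \<xi>) \<xi>)"
          using \<xi> by (intro hnorm_hdiff_commute rf)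
        finally show ?thesis
          using U(3)[OF h(1)] V(3)[OF h(2)] \<xi> \<zeta> by (simp add: M.in_mball hdist_eq \<alpha>_closed)
      qed
      ultimately show ?thesis by (intro exI[of _ ?N]) (auto simp: p_eq)
    qed
    then have "continuous_map (prod_topology euclidean M.mtopology) M.mtopology (\<lambda>(g, \<xi>). \<alpha> g \<xi>)"
      unfolding M.continuous_map_to_metric by blast
    then show ?thesis by (simp add: continuous_action_def mtopology_of_def)
  qed
  have "metrically_proper_action H \<alpha>"
    unfolding metrically_proper_action_def
  proof (intro ballI allI impI)
    fix \<xi> and g :: "nat \<Rightarrow> 'g" assume \<xi>: "\<xi> \<in> hcarrier H" and g: "tends_to_infinity g"
    have le: "hnorm H (b (g n)) - 2 * hnorm H \<xi> \<le> hnorm H (hdiff H (\<alpha> (g n) \<xi>) \<xi>)" for n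
    proof -
      have "hnorm H (b (g n)) = hnorm H (hdiff H (\<alpha> (g n) \<xi>) (\<pi> (g n) \<xi>))"
        using \<xi> by (simp add: \<alpha>_def hdiff_hadd_cancel rf b)
      also have "\<dots> \<le> hnorm H (hdiff H (\<alpha> (g n) \<xi>) \<xi>) + hnorm H (hdiff H \<xi> (\<pi> (g n) \<xi>))"
        using \<xi> by (intro hnorm_hdiff_triangle rf \<alpha>_closed)
      also have "hnorm H (hdiff H \<xi> (\<pi> (g n) \<xi>)) \<le> hnorm H \<xi> + hnorm H (\<pi> (g n) \<xi>)"
        using \<xi> by (intro hnorm_hdiff_le rf)
      finally show ?thesis using \<xi> by (simp add: rf)
    qed
    show "filterlim (\<lambda>n. hnorm H (hdiff H (\<alpha> (g n) \<xi>) \<xi>)) at_top sequentially"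
      unfolding filterlim_real_at_top_iff
    proof
      fix K
      obtain N where "\<And>n. n \<ge> N \<Longrightarrow> K + 2 * hnorm H \<xi> \<le> hnorm H (b (g n))"
        using proper[OF g] unfolding filterlim_real_at_top_iff by blast
      then have "\<forall>n\<ge>N. K \<le> hnorm H (hdiff H (\<alpha> (g n) \<xi>) \<xi>)" using le by (smt (verit))
      then show "\<exists>N. \<forall>n\<ge>N. K \<le> hnorm H (hdiff H (\<alpha> (g n) \<xi>) \<xi>)" by blast
    qed
  qed
  with hilb aff cont show ?thesis unfolding haagerup_property_def by blast
qed

section \<open>Transport of Hilbert spaces along injections\<close>

definition transport_structure :: "('k \<Rightarrow> 'h) \<Rightarrow> 'k inner_structure \<Rightarrow> 'h inner_structure" where
  "transport_structure J H = (let I = inv_into (hcarrier H) J in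
     \<lparr>hcarrier = J ` hcarrier H, hzero = J (hzero H), hadd = (\<lambda>x y. J (hadd H (I x) (I y))),
      hscale = (\<lambda>a x. J (hscale H a (I x))), hinner = (\<lambda>x y. hinner H (I x) (I y))\<rparr>)"

lemma
  fixes J :: "'k \<Rightarrow> 'h"
  assumes hilb: "hilbert_space H" and J: "inj_on J (hcarrier H)"
  shows transport_carrier: "hcarrier (transport_structure J H) = J ` hcarrier H"
    and transport_add: "x \<in> hcarrier H \<Longrightarrow> y \<in> hcarrier H \<Longrightarrow>
      hadd (transport_structure J H) (J x) (J y) = J (hadd H x y)"
    and transport_scale: "x \<in> hcarrier H \<Longrightarrow> hscale (transport_structure J H) a (J x) = J (hscale H a x)"
    and transport_norm: "x \<in> hcarrier H \<Longrightarrow> hnorm (transport_structure J H) (J x) = hnorm H x"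
    and transport_diff: "x \<in> hcarrier H \<Longrightarrow> y \<in> hcarrier H \<Longrightarrow>
      hdiff (transport_structure J H) (J x) (J y) = J (hdiff H x y)"
    and transport_hilbert_space: "hilbert_space (transport_structure J H)"
proof -
  interpret hilbert_space H by (rule hilb)
  let ?K = "transport_structure J H"
  have I: "inv_into (hcarrier H) J (J x) = x" if "x \<in> hcarrier H" for x
    using J that by simp
  show c: "hcarrier ?K = J ` hcarrier H" by (simp add: transport_structure_def Let_def)
  have z: "hzero ?K = J (hzero H)" by (simp add: transport_structure_def Let_def)
  show a: "hadd ?K (J x) (J y) = J (hadd H x y)" if "x \<in> hcarrier H" "y \<in> hcarrier H" for x y
    using that by (simp add: transport_structure_def Let_def I)
  show s: "hscale ?K a (J x) = J (hscale H a x)" if "x \<in> hcarrier H" for a x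
    using that by (simp add: transport_structure_def Let_def I)
  have i: "hinner ?K (J x) (J y) = hinner H x y" if "x \<in> hcarrier H" "y \<in> hcarrier H" for x y
    using that by (simp add: transport_structure_def Let_def I)
  show n: "hnorm ?K (J x) = hnorm H x" if "x \<in> hcarrier H" for x
    using that by (simp add: hnorm_def i)
  show d: "hdiff ?K (J x) (J y) = J (hdiff H x y)" if "x \<in> hcarrier H" "y \<in> hcarrier H" for x y
    using that by (simp add: hdiff_def a s scale_closed)
  have K: "inner_space ?K"
  proof
    show "x = hzero ?K" if "x \<in> hcarrier ?K" "hinner ?K x x = 0" for x
      using that inner_eq_zero by (auto simp: c i z)
    show "hadd ?K x y = hadd ?K y x" if "x \<in> hcarrier ?K" "y \<in> hcarrier ?K" for x y
      using that add_commute by (auto simp: c a)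
  qed (auto simp: c z a s i zero_closed add_closed scale_closed add_assoc add_zero add_uminus
      scale_scale scale_one scale_add_right scale_add_left inner_add_left inner_scale_left inner_nonneg
      intro: inner_commute)
  interpret K: inner_space ?K by (rule K)
  interpret M: Metric_space "hcarrier H" "hdist H" by (rule Metric_space_hdist)
  interpret N: Metric_space "hcarrier ?K" "hdist ?K" by (rule K.Metric_space_hdist)
  have dist: "hdist ?K (J x) (J y) = hdist H x y" if "x \<in> hcarrier H" "y \<in> hcarrier H" for x y
    using that by (simp add: hdist_def c d n hdiff_closed)
  have "N.mcomplete"
    unfolding N.mcomplete_def
  proof (intro allI impI)
    fix \<sigma> assume \<sigma>: "N.MCauchy \<sigma>"
    then have "range \<sigma> \<subseteq> hcarrier ?K" unfolding N.MCauchy_def by blast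
    then have "\<forall>n. \<exists>x. x \<in> hcarrier H \<and> \<sigma> n = J x" unfolding c by blast
    from choice[OF this] obtain \<tau> where \<tau>: "\<And>n. \<tau> n \<in> hcarrier H" and \<sigma>_eq: "\<And>n. \<sigma> n = J (\<tau> n)"
      by blast
    have "M.MCauchy \<tau>"
      using \<sigma> \<tau> unfolding N.MCauchy_def M.MCauchy_def by (auto simp: \<sigma>_eq dist)
    moreover have "M.mcomplete" using complete by (simp add: mcomplete_of_def)
    ultimately obtain l where "limitin M.mtopology \<tau> l sequentially"
      unfolding M.mcomplete_def by blast
    then have "limitin N.mtopology \<sigma> (J l) sequentially"
      unfolding M.limit_metric_sequentially N.limit_metric_sequentially
      using \<tau> by (simp add: \<sigma>_eq c dist)
    then show "\<exists>x. limitin N.mtopology \<sigma> x sequentially" by blast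
  qed
  then show "hilbert_space ?K"
    by (simp add: hilbert_space_def hilbert_space_axioms_def K mcomplete_of_def)
qed

text \<open>The averaged Hilbert space consists of functionals, so it lives over another type; the
  injection \<open>J\<close> moves it and its action into the universe \<open>'h\<close>.\<close>

lemma haagerup_property_transport:
  fixes H :: "'k inner_structure" and \<pi> :: "'g::topological_group_add \<Rightarrow> 'k \<Rightarrow> 'k" and J :: "'k \<Rightarrow> 'h"
  assumes hilb: "hilbert_space H" and rep: "isometric_representation H \<pi>"
    and b: "\<And>g. b g \<in> hcarrier H" and cocycle: "\<And>g f. b (g + f) = hadd H (\<pi> g (b f)) (b g)"
    and rep_cont: "\<And>\<xi> e. \<xi> \<in> hcarrier H \<Longrightarrow> e > 0 \<Longrightarrow>
      \<exists>U. open U \<and> 0 \<in> U \<and> (\<forall>g\<in>U. hnorm H (hdiff H (\<pi> g \<xi>) \<xi>) < e)"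
    and b_cont: "\<And>e. e > 0 \<Longrightarrow> \<exists>U. open U \<and> 0 \<in> U \<and> (\<forall>g\<in>U. hnorm H (b g) < e)"
    and proper: "\<And>g. tends_to_infinity g \<Longrightarrow> filterlim (\<lambda>n. hnorm H (b (g n))) at_top sequentially"
    and J: "inj_on J (hcarrier H)"
  shows "haagerup_property TYPE('g) TYPE('h)"
proof -
  interpret hilbert_space H by (rule hilb)
  note t = transport_carrier[OF hilb J] transport_add[OF hilb J] transport_scale[OF hilb J]
    transport_norm[OF hilb J] transport_diff[OF hilb J]
  note rf = isometric_representation_facts[OF rep]
  let ?K = "transport_structure J H"
  define \<rho> where "\<rho> g x = J (\<pi> g (inv_into (hcarrier H) J x))" for g x
  have \<rho>: "\<rho> g (J x) = J (\<pi> g x)" if "x \<in> hcarrier H" for g x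
    using that J by (simp add: \<rho>_def)
  show ?thesis
  proof (rule haagerup_propertyI[of ?K \<rho> "\<lambda>g. J (b g)"])
    show "hilbert_space ?K" by (rule transport_hilbert_space[OF hilb J])
    have "bij_betw (\<rho> g) (J ` hcarrier H) (J ` hcarrier H)" for g
    proof (rule bij_betw_byWitness[where f' = "\<rho> (- g)"])
      show "\<forall>x\<in>J ` hcarrier H. \<rho> (- g) (\<rho> g x) = x" "\<forall>x\<in>J ` hcarrier H. \<rho> g (\<rho> (- g) x) = x"
        using rf(6)[of _ "- g" g] rf(6)[of _ g "- g"] by (auto simp: \<rho> rf(1,5))
    qed (auto simp: \<rho> rf)
    then show "isometric_representation ?K \<rho>"
      by (auto simp: isometric_representation_def linear_isometric_bijection_def t \<rho> rf
          add_closed scale_closed)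
    show "J (b g) \<in> hcarrier ?K" for g by (simp add: t b)
    show "J (b (g + f)) = hadd ?K (\<rho> g (J (b f))) (J (b g))" for g f
      by (simp add: cocycle \<rho> b t rf)
    show "\<exists>U. open U \<and> 0 \<in> U \<and> (\<forall>g\<in>U. hnorm ?K (hdiff ?K (\<rho> g \<xi>) \<xi>) < e)"
      if \<xi>: "\<xi> \<in> hcarrier ?K" and e: "e > 0" for \<xi> e
    proof -
      obtain x where x: "\<xi> = J x" "x \<in> hcarrier H" using \<xi> by (auto simp: t)
      then have "hnorm ?K (hdiff ?K (\<rho> g \<xi>) \<xi>) = hnorm H (hdiff H (\<pi> g x) x)" for g
        by (simp add: \<rho> t rf hdiff_closed)
      then show ?thesis using rep_cont[OF x(2) e] by simp
    qed
    show "\<exists>U. open U \<and> 0 \<in> U \<and> (\<forall>g\<in>U. hnorm ?K (J (b g)) < e)" if "e > 0" for e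
      using b_cont[OF that] by (simp add: t b)
    show "filterlim (\<lambda>n. hnorm ?K (J (b (g n)))) at_top sequentially" if "tends_to_infinity g" for g
      using proper[OF that] by (simp add: t b)
  qed
qed


section \<open>Averaging a coarse embedding over the group\<close>

text \<open>Reals are in bijection with sets of naturals. A sequence of such sets is a set of pairs,
  which \<open>prod_encode\<close> turns back into one set of naturals.\<close>

lemma real_sequences_inject: "\<exists>f :: (nat \<Rightarrow> real) \<Rightarrow> real. inj f"
proof -
  obtain k :: "nat set \<Rightarrow> real" where k: "bij k"
    using nat_sets_eqpoll_reals by (auto simp: eqpoll_def)
  define A where "A x = {prod_encode (n, i) | n i. i \<in> inv k (x n)}" for x :: "nat \<Rightarrow> real"
  have mem: "prod_encode (n, i) \<in> A x \<longleftrightarrow> i \<in> inv k (x n)" for n i x by (auto simp: A_def)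
  have "inj (\<lambda>x. k (A x))"
  proof (rule injI)
    fix x y assume "k (A x) = k (A y)"
    then have e: "A x = A y" by (rule injD[OF bij_is_inj[OF k]])
    have "inv k (x n) = inv k (y n)" for n
    proof (rule set_eqI)
      show "i \<in> inv k (x n) \<longleftrightarrow> i \<in> inv k (y n)" for i unfolding mem[symmetric] e ..
    qed
    then have "k (inv k (x n)) = k (inv k (y n))" for n by simp
    then show "x = y" unfolding surj_f_inv_f[OF bij_is_surj[OF k]] by (rule ext)
  qed
  then show ?thesis by blast
qed

lemma coarse_embeddingD:
  assumes H: "inner_space H" and d: "mspace d = UNIV" and emb: "coarse_embedding d (hmetric H) \<eta>"
  shows "\<And>x. \<eta> x \<in> hcarrier H"
    and "\<And>t. \<exists>C. \<forall>x y. mdist d x y \<le> t \<longrightarrow> hnorm H (hdiff H (\<eta> x) (\<eta> y)) \<le> C"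
    and "\<And>C. \<exists>t. \<forall>x y. t \<le> mdist d x y \<longrightarrow> C \<le> hnorm H (hdiff H (\<eta> x) (\<eta> y))"
proof -
  interpret inner_space H by (rule H)
  show \<eta>: "\<eta> x \<in> hcarrier H" for x using emb d by (auto simp: coarse_embedding_def)
  have dist: "hdist H (\<eta> x) (\<eta> y) = hnorm H (hdiff H (\<eta> x) (\<eta> y))" for x y
    by (simp add: hdist_eq \<eta>)
  show "\<exists>C. \<forall>x y. mdist d x y \<le> t \<longrightarrow> hnorm H (hdiff H (\<eta> x) (\<eta> y)) \<le> C" for t
  proof -
    \<comment> \<open>\<open>coarse_embedding\<close> controls the expansion modulus at nonnegative
      arguments, hence the truncation.\<close>
    have "expansion_modulus d (hmetric H) \<eta> (max t 0) < \<infinity>"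
      using emb by (simp add: coarse_embedding_def)
    then obtain C where C: "expansion_modulus d (hmetric H) \<eta> (max t 0) < ereal C"
      using less_PInf_Ex_of_nat by auto
    have "hnorm H (hdiff H (\<eta> x) (\<eta> y)) \<le> C" if "mdist d x y \<le> t" for x y
    proof -
      have "ereal (hdist H (\<eta> x) (\<eta> y)) \<le> expansion_modulus d (hmetric H) \<eta> (max t 0)"
        unfolding expansion_modulus_def
      proof (rule Sup_upper, intro CollectI exI conjI)
        show "ereal (hdist H (\<eta> x) (\<eta> y)) = ereal (mdist (hmetric H) (\<eta> x) (\<eta> y))" by simp
      qed (use that d in auto)
      with C have "ereal (hdist H (\<eta> x) (\<eta> y)) \<le> ereal C" by (metis le_less_trans less_imp_le)
      then show ?thesis by (simp add: dist)
    qed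
    then show ?thesis by blast
  qed
  show "\<exists>t. \<forall>x y. t \<le> mdist d x y \<longrightarrow> C \<le> hnorm H (hdiff H (\<eta> x) (\<eta> y))" for C
  proof -
    have "(compression_modulus d (hmetric H) \<eta> \<longlongrightarrow> \<infinity>) at_top"
      using emb by (simp add: coarse_embedding_def)
    from order_tendstoD(1)[OF this, of "ereal C"]
    have "\<forall>\<^sub>F t in at_top. ereal C < compression_modulus d (hmetric H) \<eta> t" by simp
    then obtain t where t: "ereal C < compression_modulus d (hmetric H) \<eta> t"
      unfolding eventually_at_top_linorder by blast
    have "C \<le> hnorm H (hdiff H (\<eta> x) (\<eta> y))" if "t \<le> mdist d x y" for x y
    proof -
      have "compression_modulus d (hmetric H) \<eta> t \<le> ereal (hdist H (\<eta> x) (\<eta> y))"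
        unfolding compression_modulus_def
      proof (rule Inf_lower, intro CollectI exI conjI)
        show "ereal (hdist H (\<eta> x) (\<eta> y)) = ereal (mdist (hmetric H) (\<eta> x) (\<eta> y))" by simp
      qed (use that d in auto)
      with t have "ereal C \<le> ereal (hdist H (\<eta> x) (\<eta> y))" by (metis less_le_trans less_imp_le)
      then show ?thesis by (simp add: dist)
    qed
    then show ?thesis by blast
  qed
qed

section \<open>Means and averaged inner products\<close>

lemma LUC_const: "(\<lambda>_. c) \<in> LUC"
  by (auto simp: LUC_def intro: exI[of _ UNIV])

lemma LUC_modulus:
  "\<phi> \<in> LUC \<Longrightarrow> e > 0 \<Longrightarrow> \<exists>W. open W \<and> 0 \<in> W \<and> (\<forall>f. \<forall>w\<in>W. \<bar>\<phi> f - \<phi> (f + w)\<bar> < e)"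
  by (simp add: LUC_def)

lemma LUC_affine: assumes "\<phi> \<in> LUC" shows "(\<lambda>x. a * \<phi> x + c) \<in> LUC"
proof -
  obtain B where B: "\<And>x. \<bar>\<phi> x\<bar> \<le> B" using assms by (auto simp: LUC_def bounded_iff)
  have "\<bar>a * \<phi> x + c\<bar> \<le> \<bar>a\<bar> * B + \<bar>c\<bar>" for x
    using mult_left_mono[OF B, of "\<bar>a\<bar>" x] by (intro order_trans[OF abs_triangle_ineq]) (simp add: abs_mult)
  then have "bounded (range (\<lambda>x. a * \<phi> x + c))" by (auto simp: bounded_iff)
  moreover have "\<exists>W. open W \<and> 0 \<in> W \<and> (\<forall>f. \<forall>w\<in>W. \<bar>(a * \<phi> f + c) - (a * \<phi> (f + w) + c)\<bar> < e)"
    if e: "e > 0" for e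
  proof -
    have "e / (\<bar>a\<bar> + 1) > 0" using e by (simp add: add_nonneg_pos)
    from LUC_modulus[OF assms this]
    obtain W where W: "open W" "0 \<in> W" "\<And>f w. w \<in> W \<Longrightarrow> \<bar>\<phi> f - \<phi> (f + w)\<bar> < e / (\<bar>a\<bar> + 1)"
      by blast
    have "\<bar>(a * \<phi> f + c) - (a * \<phi> (f + w) + c)\<bar> < e" if "w \<in> W" for f w
    proof -
      have "\<bar>(a * \<phi> f + c) - (a * \<phi> (f + w) + c)\<bar> = \<bar>a\<bar> * \<bar>\<phi> f - \<phi> (f + w)\<bar>"
        by (simp add: abs_mult flip: right_diff_distrib)
      also have "\<dots> \<le> (\<bar>a\<bar> + 1) * \<bar>\<phi> f - \<phi> (f + w)\<bar>" by (intro mult_right_mono) auto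
      also have "\<dots> < e" using W(3)[OF that, of f] by (simp add: field_simps)
      finally show ?thesis .
    qed
    with W show ?thesis by blast
  qed
  ultimately show ?thesis by (simp add: LUC_def)
qed

text \<open>\<open>bornologous\<close> is finiteness of the expansion modulus. The lower bound from
  the compression modulus enters in \<open>haagerup_property_of_expanding\<close>, to give
  properness.\<close>

locale averaged_embedding = inner_space H for H :: "'h inner_structure" +
  fixes d :: "'g::topological_group_add metric" and \<eta> :: "'g \<Rightarrow> 'h"
    and m :: "('g \<Rightarrow> real) \<Rightarrow> real"
  assumes compatible: "compatible_left_invariant d"
    and \<eta>_closed: "\<eta> x \<in> hcarrier H"
    and unif_cont: "e > 0 \<Longrightarrow> \<exists>\<delta>>0. \<forall>x y. mdist d x y < \<delta> \<longrightarrow> hnorm H (hdiff H (\<eta> x) (\<eta> y)) < e"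
    and bornologous: "\<exists>C. \<forall>x y. mdist d x y \<le> t \<longrightarrow> hnorm H (hdiff H (\<eta> x) (\<eta> y)) \<le> C"
    and mean: "mean_on_LUC m"
    and mean_invariant: "\<phi> \<in> LUC \<Longrightarrow> m (\<lambda>x. \<phi> (x + g)) = m \<phi>"
begin

lemma mean_add: "\<phi> \<in> LUC \<Longrightarrow> \<psi> \<in> LUC \<Longrightarrow> m (\<lambda>x. \<phi> x + \<psi> x) = m \<phi> + m \<psi>"
  and mean_scale: "\<phi> \<in> LUC \<Longrightarrow> m (\<lambda>x. c * \<phi> x) = c * m \<phi>"
  and mean_nonneg: "\<phi> \<in> LUC \<Longrightarrow> (\<And>x. 0 \<le> \<phi> x) \<Longrightarrow> 0 \<le> m \<phi>"
  using mean by (simp_all add: mean_on_LUC_def)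

lemma mean_const: "m (\<lambda>_. c) = c"
  using mean_scale[OF LUC_const, of c 1] mean by (simp add: mean_on_LUC_def)

lemma mean_le: assumes "\<phi> \<in> LUC" "\<And>x. \<phi> x \<le> c" shows "m \<phi> \<le> c"
proof -
  have "0 \<le> m (\<lambda>x. -1 * \<phi> x + c)" using assms by (intro mean_nonneg LUC_affine) auto
  also have "\<dots> = - m \<phi> + c"
    using mean_add[OF LUC_affine[OF assms(1), of "-1" 0] LUC_const[of c]] mean_scale[OF assms(1), of "-1"]
    by (simp add: mean_const)
  finally show ?thesis by simp
qed

lemma mean_ge: assumes "\<phi> \<in> LUC" "\<And>x. c \<le> \<phi> x" shows "c \<le> m \<phi>"
proof -
  have "m (\<lambda>x. -1 * \<phi> x) \<le> - c"
    using LUC_affine[OF assms(1), of "-1" 0] assms(2) by (intro mean_le) auto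
  then show ?thesis using mean_scale[OF assms(1), of "-1"] by simp
qed

text \<open>Boundedness is kept separate so that \<open>\<eta>\<close> itself is a member.\<close>

definition luc_functions :: "('g \<Rightarrow> 'h) set" where
  "luc_functions = {\<xi>. (\<forall>x. \<xi> x \<in> hcarrier H) \<and>
     (\<forall>e>0. \<exists>U. open U \<and> 0 \<in> U \<and> (\<forall>x. \<forall>w\<in>U. hnorm H (hdiff H (\<xi> x) (\<xi> (x + w))) < e))}"

definition bounded_function :: "('g \<Rightarrow> 'h) \<Rightarrow> bool" where
  "bounded_function \<xi> \<longleftrightarrow> (\<exists>C. \<forall>x. hnorm H (\<xi> x) \<le> C)"

definition vadd :: "('g \<Rightarrow> 'h) \<Rightarrow> ('g \<Rightarrow> 'h) \<Rightarrow> 'g \<Rightarrow> 'h" where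
  "vadd \<xi> \<zeta> = (\<lambda>x. hadd H (\<xi> x) (\<zeta> x))"

definition vscale :: "real \<Rightarrow> ('g \<Rightarrow> 'h) \<Rightarrow> 'g \<Rightarrow> 'h" where
  "vscale c \<xi> = (\<lambda>x. hscale H c (\<xi> x))"

definition translate :: "'g \<Rightarrow> ('g \<Rightarrow> 'h) \<Rightarrow> 'g \<Rightarrow> 'h" where
  "translate g \<xi> = (\<lambda>x. \<xi> (x + g))"

definition displacement :: "'g \<Rightarrow> 'g \<Rightarrow> 'h" where
  "displacement g = (\<lambda>x. hdiff H (\<eta> (x + g)) (\<eta> x))"

definition mean_inner :: "('g \<Rightarrow> 'h) \<Rightarrow> ('g \<Rightarrow> 'h) \<Rightarrow> real" where
  "mean_inner \<xi> \<zeta> = m (\<lambda>x. hinner H (\<xi> x) (\<zeta> x))"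

text \<open>Displacements are bounded even when \<eta> is not, so the inner products of members lie
  in the domain \<open>LUC\<close> of the mean.\<close>

inductive_set displacement_span :: "('g \<Rightarrow> 'h) set" where
  span_base: "displacement g \<in> displacement_span"
| span_add: "\<xi> \<in> displacement_span \<Longrightarrow> \<zeta> \<in> displacement_span \<Longrightarrow> vadd \<xi> \<zeta> \<in> displacement_span"
| span_scale: "\<xi> \<in> displacement_span \<Longrightarrow> vscale c \<xi> \<in> displacement_span"

lemma luc_closed: "\<xi> \<in> luc_functions \<Longrightarrow> \<xi> x \<in> hcarrier H"
  by (simp add: luc_functions_def)

lemma luc_modulus:
  assumes "\<xi> \<in> luc_functions" "e > 0"
  obtains U where "open U" "0 \<in> U" "\<And>x w. w \<in> U \<Longrightarrow> hnorm H (hdiff H (\<xi> x) (\<xi> (x + w))) < e"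
proof -
  have "\<exists>U. open U \<and> 0 \<in> U \<and> (\<forall>x. \<forall>w\<in>U. hnorm H (hdiff H (\<xi> x) (\<xi> (x + w))) < e)"
    using assms by (simp add: luc_functions_def)
  then show thesis using that by blast
qed

lemma luc_vadd: assumes \<xi>: "\<xi> \<in> luc_functions" and \<zeta>: "\<zeta> \<in> luc_functions"
  shows "vadd \<xi> \<zeta> \<in> luc_functions"
  unfolding luc_functions_def
proof (intro CollectI conjI allI impI)
  show "vadd \<xi> \<zeta> x \<in> hcarrier H" for x using \<xi> \<zeta> by (simp add: vadd_def add_closed luc_closed)
  fix e :: real assume e: "e > 0"
  then have e2: "e / 2 > 0" by simp
  obtain U where U: "open U" "0 \<in> U" "\<And>x w. w \<in> U \<Longrightarrow> hnorm H (hdiff H (\<xi> x) (\<xi> (x + w))) < e / 2"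
    using luc_modulus[OF \<xi> e2] by metis
  obtain V where V: "open V" "0 \<in> V" "\<And>x w. w \<in> V \<Longrightarrow> hnorm H (hdiff H (\<zeta> x) (\<zeta> (x + w))) < e / 2"
    using luc_modulus[OF \<zeta> e2] by metis
  have "hnorm H (hdiff H (vadd \<xi> \<zeta> x) (vadd \<xi> \<zeta> (x + w))) < e" if "w \<in> U \<inter> V" for x w
  proof -
    have "hnorm H (hdiff H (vadd \<xi> \<zeta> x) (vadd \<xi> \<zeta> (x + w))) \<le>
        hnorm H (hdiff H (\<xi> x) (\<xi> (x + w))) + hnorm H (hdiff H (\<zeta> x) (\<zeta> (x + w)))"
      using \<xi> \<zeta> by (simp add: vadd_def hdiff_hadd luc_closed hnorm_triangle hdiff_closed)
    then show ?thesis using U(3)[of w x] V(3)[of w x] that by simp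
  qed
  then show "\<exists>U. open U \<and> 0 \<in> U \<and> (\<forall>x. \<forall>w\<in>U. hnorm H (hdiff H (vadd \<xi> \<zeta> x) (vadd \<xi> \<zeta> (x + w))) < e)"
    using open_Int[OF U(1) V(1)] U(2) V(2) by blast
qed

lemma luc_vscale: assumes \<xi>: "\<xi> \<in> luc_functions" shows "vscale c \<xi> \<in> luc_functions"
  unfolding luc_functions_def
proof (intro CollectI conjI allI impI)
  show "vscale c \<xi> x \<in> hcarrier H" for x using \<xi> by (simp add: vscale_def scale_closed luc_closed)
  fix e :: real assume e: "e > 0"
  have p: "\<bar>c\<bar> + 1 > 0" by simp
  then have e2: "e / (\<bar>c\<bar> + 1) > 0" using e by simp
  obtain U where U: "open U" "0 \<in> U" "\<And>x w. w \<in> U \<Longrightarrow> hnorm H (hdiff H (\<xi> x) (\<xi> (x + w))) < e / (\<bar>c\<bar> + 1)"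
    using luc_modulus[OF \<xi> e2] by metis
  have "hnorm H (hdiff H (vscale c \<xi> x) (vscale c \<xi> (x + w))) < e" if "w \<in> U" for x w
  proof -
    have "hnorm H (hdiff H (vscale c \<xi> x) (vscale c \<xi> (x + w))) =
        \<bar>c\<bar> * hnorm H (hdiff H (\<xi> x) (\<xi> (x + w)))"
      using \<xi> by (simp add: vscale_def hdiff_scale luc_closed hnorm_scale hdiff_closed)
    also have "\<dots> \<le> (\<bar>c\<bar> + 1) * hnorm H (hdiff H (\<xi> x) (\<xi> (x + w)))"
      using \<xi> by (intro mult_right_mono hnorm_nonneg hdiff_closed luc_closed) auto
    also have "\<dots> < e" using U(3)[OF that, of x] p by (simp add: pos_less_divide_eq mult.commute)
    finally show ?thesis .
  qed
  then show "\<exists>U. open U \<and> 0 \<in> U \<and> (\<forall>x. \<forall>w\<in>U. hnorm H (hdiff H (vscale c \<xi> x) (vscale c \<xi> (x + w))) < e)"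
    using U(1,2) by blast
qed

text \<open>Right translation conjugates the modulus: \<open>x + w + g\<close> equals
  \<open>(x + g) + (- g + w + g)\<close>.\<close>

lemma luc_translate: assumes \<xi>: "\<xi> \<in> luc_functions" shows "translate g \<xi> \<in> luc_functions"
  unfolding luc_functions_def
proof (intro CollectI conjI allI impI)
  show "translate g \<xi> x \<in> hcarrier H" for x using \<xi> by (simp add: translate_def luc_closed)
  fix e :: real assume e: "e > 0"
  obtain U where U: "open U" "0 \<in> U" "\<And>x w. w \<in> U \<Longrightarrow> hnorm H (hdiff H (\<xi> x) (\<xi> (x + w))) < e"
    using luc_modulus[OF \<xi> e] by metis
  let ?V = "{w. w + g \<in> {v. - g + v \<in> U}}"
  have "hnorm H (hdiff H (translate g \<xi> x) (translate g \<xi> (x + w))) < e" if "w \<in> ?V" for x w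
  proof -
    have "x + g + (- g + (w + g)) = x + w + g" by (simp only: add.assoc add_minus_cancel)
    then show ?thesis using U(3)[of "- g + (w + g)" "x + g"] that by (simp add: translate_def)
  qed
  moreover have "open ?V" by (intro open_right_translate open_left_translate U(1))
  ultimately show "\<exists>U. open U \<and> 0 \<in> U \<and>
      (\<forall>x. \<forall>w\<in>U. hnorm H (hdiff H (translate g \<xi> x) (translate g \<xi> (x + w))) < e)"
    using U(2) by (intro exI[of _ ?V]) simp
qed

text \<open>By left invariance \<open>x\<close> and \<open>x + w\<close> are as far apart as
  \<open>0\<close> and \<open>w\<close>, so a metric modulus becomes a neighbourhood of
  \<open>0\<close> independent of \<open>x\<close>.\<close>

lemma luc_\<eta>: "\<eta> \<in> luc_functions"
  unfolding luc_functions_def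
proof (intro CollectI conjI allI impI \<eta>_closed)
  fix e :: real assume "e > 0"
  then obtain \<delta> where \<delta>: "\<delta> > 0" "\<And>x y. mdist d x y < \<delta> \<Longrightarrow> hnorm H (hdiff H (\<eta> x) (\<eta> y)) < e"
    using unif_cont by blast
  have "mdist d x (x + w) = mdist d 0 w" for x w
    using compatible_invariant[OF compatible, of x 0 w] by simp
  then have "\<forall>x. \<forall>w\<in>{w. mdist d 0 w < \<delta>}. hnorm H (hdiff H (\<eta> x) (\<eta> (x + w))) < e"
    using \<delta>(2) by simp
  moreover have "mdist d 0 0 = 0" by (simp add: compatible_mspace[OF compatible])
  then have "0 \<in> {w. mdist d 0 w < \<delta>}" using \<delta>(1) by simp
  ultimately show "\<exists>U. open U \<and> 0 \<in> U \<and> (\<forall>x. \<forall>w\<in>U. hnorm H (hdiff H (\<eta> x) (\<eta> (x + w))) < e)"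
    using compatible_open_ball[OF compatible, of 0 \<delta>] by blast
qed

lemma displacement_eq: "displacement g = vadd (translate g \<eta>) (vscale (-1) \<eta>)"
  by (simp add: displacement_def vadd_def translate_def vscale_def hdiff_def)

lemma span_luc: "\<xi> \<in> displacement_span \<Longrightarrow> \<xi> \<in> luc_functions"
  by (induction rule: displacement_span.induct)
    (auto simp: displacement_eq intro: luc_vadd luc_vscale luc_translate luc_\<eta>)

lemma span_closed: "\<xi> \<in> displacement_span \<Longrightarrow> \<xi> x \<in> hcarrier H"
  using span_luc luc_closed by blast

lemma span_bounded: "\<xi> \<in> displacement_span \<Longrightarrow> bounded_function \<xi>"
proof (induction rule: displacement_span.induct)
  case (span_base g)
  obtain C where C: "\<And>x y. mdist d x y \<le> mdist d 0 g \<Longrightarrow> hnorm H (hdiff H (\<eta> x) (\<eta> y)) \<le> C"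
    using bornologous by blast
  have "mdist d (x + g) x = mdist d 0 g" for x
    using compatible_invariant[OF compatible, of x g 0] by (simp add: mdist_commute)
  then show ?case unfolding bounded_function_def displacement_def using C by (intro exI[of _ C]) simp
next
  case (span_add \<xi> \<zeta>)
  then obtain C D where "\<And>x. hnorm H (\<xi> x) \<le> C" "\<And>x. hnorm H (\<zeta> x) \<le> D"
    by (auto simp: bounded_function_def)
  then have "hnorm H (vadd \<xi> \<zeta> x) \<le> C + D" for x
    unfolding vadd_def using span_add.hyps
    by (intro order_trans[OF hnorm_triangle] add_mono) (auto simp: span_closed)
  then show ?case unfolding bounded_function_def by blast
next
  case (span_scale \<xi> c)
  then obtain C where "\<And>x. hnorm H (\<xi> x) \<le> C" by (auto simp: bounded_function_def)
  then have "hnorm H (vscale c \<xi> x) \<le> \<bar>c\<bar> * C" for x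
    unfolding vscale_def using span_scale.hyps by (simp add: hnorm_scale span_closed mult_left_mono)
  then show ?case unfolding bounded_function_def by blast
qed

lemma inner_LUC:
  assumes \<xi>: "\<xi> \<in> displacement_span" and \<zeta>: "\<zeta> \<in> displacement_span"
  shows "(\<lambda>x. hinner H (\<xi> x) (\<zeta> x)) \<in> LUC"
proof -
  obtain C0 D0 where C0: "\<And>x. hnorm H (\<xi> x) \<le> C0" and D0: "\<And>x. hnorm H (\<zeta> x) \<le> D0"
    using span_bounded[OF \<xi>] span_bounded[OF \<zeta>] by (auto simp: bounded_function_def)
  \<comment> \<open>The summand 1 makes the common bound positive, so that
    \<open>e / (2 * C)\<close> is a legitimate tolerance.\<close>
  define C where "C = max C0 D0 + 1"
  have C: "hnorm H (\<xi> x) \<le> C" "hnorm H (\<zeta> x) \<le> C" for x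
    using C0[of x] D0[of x] by (auto simp: C_def)
  have "0 \<le> hnorm H (\<xi> 0)" using \<xi> by (simp add: hnorm_nonneg span_closed)
  then have C_pos: "C > 0" using C0[of 0] by (simp add: C_def)
  have "\<bar>hinner H (\<xi> x) (\<zeta> x)\<bar> \<le> C * C" for x
    using Cauchy_Schwarz[of "\<xi> x" "\<zeta> x"] mult_mono[OF C(1)[of x] C(2)[of x]] C_pos \<xi> \<zeta>
    by (simp add: span_closed hnorm_nonneg)
  then have "bounded (range (\<lambda>x. hinner H (\<xi> x) (\<zeta> x)))" by (auto simp: bounded_iff)
  moreover have "\<exists>W. open W \<and> 0 \<in> W \<and>
      (\<forall>x. \<forall>w\<in>W. \<bar>hinner H (\<xi> x) (\<zeta> x) - hinner H (\<xi> (x + w)) (\<zeta> (x + w))\<bar> < e)" if e: "e > 0" for e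
  proof -
    have e2: "e / (2 * C) > 0" using e C_pos by simp
    obtain U where U: "open U" "0 \<in> U" "\<And>x w. w \<in> U \<Longrightarrow> hnorm H (hdiff H (\<xi> x) (\<xi> (x + w))) < e / (2 * C)"
      using luc_modulus[OF span_luc[OF \<xi>] e2] by metis
    obtain V where V: "open V" "0 \<in> V" "\<And>x w. w \<in> V \<Longrightarrow> hnorm H (hdiff H (\<zeta> x) (\<zeta> (x + w))) < e / (2 * C)"
      using luc_modulus[OF span_luc[OF \<zeta>] e2] by metis
    have "\<bar>hinner H (\<xi> x) (\<zeta> x) - hinner H (\<xi> (x + w)) (\<zeta> (x + w))\<bar> < e" if w: "w \<in> U" "w \<in> V" for x w
    proof -
      have "\<bar>hinner H (\<xi> x) (\<zeta> x) - hinner H (\<xi> (x + w)) (\<zeta> (x + w))\<bar> \<le>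
          hnorm H (hdiff H (\<xi> x) (\<xi> (x + w))) * hnorm H (\<zeta> x) +
          hnorm H (\<xi> (x + w)) * hnorm H (hdiff H (\<zeta> x) (\<zeta> (x + w)))"
        using \<xi> \<zeta> by (intro inner_perturb span_closed)
      also have "\<dots> \<le> hnorm H (hdiff H (\<xi> x) (\<xi> (x + w))) * C + C * hnorm H (hdiff H (\<zeta> x) (\<zeta> (x + w)))"
        using \<xi> \<zeta> by (intro add_mono mult_left_mono mult_right_mono C hnorm_nonneg hdiff_closed span_closed)
      also have "\<dots> < e / (2 * C) * C + C * (e / (2 * C))"
        using U(3)[OF w(1), of x] V(3)[OF w(2), of x] C_pos
        by (intro add_strict_mono mult_strict_left_mono mult_strict_right_mono)
      also have "\<dots> = e" using C_pos by simp
      finally show ?thesis .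
    qed
    then show ?thesis using open_Int[OF U(1) V(1)] U(2) V(2) by blast
  qed
  ultimately show ?thesis by (simp add: LUC_def)
qed

sublocale semi_inner_product displacement_span vadd vscale mean_inner
proof
  show "displacement_span \<noteq> {}" using span_base by blast
  fix \<xi> \<zeta> \<theta> :: "'g \<Rightarrow> 'h" and c
  assume \<xi>: "\<xi> \<in> displacement_span"
  show "vscale c \<xi> \<in> displacement_span" by (rule span_scale[OF \<xi>])
  show "0 \<le> mean_inner \<xi> \<xi>"
    unfolding mean_inner_def using \<xi> by (intro mean_nonneg inner_LUC inner_nonneg span_closed)
  assume \<zeta>: "\<zeta> \<in> displacement_span"
  show "vadd \<xi> \<zeta> \<in> displacement_span" by (rule span_add[OF \<xi> \<zeta>])
  show "mean_inner \<xi> \<zeta> = mean_inner \<zeta> \<xi>"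
    unfolding mean_inner_def using \<xi> \<zeta> by (intro arg_cong[of _ _ m] ext inner_commute span_closed)
  show "mean_inner (vscale c \<xi>) \<zeta> = c * mean_inner \<xi> \<zeta>"
    unfolding mean_inner_def vscale_def using \<xi> \<zeta>
    by (simp add: inner_scale_left span_closed mean_scale inner_LUC)
  assume \<theta>: "\<theta> \<in> displacement_span"
  show "mean_inner (vadd \<xi> \<zeta>) \<theta> = mean_inner \<xi> \<theta> + mean_inner \<zeta> \<theta>"
    unfolding mean_inner_def vadd_def using \<xi> \<zeta> \<theta>
    by (simp add: inner_add_left span_closed mean_add inner_LUC)
qed

text \<open>Telescoping through \<open>\<eta> x\<close> gives the cocycle identity. It makes the
  span translation invariant and later becomes the cocycle of the affine action.\<close>

lemma translate_displacement:
  "translate g (displacement f) = vadd (displacement (g + f)) (vscale (-1) (displacement g))"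
proof
  fix x
  have "hdiff H (\<eta> (x + g + f)) (\<eta> (x + g)) =
      hadd H (hdiff H (\<eta> (x + g + f)) (\<eta> x)) (hdiff H (\<eta> x) (\<eta> (x + g)))"
    by (simp add: hdiff_telescope \<eta>_closed)
  also have "hdiff H (\<eta> x) (\<eta> (x + g)) = hscale H (-1) (hdiff H (\<eta> (x + g)) (\<eta> x))"
    by (simp add: hdiff_def scale_add_right scale_scale scale_one scale_closed \<eta>_closed
        add_commute[of "\<eta> x"])
  finally show "translate g (displacement f) x =
      vadd (displacement (g + f)) (vscale (-1) (displacement g)) x"
    by (simp add: translate_def displacement_def vadd_def vscale_def add.assoc)
qed

lemma translate_vadd: "translate g (vadd \<xi> \<zeta>) = vadd (translate g \<xi>) (translate g \<zeta>)"
  and translate_vscale: "translate g (vscale c \<xi>) = vscale c (translate g \<xi>)"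
  and translate_translate: "translate g (translate f \<xi>) = translate (g + f) \<xi>"
  and translate_zero: "translate 0 \<xi> = \<xi>"
  by (simp_all add: translate_def vadd_def vscale_def add.assoc)

lemma span_translate: "\<xi> \<in> displacement_span \<Longrightarrow> translate g \<xi> \<in> displacement_span"
  by (induction rule: displacement_span.induct)
    (simp_all add: translate_displacement translate_vadd translate_vscale displacement_span.intros)

lemma mean_inner_translate:
  "\<xi> \<in> displacement_span \<Longrightarrow> \<zeta> \<in> displacement_span \<Longrightarrow>
    mean_inner (translate g \<xi>) (translate g \<zeta>) = mean_inner \<xi> \<zeta>"
  unfolding mean_inner_def translate_def using mean_invariant[OF inner_LUC] by blast

lemma mean_inner_le:
  assumes \<xi>: "\<xi> \<in> displacement_span" and C: "\<And>x. hnorm H (\<xi> x) \<le> C"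
  shows "mean_inner \<xi> \<xi> \<le> C\<^sup>2"
  unfolding mean_inner_def
proof (rule mean_le[OF inner_LUC[OF \<xi> \<xi>]])
  fix x
  have "(hnorm H (\<xi> x))\<^sup>2 \<le> C\<^sup>2" using \<xi> by (intro power_mono C hnorm_nonneg span_closed)
  then show "hinner H (\<xi> x) (\<xi> x) \<le> C\<^sup>2" using \<xi> by (simp add: hnorm_sq span_closed)
qed

lemma mean_inner_ge:
  assumes \<xi>: "\<xi> \<in> displacement_span" and C: "0 \<le> C" "\<And>x. C \<le> hnorm H (\<xi> x)"
  shows "C\<^sup>2 \<le> mean_inner \<xi> \<xi>"
  unfolding mean_inner_def
proof (rule mean_ge[OF inner_LUC[OF \<xi> \<xi>]])
  fix x
  have "C\<^sup>2 \<le> (hnorm H (\<xi> x))\<^sup>2" by (intro power_mono C)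
  then show "C\<^sup>2 \<le> hinner H (\<xi> x) (\<xi> x)" using \<xi> by (simp add: hnorm_sq span_closed)
qed

text \<open>The contragredient of translation: the inverse keeps the order of products, and on Riesz
  functionals it becomes \<open>translate g\<close> by invariance of the mean.\<close>

definition regular_rep :: "'g \<Rightarrow> (('g \<Rightarrow> 'h) \<Rightarrow> real) \<Rightarrow> ('g \<Rightarrow> 'h) \<Rightarrow> real" where
  "regular_rep g F = (\<lambda>\<xi>. if \<xi> \<in> displacement_span then F (translate (- g) \<xi>) else 0)"

lemma regular_rep_dual:
  assumes F: "F \<in> dual"
  shows "regular_rep g F \<in> dual" and "sqnorm (regular_rep g F) \<le> sqnorm F"
proof -
  have "bounded_by (sqnorm F) (regular_rep g F)"
    unfolding bounded_by_def
  proof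
    fix \<xi> assume \<xi>: "\<xi> \<in> displacement_span"
    have "(F (translate (- g) \<xi>))\<^sup>2 \<le> sqnorm F * mean_inner (translate (- g) \<xi>) (translate (- g) \<xi>)"
      using sqnorm_bound[OF F] span_translate[OF \<xi>] unfolding bounded_by_def by blast
    then show "(regular_rep g F \<xi>)\<^sup>2 \<le> sqnorm F * mean_inner \<xi> \<xi>"
      using \<xi> by (simp add: regular_rep_def mean_inner_translate)
  qed
  moreover have "linear_on_W (regular_rep g F)"
    using F unfolding linear_on_W_def regular_rep_def
    by (auto simp: span_translate span_add span_scale translate_vadd translate_vscale dual_add dual_scale)
  ultimately show "regular_rep g F \<in> dual" "sqnorm (regular_rep g F) \<le> sqnorm F"
    using sqnorm_nonneg[OF F] by (auto simp: dual_def intro: sqnorm_le)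
qed

lemma regular_rep_mult: "regular_rep (g + f) F = regular_rep g (regular_rep f F)"
  by (auto simp: regular_rep_def span_translate translate_translate minus_add)

lemma regular_rep_zero: "F \<in> dual \<Longrightarrow> regular_rep 0 F = F"
  by (auto simp: regular_rep_def translate_zero dual_outside)

text \<open>Both \<open>g\<close> and \<open>- g\<close> act as contractions and undo each
  other.\<close>

lemma regular_rep_sqnorm:
  assumes F: "F \<in> dual" shows "sqnorm (regular_rep g F) = sqnorm F"
proof (rule antisym[OF regular_rep_dual(2)[OF F]])
  have "sqnorm (regular_rep (- g) (regular_rep g F)) \<le> sqnorm (regular_rep g F)"
    by (intro regular_rep_dual F)
  then show "sqnorm F \<le> sqnorm (regular_rep g F)"
    using regular_rep_mult[of "- g" g F] regular_rep_zero[OF F] by simp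
qed

lemma regular_rep_isometric: "isometric_representation dual_structure regular_rep"
proof -
  have "bij_betw (regular_rep g) dual dual" for g
  proof (rule bij_betw_byWitness[where f' = "regular_rep (- g)"])
    show "\<forall>F\<in>dual. regular_rep (- g) (regular_rep g F) = F"
      using regular_rep_mult[of "- g" g] regular_rep_zero by simp
    show "\<forall>F\<in>dual. regular_rep g (regular_rep (- g) F) = F"
      using regular_rep_mult[of g "- g"] regular_rep_zero by simp
  qed (auto intro: regular_rep_dual)
  moreover have "regular_rep g (\<lambda>\<xi>. F \<xi> + G \<xi>) = (\<lambda>\<xi>. regular_rep g F \<xi> + regular_rep g G \<xi>)"
    "regular_rep g (\<lambda>\<xi>. c * F \<xi>) = (\<lambda>\<xi>. c * regular_rep g F \<xi>)" for g F G c
    by (auto simp: regular_rep_def)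
  ultimately show ?thesis
    by (simp add: isometric_representation_def linear_isometric_bijection_def regular_rep_zero
        regular_rep_mult hnorm_dual regular_rep_dual regular_rep_sqnorm)
qed

lemma regular_rep_riesz:
  assumes \<xi>: "\<xi> \<in> displacement_span"
  shows "regular_rep g (riesz \<xi>) = riesz (translate g \<xi>)"
proof
  fix \<zeta>
  show "regular_rep g (riesz \<xi>) \<zeta> = riesz (translate g \<xi>) \<zeta>"
    using mean_inner_translate[OF \<xi> span_translate[of \<zeta> "- g"], of g]
    by (simp add: regular_rep_def riesz_def span_translate translate_translate translate_zero)
qed

lemma riesz_vadd: "\<xi> \<in> displacement_span \<Longrightarrow> \<zeta> \<in> displacement_span \<Longrightarrow>
    riesz (vadd \<xi> \<zeta>) = (\<lambda>\<theta>. riesz \<xi> \<theta> + riesz \<zeta> \<theta>)"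
  and riesz_vscale: "\<xi> \<in> displacement_span \<Longrightarrow> riesz (vscale c \<xi>) = (\<lambda>\<theta>. c * riesz \<xi> \<theta>)"
  by (auto simp: riesz_def q_add_left q_scale_left)

lemma displacement_cocycle:
  "riesz (displacement (g + f)) =
    hadd dual_structure (regular_rep g (riesz (displacement f))) (riesz (displacement g))"
  by (simp add: regular_rep_riesz span_base translate_displacement riesz_vadd riesz_vscale span_scale)

lemma displacement_small:
  assumes e: "e > 0"
  shows "\<exists>U. open U \<and> 0 \<in> U \<and> (\<forall>g\<in>U. hnorm dual_structure (riesz (displacement g)) < e)"
proof -
  \<comment> \<open>A mean preserves only weak inequalities, so half of \<open>e\<close> is kept in
    reserve.\<close>
  have e2: "e / 2 > 0" using e by simp
  obtain U where U: "open U" "0 \<in> U" "\<And>x w. w \<in> U \<Longrightarrow> hnorm H (hdiff H (\<eta> x) (\<eta> (x + w))) < e / 2"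
    using luc_modulus[OF luc_\<eta> e2] by metis
  have "hnorm dual_structure (riesz (displacement g)) < e" if "g \<in> U" for g
  proof -
    have "hnorm H (displacement g x) \<le> e / 2" for x
      using U(3)[OF that, of x] hnorm_hdiff_commute[of "\<eta> x" "\<eta> (x + g)"]
      by (simp add: displacement_def \<eta>_closed)
    then have "mean_inner (displacement g) (displacement g) \<le> (e / 2)\<^sup>2"
      by (intro mean_inner_le span_base)
    then have "sqrt (mean_inner (displacement g) (displacement g)) \<le> e / 2"
      using e by (intro real_le_lsqrt) (auto intro: q_nonneg span_base)
    then show ?thesis using e by (simp add: hnorm_dual riesz_dual span_base sqnorm_riesz)
  qed
  with U show ?thesis by blast
qed

lemma regular_rep_small_riesz:
  assumes \<xi>: "\<xi> \<in> displacement_span" and e: "e > 0"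
  shows "\<exists>U. open U \<and> 0 \<in> U \<and>
    (\<forall>g\<in>U. hnorm dual_structure (hdiff dual_structure (regular_rep g (riesz \<xi>)) (riesz \<xi>)) < e)"
proof -
  have e2: "e / 2 > 0" using e by simp
  obtain U where U: "open U" "0 \<in> U" "\<And>x w. w \<in> U \<Longrightarrow> hnorm H (hdiff H (\<xi> x) (\<xi> (x + w))) < e / 2"
    using luc_modulus[OF span_luc[OF \<xi>] e2] by metis
  have "hnorm dual_structure (hdiff dual_structure (regular_rep g (riesz \<xi>)) (riesz \<xi>)) < e"
    if "g \<in> U" for g
  proof -
    let ?\<theta> = "vadd (translate g \<xi>) (vscale (-1) \<xi>)"
    have \<theta>: "?\<theta> \<in> displacement_span" by (intro span_add span_scale span_translate \<xi>)
    have "hdiff dual_structure (regular_rep g (riesz \<xi>)) (riesz \<xi>) = riesz ?\<theta>"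
      using \<xi> by (simp add: hdiff_dual regular_rep_riesz riesz_vadd riesz_vscale span_scale span_translate)
    moreover have "hnorm H (?\<theta> x) \<le> e / 2" for x
      using U(3)[OF that, of x] hnorm_hdiff_commute[of "\<xi> x" "\<xi> (x + g)"] \<xi>
      by (simp add: vadd_def vscale_def translate_def span_closed flip: hdiff_def)
    then have "mean_inner ?\<theta> ?\<theta> \<le> (e / 2)\<^sup>2" by (intro mean_inner_le \<theta>)
    then have "sqrt (mean_inner ?\<theta> ?\<theta>) \<le> e / 2"
      using e by (intro real_le_lsqrt) (auto intro: q_nonneg \<theta>)
    ultimately show ?thesis using e by (simp add: hnorm_dual riesz_dual \<theta> sqnorm_riesz)
  qed
  with U show ?thesis by blast
qed

text \<open>Continuity on Riesz functionals comes from the modulus of their vectors. Density and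
  isometry extend it to the whole dual by an estimate in thirds.\<close>

lemma regular_rep_continuous:
  assumes F: "F \<in> dual" and e: "e > 0"
  shows "\<exists>U. open U \<and> 0 \<in> U \<and>
    (\<forall>g\<in>U. hnorm dual_structure (hdiff dual_structure (regular_rep g F) F) < e)"
proof -
  interpret D: inner_space dual_structure by (rule inner_space_dual)
  note rf = D.isometric_representation_facts[OF regular_rep_isometric]
  have e3: "e / 3 > 0" using e by simp
  obtain \<xi> where \<xi>: "\<xi> \<in> displacement_span" and s: "sqnorm (\<lambda>\<zeta>. F \<zeta> - riesz \<xi> \<zeta>) < (e / 3)\<^sup>2"
    by (rule riesz_dense[OF F zero_less_power[OF e3, of 2]])
  have R: "riesz \<xi> \<in> dual" by (rule riesz_dual[OF \<xi>])
  have "sqrt (sqnorm (\<lambda>\<zeta>. F \<zeta> - riesz \<xi> \<zeta>)) < e / 3"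
    using s e by (intro real_less_lsqrt) auto
  then have n: "hnorm dual_structure (hdiff dual_structure F (riesz \<xi>)) < e / 3"
    by (simp add: hdiff_dual hnorm_dual dual_diff F R)
  obtain U where U: "open U" "0 \<in> U" "\<And>g. g \<in> U \<Longrightarrow>
      hnorm dual_structure (hdiff dual_structure (regular_rep g (riesz \<xi>)) (riesz \<xi>)) < e / 3"
    using regular_rep_small_riesz[OF \<xi> e3] by blast
  have "hnorm dual_structure (hdiff dual_structure (regular_rep g F) F) < e" if "g \<in> U" for g
  proof -
    let ?n = "\<lambda>A B. hnorm dual_structure (hdiff dual_structure A B)"
    have c: "F \<in> hcarrier dual_structure" "riesz \<xi> \<in> hcarrier dual_structure"
      "regular_rep g F \<in> hcarrier dual_structure" "regular_rep g (riesz \<xi>) \<in> hcarrier dual_structure"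
      using F R regular_rep_dual by simp_all
    have "?n (regular_rep g F) F \<le> ?n (regular_rep g F) (regular_rep g (riesz \<xi>)) + ?n (regular_rep g (riesz \<xi>)) F"
      by (intro D.hnorm_hdiff_triangle c)
    moreover have "?n (regular_rep g (riesz \<xi>)) F \<le> ?n (regular_rep g (riesz \<xi>)) (riesz \<xi>) + ?n (riesz \<xi>) F"
      by (intro D.hnorm_hdiff_triangle c)
    moreover have "?n (regular_rep g F) (regular_rep g (riesz \<xi>)) = ?n F (riesz \<xi>)"
      using rf(2)[OF D.hdiff_closed[OF c(1,2)], of g] rf(7)[OF c(1,2), of g] by simp
    moreover have "?n (riesz \<xi>) F = ?n F (riesz \<xi>)" by (intro D.hnorm_hdiff_commute c)
    ultimately show ?thesis using n U(3)[OF that] by linarith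
  qed
  with U show ?thesis by blast
qed

text \<open>The terms \<open>\<eta> x\<close> cancel and \<open>\<eta> (x + g)\<close> is compared
  with \<open>\<eta> (x + f)\<close>, whose arguments are as close as \<open>g\<close> and
  \<open>f\<close>.\<close>

lemma displacement_diff_small:
  assumes "\<And>x y. mdist d x y < \<delta> \<Longrightarrow> hnorm H (hdiff H (\<eta> x) (\<eta> y)) < e" and "mdist d g f < \<delta>"
  shows "hnorm H (vadd (displacement g) (vscale (-1) (displacement f)) x) < e"
proof -
  have "vadd (displacement g) (vscale (-1) (displacement f)) x =
      hdiff H (hadd H (\<eta> (x + g)) (hscale H (-1) (\<eta> x))) (hadd H (\<eta> (x + f)) (hscale H (-1) (\<eta> x)))"
    by (simp add: vadd_def vscale_def displacement_def hdiff_def)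
  also have "\<dots> = hdiff H (\<eta> (x + g)) (\<eta> (x + f))"
    by (simp add: hdiff_hadd_right \<eta>_closed scale_closed)
  finally show ?thesis
    using assms(1)[of "x + g" "x + f"] assms(2) compatible_invariant[OF compatible, of x g f] by simp
qed

text \<open>The map sending \<open>g\<close> to \<open>F (displacement g)\<close> is continuous, so
  zeros on a dense sequence spread to all displacements and then to their span.\<close>

lemma dual_zero_on_dense:
  assumes F: "F \<in> dual" and dense: "\<And>N x. open N \<Longrightarrow> x \<in> N \<Longrightarrow> \<exists>n. s n \<in> N"
    and z: "\<And>n::nat. F (displacement (s n)) = 0"
  shows "F = (\<lambda>\<xi>. 0)"
proof -
  have "F (displacement g) = 0" for g
  proof -
    have "\<bar>F (displacement g)\<bar> \<le> sqrt (sqnorm F) * e" if e: "e > 0" for e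
    proof -
      obtain \<delta> where \<delta>: "\<delta> > 0" "\<And>x y. mdist d x y < \<delta> \<Longrightarrow> hnorm H (hdiff H (\<eta> x) (\<eta> y)) < e"
        using unif_cont[OF e] by blast
      have "mdist d g g = 0" by (simp add: compatible_mspace[OF compatible])
      then obtain n where n: "mdist d g (s n) < \<delta>"
        using dense[OF compatible_open_ball[OF compatible], of g g \<delta>] \<delta>(1) by auto
      let ?\<theta> = "vadd (displacement g) (vscale (-1) (displacement (s n)))"
      have \<theta>: "?\<theta> \<in> displacement_span" by (intro displacement_span.intros)
      have "mean_inner ?\<theta> ?\<theta> \<le> e\<^sup>2"
        using displacement_diff_small[OF \<delta>(2) n] by (intro mean_inner_le \<theta>) (simp add: less_imp_le)
      then have "sqrt (mean_inner ?\<theta> ?\<theta>) \<le> e"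
        using e by (intro real_le_lsqrt) (auto intro: q_nonneg \<theta>)
      then have "sqrt (sqnorm F) * sqrt (mean_inner ?\<theta> ?\<theta>) \<le> sqrt (sqnorm F) * e"
        by (intro mult_left_mono) (simp_all add: sqnorm_nonneg F)
      then have "\<bar>F ?\<theta>\<bar> \<le> sqrt (sqnorm F) * e" using dual_sqrt_bound[OF F \<theta>] by linarith
      moreover have "F ?\<theta> = F (displacement g)"
        using z[of n] F by (simp add: dual_add dual_scale displacement_span.intros)
      ultimately show ?thesis by simp
    qed
    note bound = this
    have "\<bar>F (displacement g)\<bar> \<le> 0 + e" if e: "e > 0" for e
    proof -
      have p: "sqrt (sqnorm F) + 1 > 0" using sqnorm_nonneg[OF F] by (simp add: add_nonneg_pos)
      then have "e / (sqrt (sqnorm F) + 1) > 0" using e by simp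
      from bound[OF this] have "\<bar>F (displacement g)\<bar> \<le> sqrt (sqnorm F) * (e / (sqrt (sqnorm F) + 1))" .
      also have "\<dots> \<le> (sqrt (sqnorm F) + 1) * (e / (sqrt (sqnorm F) + 1))"
        using p e by (intro mult_right_mono) auto
      also have "\<dots> = e" using p by simp
      finally show ?thesis by simp
    qed
    from field_le_epsilon[OF this] show ?thesis by simp
  qed
  note base = this
  have "F \<xi> = 0" if "\<xi> \<in> displacement_span" for \<xi>
    using that by (induction rule: displacement_span.induct) (simp_all add: base dual_add[OF F] dual_scale[OF F])
  then show ?thesis using dual_outside[OF F] by blast
qed

text \<open>The values on a dense sequence of displacements are coded into one real, used as the
  coefficient of a fixed vector \<open>v\<close>: a single line in \<open>H\<close> has enough
  points.\<close>

lemma dual_injection: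
  assumes sep: "separable_space (euclidean :: 'g topology)"
  shows "\<exists>J :: (('g \<Rightarrow> 'h) \<Rightarrow> real) \<Rightarrow> 'h. inj_on J dual"
proof (cases "\<exists>v\<in>hcarrier H. hinner H v v \<noteq> 0")
  case True
  then obtain v where v: "v \<in> hcarrier H" "hinner H v v \<noteq> 0" by blast
  obtain s :: "nat \<Rightarrow> 'g" where dense: "\<And>N x. open N \<Longrightarrow> x \<in> N \<Longrightarrow> \<exists>n. s n \<in> N"
    using dense_sequence_exists[OF sep] by blast
  obtain f :: "(nat \<Rightarrow> real) \<Rightarrow> real" where f: "inj f" using real_sequences_inject by blast
  define J where "J F = hscale H (f (\<lambda>n. F (displacement (s n)))) v" for F
  have "inj_on J dual"
  proof (rule inj_onI)
    fix F G assume F: "F \<in> dual" and G: "G \<in> dual" and "J F = J G"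
    then have "hinner H (J F) v = hinner H (J G) v" by simp
    \<comment> \<open>Pairing with \<open>v\<close> recovers the coefficient, since \<open>v\<close>
      has nonzero norm.\<close>
    then have "f (\<lambda>n. F (displacement (s n))) = f (\<lambda>n. G (displacement (s n)))"
      using v by (simp add: J_def inner_scale_left)
    then have "(\<lambda>n. F (displacement (s n))) = (\<lambda>n. G (displacement (s n)))" by (rule injD[OF f])
    then have "F (displacement (s n)) - G (displacement (s n)) = 0" for n by (simp add: fun_eq_iff)
    from dual_zero_on_dense[OF dual_diff[OF F G] dense this]
    show "F = G" by (simp add: fun_eq_iff)
  qed
  then show ?thesis by blast
next
  case False
  \<comment> \<open>All norms in \<open>H\<close> vanish, so the averaged form is zero and the dual
    is a single point.\<close>
  have "F = (\<lambda>\<xi>. 0)" if F: "F \<in> dual" for F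
  proof
    fix \<xi> show "F \<xi> = 0"
    proof (cases "\<xi> \<in> displacement_span")
      case True
      have "mean_inner \<xi> \<xi> = 0"
        using False span_closed[OF True] by (simp add: mean_inner_def mean_const)
      then show ?thesis using dual_sqrt_bound[OF F True] by simp
    qed (rule dual_outside[OF F])
  qed
  then show ?thesis by (metis inj_onI)
qed

lemma haagerup_property_of_expanding:
  assumes sep: "separable_space (euclidean :: 'g topology)"
    and proper: "metrically_proper_metric d"
    and expanding: "\<And>C. \<exists>t. \<forall>x y. t \<le> mdist d x y \<longrightarrow> C \<le> hnorm H (hdiff H (\<eta> x) (\<eta> y))"
  shows "haagerup_property TYPE('g) TYPE('h)"
proof -
  obtain J :: "(('g \<Rightarrow> 'h) \<Rightarrow> real) \<Rightarrow> 'h" where J: "inj_on J dual" using dual_injection[OF sep] by blast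
  show ?thesis
  proof (rule haagerup_property_transport[of dual_structure regular_rep "\<lambda>g. riesz (displacement g)" J])
    show "filterlim (\<lambda>n. hnorm dual_structure (riesz (displacement (g n)))) at_top sequentially"
      if g: "tends_to_infinity g" for g
      unfolding filterlim_real_at_top_iff
    proof
      fix C :: real
      \<comment> \<open>\<open>mean_inner_ge\<close> works with squares, so the target is truncated
        at 0.\<close>
      obtain t where t: "\<And>x y. t \<le> mdist d x y \<Longrightarrow> max C 0 \<le> hnorm H (hdiff H (\<eta> x) (\<eta> y))"
        using expanding by blast
      have "filterlim (\<lambda>n. mdist d (g n) 0) at_top sequentially"
        using proper g by (simp add: metrically_proper_metric_def)
      then obtain N where N: "\<And>n. n \<ge> N \<Longrightarrow> t \<le> mdist d (g n) 0"
        unfolding filterlim_real_at_top_iff by blast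
      have "C \<le> hnorm dual_structure (riesz (displacement (g n)))" if "n \<ge> N" for n
      proof -
        have "max C 0 \<le> hnorm H (displacement (g n) x)" for x
          using t[of "x + g n" x] N[OF that] compatible_invariant[OF compatible, of x "g n" 0]
          by (simp add: displacement_def)
        then have "(max C 0)\<^sup>2 \<le> mean_inner (displacement (g n)) (displacement (g n))"
          by (intro mean_inner_ge span_base) auto
        then have "max C 0 \<le> sqrt (mean_inner (displacement (g n)) (displacement (g n)))"
          by (rule real_le_rsqrt)
        then show ?thesis by (simp add: hnorm_dual riesz_dual span_base sqnorm_riesz)
      qed
      then show "\<exists>N. \<forall>n\<ge>N. C \<le> hnorm dual_structure (riesz (displacement (g n)))" by blast
    qed
  qed (use J in \<open>auto simp: hilbert_space_dual regular_rep_isometric riesz_dual span_base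
      displacement_cocycle displacement_small regular_rep_continuous simp del: dual_structure_simps(2-5)\<close>)
qed

end

section \<open>The two implications and the equivalence\<close>

lemma haagerup_property_of_coarse_embedding:
  assumes sep: "separable_space (euclidean :: 'g::topological_group_add topology)"
    and amen: "amenable TYPE('g)"
    and emb: "admits_uc_coarse_embedding TYPE('g) TYPE('h)"
  shows "haagerup_property TYPE('g) TYPE('h)"
proof -
  obtain d :: "'g metric" and H :: "'h inner_structure" and \<eta> :: "'g \<Rightarrow> 'h"
    where d: "metrically_proper_metric d" and hilb: "hilbert_space H"
      and uc: "uniformly_continuous_map d (hmetric H) \<eta>" and ce: "coarse_embedding d (hmetric H) \<eta>"
    using emb by (auto simp: admits_uc_coarse_embedding_def)
  obtain m :: "('g \<Rightarrow> real) \<Rightarrow> real"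
    where m: "mean_on_LUC m" "\<And>\<phi> g. \<phi> \<in> LUC \<Longrightarrow> m (\<lambda>x. \<phi> (x + g)) = m \<phi>"
    using amen by (auto simp: amenable_def)
  interpret hilbert_space H by (rule hilb)
  have comp: "compatible_left_invariant d" using d by (simp add: metrically_proper_metric_def)
  note ms = compatible_mspace[OF comp]
  note ceD = coarse_embeddingD[OF inner_space_axioms ms ce]
  interpret averaged_embedding H d \<eta> m
  proof
    fix e :: real assume e: "e > 0"
    show "\<exists>\<delta>>0. \<forall>x y. mdist d x y < \<delta> \<longrightarrow> hnorm H (hdiff H (\<eta> x) (\<eta> y)) < e"
      using uc e unfolding uniformly_continuous_map_def ms mdist_hmetric
      by (simp add: hdist_eq ceD(1)) blast
  qed (use comp ceD m in auto)
  show ?thesis using haagerup_property_of_expanding[OF sep d] ceD(3) by blast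
qed

lemma coarse_embedding_of_haagerup_property:
  assumes proper_ex: "\<exists>d :: 'g::topological_group_add metric. metrically_proper_metric d"
    and haag: "haagerup_property TYPE('g) TYPE('h)"
  shows "admits_uc_coarse_embedding TYPE('g) TYPE('h)"
proof -
  obtain d :: "'g metric" where d: "metrically_proper_metric d" using proper_ex by blast
  have comp: "compatible_left_invariant d"
    and d_proper: "\<And>g. tends_to_infinity g \<Longrightarrow> filterlim (\<lambda>n. mdist d (g n) 0) at_top sequentially"
    using d by (simp_all add: metrically_proper_metric_def)
  obtain H :: "'h inner_structure" and \<alpha> :: "'g \<Rightarrow> 'h \<Rightarrow> 'h" where hilb: "hilbert_space H"
    and aff: "affine_isometric_action H \<alpha>" and cont: "continuous_action H \<alpha>"
    and \<alpha>_proper: "metrically_proper_action H \<alpha>"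
    using haag by (auto simp: haagerup_property_def)
  interpret hilbert_space H by (rule hilb)
  interpret M: Metric_space "hcarrier H" "hdist H" by (rule Metric_space_hdist)
  obtain \<pi> b where rep: "isometric_representation H \<pi>" and b: "\<And>g. b g \<in> hcarrier H"
    and cocycle: "\<And>g f. b (g + f) = hadd H (\<pi> g (b f)) (b g)"
    and \<alpha>: "\<And>g \<xi>. \<xi> \<in> hcarrier H \<Longrightarrow> \<alpha> g \<xi> = hadd H (\<pi> g \<xi>) (b g)"
    using aff unfolding affine_isometric_action_def by blast
  note rf = isometric_representation_facts[OF rep]
  have diff_zero: "hdiff H x (hzero H) = x" if "x \<in> hcarrier H" for x
    using hdiff_hadd_cancel[of "hzero H" x] that by (simp add: add_commute zero_closed add_zero)
  have norm_zero: "hnorm H (hzero H) = 0" by (simp add: hnorm_def inner_zero)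
  have \<pi>0: "\<pi> g (hzero H) = hzero H" for g
  proof (rule inner_eq_zero)
    show "hinner H (\<pi> g (hzero H)) (\<pi> g (hzero H)) = 0"
      using rf(2)[OF zero_closed, of g] hnorm_sq[OF rf(1)[OF zero_closed], of g] norm_zero by simp
  qed (intro rf zero_closed)
  have \<alpha>0: "\<alpha> g (hzero H) = b g" for g
    using add_commute[OF zero_closed b] by (simp add: \<alpha> zero_closed \<pi>0 b add_zero)
  have b0: "b 0 = hzero H"
  proof -
    have "b 0 = hadd H (b 0) (b 0)" using cocycle[of 0 0] by (simp add: rf(5) b)
    then have "hdiff H (b 0) (b 0) = b 0" using hdiff_hadd_cancel[OF b b, of 0 0] by simp
    then show ?thesis using hdiff_eq_zero[OF b b, of 0 0] by simp
  qed
  define L where "L g = hnorm H (b g)" for g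
  \<comment> \<open>By the cocycle identity \<open>b x - b y\<close> is \<open>\<pi> y\<close>
    applied to \<open>b (- y + x)\<close>, so the orbit map pulls the norm back to a left-invariant
    pseudometric with length \<open>L\<close>.\<close>
  have dist: "hnorm H (hdiff H (b x) (b y)) = L (- y + x)" for x y
  proof -
    have "b x = hadd H (b y) (\<pi> y (b (- y + x)))"
      using cocycle[of y "- y + x"] by (simp add: add.assoc[symmetric] add_commute b rf(1))
    then have "hdiff H (b x) (b y) = \<pi> y (b (- y + x))" by (simp add: hdiff_hadd_cancel b rf(1))
    then show ?thesis by (simp add: L_def rf(2) b)
  qed
  have L_nonneg: "0 \<le> L x" for x by (simp add: L_def hnorm_nonneg b)
  have L_zero: "L 0 = 0" by (simp add: L_def b0 norm_zero)
  have L_uminus: "L (- x) = L x" for x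
    using dist[of x 0] dist[of 0 x] hnorm_hdiff_commute[OF b b, of x 0] by simp
  have L_add: "L (x + y) \<le> L x + L y" for x y
    using hnorm_triangle[OF rf(1)[OF b] b, of x y x] by (simp add: L_def cocycle rf(2) b)
  have L_small: "\<exists>U. open U \<and> 0 \<in> U \<and> (\<forall>x\<in>U. L x < e)" if e: "e > 0" for e
  proof -
    have "continuous_map (prod_topology euclidean M.mtopology) M.mtopology (\<lambda>(g, \<xi>). \<alpha> g \<xi>)"
      using cont by (simp add: continuous_action_def mtopology_of_def)
    then obtain N where N: "openin (prod_topology euclidean M.mtopology) N" "(0, hzero H) \<in> N"
      "\<And>y. y \<in> N \<Longrightarrow> (\<lambda>(g, \<xi>). \<alpha> g \<xi>) y \<in> M.mball ((\<lambda>(g, \<xi>). \<alpha> g \<xi>) (0, hzero H)) e"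
      using e zero_closed unfolding M.continuous_map_to_metric by force
    obtain U V where U: "openin euclidean U" and UV: "0 \<in> U" "hzero H \<in> V" "U \<times> V \<subseteq> N"
      using N(1,2) unfolding openin_prod_topology_alt by blast
    have "open U" using U by (simp only: open_openin[symmetric])
    have "L g < e" if "g \<in> U" for g
    proof -
      have "b g \<in> M.mball (hzero H) e" using N(3)[of "(g, hzero H)"] that UV by (auto simp: \<alpha>0 b0)
      then have "hnorm H (hdiff H (hzero H) (b g)) < e" by (auto simp: M.in_mball hdist_eq)
      then show ?thesis using hnorm_hdiff_commute[OF zero_closed b] by (simp add: diff_zero b L_def)
    qed
    with \<open>open U\<close> UV(1) show ?thesis by blast
  qed
  have L_proper: "filterlim (\<lambda>n. L (g n)) at_top sequentially" if "tends_to_infinity g" for g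
    using \<alpha>_proper that zero_closed unfolding metrically_proper_action_def
    by (auto simp: \<alpha>0 diff_zero b L_def dest!: bspec[OF _ zero_closed])
  note len = compatible_length[OF comp]
  note ms = compatible_mspace[OF comp]
  have d0: "mdist d 0 x = 0 \<longleftrightarrow> x = 0" for x using mdist_zero[where m = d and x = 0 and y = x] unfolding ms by auto
  \<comment> \<open>\<open>L\<close> may vanish away from \<open>0\<close>. The summand from
    \<open>d\<close> supplies definiteness and a neighbourhood base, and continuity of
    \<open>L\<close> at \<open>0\<close> keeps the topology from becoming finer.\<close>
  define D where "D x = mdist d 0 x + L x" for x
  have D: "compatible_left_invariant (metric (UNIV, \<lambda>x y. D (- x + y)))"
    and D_dist: "mdist (metric (UNIV, \<lambda>x y. D (- x + y))) = (\<lambda>x y. D (- x + y))"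
  proof -
    have 1: "0 \<le> D x" for x by (simp add: D_def L_nonneg add_nonneg_nonneg)
    have 2: "D x = 0 \<longleftrightarrow> x = 0" for x
      using L_nonneg[of x] mdist_nonneg[of d 0 x] d0[of x] L_zero
      by (auto simp: D_def add_nonneg_eq_0_iff)
    have 3: "D (- x) = D x" for x by (simp add: D_def len(2) L_uminus)
    have 4: "D (x + y) \<le> D x + D y" for x y
      using len(3)[of x y] L_add[of x y] by (simp add: D_def)
    have 5: "\<exists>U. open U \<and> 0 \<in> U \<and> (\<forall>x\<in>U. D x < e)" if e: "e > 0" for e
    proof -
      have e2: "e / 2 > 0" using e by simp
      obtain U where U: "open U" "0 \<in> U" "\<And>x. x \<in> U \<Longrightarrow> L x < e / 2" using L_small[OF e2] by blast
      let ?V = "{y. mdist d 0 y < e / 2} \<inter> U"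
      have "open ?V" by (intro open_Int U compatible_open_ball[OF comp])
      moreover have "0 \<in> ?V" using U(2) e2 d0[of 0] by simp
      moreover have "D x < e" if "x \<in> ?V" for x using U(3)[of x] that by (simp add: D_def)
      ultimately show ?thesis by blast
    qed
    have 6: "\<exists>e>0. \<forall>x. D x < e \<longrightarrow> x \<in> U" if U: "open U" "0 \<in> U" for U
    proof -
      obtain e where e: "e > 0" "\<And>y. mdist d 0 y < e \<Longrightarrow> y \<in> U"
        using compatible_base[OF comp U] by blast
      have "mdist d 0 x \<le> D x" for x by (simp add: D_def L_nonneg)
      then show ?thesis using e by (meson le_less_trans)
    qed
    show "compatible_left_invariant (metric (UNIV, \<lambda>x y. D (- x + y)))"
      and "mdist (metric (UNIV, \<lambda>x y. D (- x + y))) = (\<lambda>x y. D (- x + y))"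
      using compatible_left_invariantI[of D, OF 1 2 3 4 5 6] by blast+
  qed
  have expansion: "\<exists>C. \<forall>x. mdist d 0 x \<le> t \<longrightarrow> L x \<le> C" for t
  proof (rule ccontr)
    assume "\<not> ?thesis"
    then have "\<forall>n. \<exists>x. mdist d 0 x \<le> t \<and> real n \<le> L x" by (meson not_le less_imp_le)
    from choice[OF this] obtain g where g: "\<And>n. mdist d 0 (g n) \<le> t" "\<And>n. real n \<le> L (g n)" by blast
    have "filterlim (\<lambda>n. mdist (metric (UNIV, \<lambda>x y. D (- x + y))) (g n) 0) at_top sequentially"
      unfolding D_dist
    proof (rule filterlim_at_top_mono[OF filterlim_real_sequentially always_eventually], rule allI)
      show "real n \<le> D (- g n + 0)" for n
        using g(2)[of n] by (simp add: D_def len(2) L_uminus add_increasing)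
    qed
    then have "tends_to_infinity g" using D unfolding tends_to_infinity_def by blast
    then obtain n where "t + 1 \<le> mdist d (g n) 0"
      using d_proper unfolding filterlim_real_at_top_iff by blast
    then show False using g(1)[of n] by (simp add: mdist_commute)
  qed
  \<comment> \<open>Here the roles are exchanged: \<open>d\<close> itself witnesses that the
    sequence tends to infinity, and properness of the action is contradicted.\<close>
  have compression: "\<exists>t. \<forall>x. t \<le> mdist d 0 x \<longrightarrow> C \<le> L x" for C
  proof (rule ccontr)
    assume "\<not> ?thesis"
    then have "\<forall>n. \<exists>x. real n \<le> mdist d 0 x \<and> L x < C" by (meson not_le)
    from choice[OF this] obtain g where g: "\<And>n. real n \<le> mdist d 0 (g n)" "\<And>n. L (g n) < C" by blast
    have "filterlim (\<lambda>n. mdist d (g n) 0) at_top sequentially"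
      by (rule filterlim_at_top_mono[OF filterlim_real_sequentially always_eventually])
        (simp add: g(1) mdist_commute[of d _ 0])
    then have "tends_to_infinity g" using comp unfolding tends_to_infinity_def by blast
    then obtain n where "C \<le> L (g n)"
      using L_proper unfolding filterlim_real_at_top_iff by blast
    then show False using g(2)[of n] by simp
  qed
  have hd: "hdist H (b x) (b y) = L (- y + x)" for x y using dist by (simp add: hdist_eq b)
  have dl: "mdist d x y = mdist d 0 (- y + x)" for x y using len(1)[of y x] by (simp add: mdist_commute)
  have uc: "uniformly_continuous_map d (hmetric H) b"
    unfolding uniformly_continuous_map_def
  proof (intro conjI allI impI)
    show "b \<in> mspace d \<rightarrow> mspace (hmetric H)" by (simp add: b)
    fix e :: real assume e: "e > 0"
    obtain U where U: "open U" "0 \<in> U" "\<And>x. x \<in> U \<Longrightarrow> L x < e" using L_small[OF e] by blast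
    obtain \<delta> where \<delta>: "\<delta> > 0" "\<And>y. mdist d 0 y < \<delta> \<Longrightarrow> y \<in> U"
      using compatible_base[OF comp U(1,2)] by blast
    have "mdist (hmetric H) (b y) (b x) < e" if "mdist d y x < \<delta>" for x y
      using U(3) \<delta>(2) that unfolding mdist_hmetric hd dl[of y x] by blast
    with \<delta>(1) show "\<exists>\<delta>>0. \<forall>x\<in>mspace d. \<forall>y\<in>mspace d.
        mdist d y x < \<delta> \<longrightarrow> mdist (hmetric H) (b y) (b x) < e"
      by blast
  qed
  have ce: "coarse_embedding d (hmetric H) b"
    unfolding coarse_embedding_def
  proof (intro conjI allI impI)
    show "b \<in> mspace d \<rightarrow> mspace (hmetric H)" by (simp add: b)
    show "expansion_modulus d (hmetric H) b t < \<infinity>" for t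
    proof -
      obtain C where C: "\<And>x. mdist d 0 x \<le> t \<Longrightarrow> L x \<le> C" using expansion by blast
      have C: "hdist H (b x) (b y) \<le> C" if "mdist d x y \<le> t" for x y
        using that C unfolding hd dl[of x y] by blast
      have "expansion_modulus d (hmetric H) b t \<le> ereal C"
        unfolding expansion_modulus_def by (intro Sup_least) (use C in auto)
      then show ?thesis by (rule le_less_trans) simp
    qed
    show "(compression_modulus d (hmetric H) b \<longlongrightarrow> \<infinity>) at_top"
      unfolding tendsto_PInfty
    proof
      fix r
      \<comment> \<open>An infimum of numbers above \<open>r\<close> may equal \<open>r\<close>; the
        margin 1 keeps the inequality strict.\<close>
      obtain t0 where t0: "\<And>x. t0 \<le> mdist d 0 x \<Longrightarrow> r + 1 \<le> L x" using compression by blast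
      have t0: "r + 1 \<le> hdist H (b x) (b y)" if "t0 \<le> mdist d x y" for x y
        using that t0 unfolding hd dl[of x y] by blast
      have "ereal r < compression_modulus d (hmetric H) b t" if "t \<ge> t0" for t
      proof -
        have "ereal (r + 1) \<le> compression_modulus d (hmetric H) b t"
          unfolding compression_modulus_def
          by (intro Inf_greatest) (use t0 order_trans[OF that] in auto)
        moreover have "ereal r < ereal (r + 1)" by simp
        ultimately show ?thesis by (rule less_le_trans[rotated])
      qed
      then show "\<forall>\<^sub>F t in at_top. ereal r < compression_modulus d (hmetric H) b t"
        unfolding eventually_at_top_linorder by blast
    qed
  qed
  show ?thesis
    unfolding admits_uc_coarse_embedding_def using d hilb uc ce by blast
qed

theorem theorem49:
  assumes "metrizable_space (euclidean :: 'g::topological_group_add topology)"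
    and "separable_space (euclidean :: 'g topology)"
    and "locally_OB TYPE('g)"
    and "amenable TYPE('g)"
  shows "admits_uc_coarse_embedding TYPE('g) TYPE('h) \<longleftrightarrow> haagerup_property TYPE('g) TYPE('h)"
  using haagerup_property_of_coarse_embedding[OF assms(2,4)]
    coarse_embedding_of_haagerup_property[OF metrically_proper_metric_exists[OF assms(1-3)]]
  by blast

end
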